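(* Let $G$ be a Lie group whose Lie algebra $\mathfrak g$ carries an invariant inner product $B$. Let $(M,\mathcal A_M,\omega,\Phi)$ be a q-Hamiltonian $G\times G$-manifold. Let $\mathcal A_{\mathrm{fus}}$ be the diagonal $G$-action, $\Phi_{\mathrm{fus}}=\mathrm{Mult}\circ\Phi$, and $\omega_{\mathrm{fus}}=\omega+\Phi^*\varsigma$, with $\varsigma=-\frac12B(\theta^{L,1},\theta^{R,2})\in\Omega^2(G\times G)$. Then $(M,\mathcal A_{\mathrm{fus}},\omega_{\mathrm{fus}},\Phi_{\mathrm{fus}})$ is a q-Hamiltonian $G$-manifold. (An analogous statement holds for q-Hamiltonian $\mathfrak g\times\mathfrak g$-manifolds: with $\mathcal A_{\mathrm{fus}}$ the diagonal $\mathfrak g$-action, one obtains a q-Hamiltonian $\mathfrak g$-manifold.)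
   Context: $B$ is an $\mathrm{Ad}$-invariant non-degenerate symmetric bilinear form on $\mathfrak g$ (not necessarily positive definite; $G$ need not be compact or connected). $\theta^L,\theta^R$ are the left-/right-Maurer–Cartan forms on $G$, $\eta=\frac1{12}B(\theta^L,[\theta^L,\theta^L])$; superscripts $1,2$ denote pull-back to the factors of $G\times G$; $B(\alpha,\beta)(X,Y)=B(\alpha(X),\beta(Y))-B(\alpha(Y),\beta(X))$ for $\mathfrak g$-valued 1-forms; $\mathrm{Mult}(a,b)=ab$. A Lie algebra action is a Lie algebra homomorphism $\mathcal A_M:\mathfrak g\to\mathfrak X(M)$ with $\mathfrak g\times M\to TM$ smooth; a $G$-action $\mathcal A_M$ induces $\mathcal A_M(\xi)f=\frac{\partial}{\partial t}|_{t=0}\mathcal A_M(\exp(-t\xi))^*f$. On $G$ itself one uses the conjugation action, with generating vector fields $\xi^L-\xi^R$. A q-Hamiltonian $\mathfrak g$-manifold is a manifold $M$ with a $\mathfrak g$-action $\mathcal A_M$, a 2-form $\omega$ and a $\mathfrak g$-equivariant map $\Phi:M\to G$ such that (1) $\mathrm d\omega=\Phi^*\eta$; (2) $\iota(\mathcal A_M(\xi))\omega=\Phi^*B(\xi,\frac{\theta^L+\theta^R}2)$ for all $\xi\in\mathfrak g$; (3) $\ker(\omega_m)=\{\mathcal A_M(\xi)_m:\mathrm{Ad}_{\Phi(m)}\xi=-\xi\}$ for all $m\in M$. If the action extends to an action of $G$ for which $\omega$ is invariant and $\Phi$ equivariant, it is a q-Hamiltonian $G$-manifold. A q-Hamiltonian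 $G\times G$-manifold (or $\mathfrak g\times\mathfrak g$-manifold) is defined in the same way for the group $G\times G$ with inner product $B\oplus B$ on $\mathfrak g\oplus\mathfrak g$. *)

theory Defs
  imports "HOL-Analysis.Analysis" "HOL-Algebra.Group"
begin

section \<open>Smooth manifolds\<close>

text \<open>
  \<open>Ck_on V S k f\<close>: the map \<open>f\<close> is of class \<open>C\<close>-\<open>k\<close> on \<open>S\<close>, where \<open>S\<close> is a relatively open subset of the
  linear subspace \<open>V\<close>. Only the values \<open>f' x v\<close> with \<open>v \<in> V\<close> matter, and these are determined by
  the derivative at \<open>x\<close> within \<open>S\<close>.
\<close>

primrec Ck_on :: "'a::euclidean_space set \<Rightarrow> 'a set \<Rightarrow> nat \<Rightarrow> ('a \<Rightarrow> 'b::real_normed_vector) \<Rightarrow> bool" where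
  "Ck_on V S 0 f \<longleftrightarrow> continuous_on S f"
| "Ck_on V S (Suc k) f \<longleftrightarrow>
     (\<exists>f'. (\<forall>x\<in>S. (f has_derivative f' x) (at x within S)) \<and> (\<forall>v\<in>V. Ck_on V S k (\<lambda>x. f' x v)))"

definition smooth_on :: "'a::euclidean_space set \<Rightarrow> 'a set \<Rightarrow> ('a \<Rightarrow> 'b::real_normed_vector) \<Rightarrow> bool" where
  "smooth_on V S f \<longleftrightarrow> (\<forall>k. Ck_on V S k f)"

text \<open>
  The underlying set of a manifold is the whole type \<open>'m\<close>; Hausdorffness and second countability are
  the type classes of \<open>'m\<close>. The model space is a linear subspace of \<open>'e\<close> rather than \<open>'e\<close> itself
  because every type of class \<open>euclidean_space\<close> has positive dimension, whereas manifolds of dimension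
  zero (e.g. discrete Lie groups) are to be included. A chart is a pair of its domain and
  coordinate map; the atlas need not be maximal.
\<close>

record ('m, 'e) mfd =
  model :: "'e set"
  atlas :: "('m set \<times> ('m \<Rightarrow> 'e)) set"

definition smooth_manifold ::
    "('m::{t2_space,second_countable_topology}, 'e::euclidean_space) mfd \<Rightarrow> bool" where
  "smooth_manifold M \<longleftrightarrow>
     subspace (model M) \<and>
     (\<Union>(U, \<phi>)\<in>atlas M. U) = UNIV \<and>
     (\<forall>(U, \<phi>)\<in>atlas M.
        open U \<and> openin (top_of_set (model M)) (\<phi> ` U) \<and>
        homeomorphism U (\<phi> ` U) \<phi> (inv_into U \<phi>)) \<and>
     (\<forall>(U, \<phi>)\<in>atlas M. \<forall>(W, \<psi>)\<in>atlas M.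
        smooth_on (model M) (\<phi> ` (U \<inter> W)) (\<psi> \<circ> inv_into U \<phi>))"

definition smooth_map ::
    "('m::topological_space, 'e::euclidean_space) mfd \<Rightarrow> ('n::topological_space, 'f::euclidean_space) mfd
      \<Rightarrow> ('m \<Rightarrow> 'n) \<Rightarrow> bool" where
  "smooth_map M N f \<longleftrightarrow>
     continuous_on UNIV f \<and>
     (\<forall>(U, \<phi>)\<in>atlas M. \<forall>(W, \<psi>)\<in>atlas N.
        smooth_on (model M) (\<phi> ` (U \<inter> f -` W)) (\<psi> \<circ> f \<circ> inv_into U \<phi>))"

definition euclid :: "('e::euclidean_space, 'e) mfd" where
  "euclid = \<lparr>model = UNIV, atlas = {(UNIV, id)}\<rparr>"

abbreviation line :: "(real, real) mfd" where
  "line \<equiv> euclid"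

definition prod_mfd :: "('m, 'e) mfd \<Rightarrow> ('n, 'f) mfd \<Rightarrow> ('m \<times> 'n, 'e \<times> 'f) mfd" where
  "prod_mfd M N =
     \<lparr>model = model M \<times> model N,
      atlas = (\<lambda>((U, \<phi>), (W, \<psi>)). (U \<times> W, map_prod \<phi> \<psi>)) ` (atlas M \<times> atlas N)\<rparr>"

definition smooth_fun :: "('m::topological_space, 'e::euclidean_space) mfd \<Rightarrow> ('m \<Rightarrow> real) set" where
  "smooth_fun M = {f. smooth_map M line f}"


section \<open>Tangent vectors and vector fields\<close>

text \<open>
  Tangent vectors at \<open>p\<close> are the derivations at \<open>p\<close> of the algebra of smooth functions. As HOL
  functions are total, a derivation is normalised to be zero on functions that are not smooth.
\<close>

type_synonym 'm tvec = "('m \<Rightarrow> real) \<Rightarrow> real"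

definition tangent :: "('m::topological_space, 'e::euclidean_space) mfd \<Rightarrow> 'm \<Rightarrow> 'm tvec set" where
  "tangent M p = {v.
     (\<forall>f\<in>smooth_fun M. \<forall>g\<in>smooth_fun M. \<forall>a b. v (\<lambda>x. a * f x + b * g x) = a * v f + b * v g) \<and>
     (\<forall>f\<in>smooth_fun M. \<forall>g\<in>smooth_fun M. v (\<lambda>x. f x * g x) = f p * v g + g p * v f) \<and>
     (\<forall>f. f \<notin> smooth_fun M \<longrightarrow> v f = 0)}"

definition lincomb :: "real \<Rightarrow> 'm tvec \<Rightarrow> real \<Rightarrow> 'm tvec \<Rightarrow> 'm tvec" where
  "lincomb a u b v = (\<lambda>f. a * u f + b * v f)"

definition tscale :: "real \<Rightarrow> 'm tvec \<Rightarrow> 'm tvec" where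
  "tscale a u = (\<lambda>f. a * u f)"

definition tdiff :: "'m tvec \<Rightarrow> 'm tvec \<Rightarrow> 'm tvec" where
  "tdiff u v = (\<lambda>f. u f - v f)"

definition dmap ::
    "('n::topological_space, 'f::euclidean_space) mfd \<Rightarrow> ('m \<Rightarrow> 'n) \<Rightarrow> 'm tvec \<Rightarrow> 'n tvec" where
  "dmap N F v = (\<lambda>h. if h \<in> smooth_fun N then v (h \<circ> F) else 0)"

definition vector_fields ::
    "('m::topological_space, 'e::euclidean_space) mfd \<Rightarrow> ('m \<Rightarrow> 'm tvec) set" where
  "vector_fields M =
     {X. (\<forall>p. X p \<in> tangent M p) \<and> (\<forall>f\<in>smooth_fun M. (\<lambda>p. X p f) \<in> smooth_fun M)}"

definition vf_bracket :: "('m \<Rightarrow> 'm tvec) \<Rightarrow> ('m \<Rightarrow> 'm tvec) \<Rightarrow> 'm \<Rightarrow> 'm tvec" where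
  "vf_bracket X Y = (\<lambda>p f. X p (\<lambda>q. Y q f) - Y p (\<lambda>q. X q f))"


section \<open>Differential forms\<close>

text \<open>
  A form is a family of functions of tangent vectors; its values on arguments that are not tangent
  vectors at the given point are irrelevant.
\<close>

type_synonym 'm form2 = "'m \<Rightarrow> 'm tvec \<Rightarrow> 'm tvec \<Rightarrow> real"
type_synonym 'm form3 = "'m \<Rightarrow> 'm tvec \<Rightarrow> 'm tvec \<Rightarrow> 'm tvec \<Rightarrow> real"

definition bilinear_on_tangent ::
    "('m::topological_space, 'e::euclidean_space) mfd \<Rightarrow> 'm \<Rightarrow> ('m tvec \<Rightarrow> 'm tvec \<Rightarrow> real) \<Rightarrow> bool" where
  "bilinear_on_tangent M p \<beta> \<longleftrightarrow>
     (\<forall>u\<in>tangent M p. \<forall>v\<in>tangent M p. \<forall>w\<in>tangent M p. \<forall>a b.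
        \<beta> (lincomb a u b v) w = a * \<beta> u w + b * \<beta> v w \<and>
        \<beta> w (lincomb a u b v) = a * \<beta> w u + b * \<beta> w v)"

definition two_form :: "('m::topological_space, 'e::euclidean_space) mfd \<Rightarrow> 'm form2 \<Rightarrow> bool" where
  "two_form M \<omega> \<longleftrightarrow>
     (\<forall>p. bilinear_on_tangent M p (\<omega> p) \<and> (\<forall>v\<in>tangent M p. \<omega> p v v = 0)) \<and>
     (\<forall>X\<in>vector_fields M. \<forall>Y\<in>vector_fields M. (\<lambda>p. \<omega> p (X p) (Y p)) \<in> smooth_fun M)"

text \<open>The value of \<open>d \<omega>\<close> on three vector fields, by the invariant (Koszul) formula.\<close>

definition ext_d2 ::
    "'m form2 \<Rightarrow> ('m \<Rightarrow> 'm tvec) \<Rightarrow> ('m \<Rightarrow> 'm tvec) \<Rightarrow> ('m \<Rightarrow> 'm tvec) \<Rightarrow> 'm \<Rightarrow> real" where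
  "ext_d2 \<omega> X Y Z p =
     X p (\<lambda>q. \<omega> q (Y q) (Z q)) - Y p (\<lambda>q. \<omega> q (X q) (Z q)) + Z p (\<lambda>q. \<omega> q (X q) (Y q))
     - \<omega> p (vf_bracket X Y p) (Z p) + \<omega> p (vf_bracket X Z p) (Y p) - \<omega> p (vf_bracket Y Z p) (X p)"

definition d_eq ::
    "('m::topological_space, 'e::euclidean_space) mfd \<Rightarrow> 'm form2 \<Rightarrow> 'm form3 \<Rightarrow> bool" where
  "d_eq M \<omega> \<tau> \<longleftrightarrow>
     (\<forall>X\<in>vector_fields M. \<forall>Y\<in>vector_fields M. \<forall>Z\<in>vector_fields M. \<forall>p.
        ext_d2 \<omega> X Y Z p = \<tau> p (X p) (Y p) (Z p))"

definition pull2 ::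
    "('n::topological_space, 'f::euclidean_space) mfd \<Rightarrow> ('m \<Rightarrow> 'n) \<Rightarrow> 'n form2 \<Rightarrow> 'm form2" where
  "pull2 N F \<omega> = (\<lambda>p u v. \<omega> (F p) (dmap N F u) (dmap N F v))"

definition pull3 ::
    "('n::topological_space, 'f::euclidean_space) mfd \<Rightarrow> ('m \<Rightarrow> 'n) \<Rightarrow> 'n form3 \<Rightarrow> 'm form3" where
  "pull3 N F \<tau> = (\<lambda>p u v w. \<tau> (F p) (dmap N F u) (dmap N F v) (dmap N F w))"


section \<open>Lie groups\<close>

definition lie_group ::
    "'g::{t2_space,second_countable_topology} monoid \<Rightarrow> ('g, 'e::euclidean_space) mfd \<Rightarrow> bool" where
  "lie_group G GM \<longleftrightarrow>
     group G \<and> carrier G = UNIV \<and> smooth_manifold GM \<and>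
     smooth_map (prod_mfd GM GM) GM (\<lambda>(a, b). a \<otimes>\<^bsub>G\<^esub> b) \<and>
     smooth_map GM GM (\<lambda>a. inv\<^bsub>G\<^esub> a)"

text \<open>The Lie algebra is the tangent space at the unit, with the bracket of left-invariant fields.\<close>

definition lie_alg :: "'g monoid \<Rightarrow> ('g::topological_space, 'e::euclidean_space) mfd \<Rightarrow> 'g tvec set" where
  "lie_alg G GM = tangent GM \<one>\<^bsub>G\<^esub>"

definition left_inv_field ::
    "'g monoid \<Rightarrow> ('g::topological_space, 'e::euclidean_space) mfd \<Rightarrow> 'g tvec \<Rightarrow> 'g \<Rightarrow> 'g tvec" where
  "left_inv_field G GM \<xi> g = dmap GM (\<lambda>x. g \<otimes>\<^bsub>G\<^esub> x) \<xi>"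

definition right_inv_field ::
    "'g monoid \<Rightarrow> ('g::topological_space, 'e::euclidean_space) mfd \<Rightarrow> 'g tvec \<Rightarrow> 'g \<Rightarrow> 'g tvec" where
  "right_inv_field G GM \<xi> g = dmap GM (\<lambda>x. x \<otimes>\<^bsub>G\<^esub> g) \<xi>"

definition lie_br ::
    "'g monoid \<Rightarrow> ('g::topological_space, 'e::euclidean_space) mfd \<Rightarrow> 'g tvec \<Rightarrow> 'g tvec \<Rightarrow> 'g tvec" where
  "lie_br G GM \<xi> \<zeta> = vf_bracket (left_inv_field G GM \<xi>) (left_inv_field G GM \<zeta>) \<one>\<^bsub>G\<^esub>"

definition Ad ::
    "'g monoid \<Rightarrow> ('g::topological_space, 'e::euclidean_space) mfd \<Rightarrow> 'g \<Rightarrow> 'g tvec \<Rightarrow> 'g tvec" where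
  "Ad G GM g \<xi> = dmap GM (\<lambda>x. g \<otimes>\<^bsub>G\<^esub> x \<otimes>\<^bsub>G\<^esub> inv\<^bsub>G\<^esub> g) \<xi>"

definition MC_L ::
    "'g monoid \<Rightarrow> ('g::topological_space, 'e::euclidean_space) mfd \<Rightarrow> 'g \<Rightarrow> 'g tvec \<Rightarrow> 'g tvec" where
  "MC_L G GM g v = dmap GM (\<lambda>x. inv\<^bsub>G\<^esub> g \<otimes>\<^bsub>G\<^esub> x) v"

definition MC_R ::
    "'g monoid \<Rightarrow> ('g::topological_space, 'e::euclidean_space) mfd \<Rightarrow> 'g \<Rightarrow> 'g tvec \<Rightarrow> 'g tvec" where
  "MC_R G GM g v = dmap GM (\<lambda>x. x \<otimes>\<^bsub>G\<^esub> inv\<^bsub>G\<^esub> g) v"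

definition velocity0 ::
    "('m::topological_space, 'e::euclidean_space) mfd \<Rightarrow> (real \<Rightarrow> 'm) \<Rightarrow> 'm tvec" where
  "velocity0 M \<gamma> = (\<lambda>f. if f \<in> smooth_fun M then deriv (\<lambda>t. f (\<gamma> t)) 0 else 0)"

definition one_param_subgroup ::
    "'g monoid \<Rightarrow> ('g::topological_space, 'e::euclidean_space) mfd \<Rightarrow> (real \<Rightarrow> 'g) \<Rightarrow> bool" where
  "one_param_subgroup G GM \<gamma> \<longleftrightarrow>
     smooth_map line GM \<gamma> \<and> (\<forall>s t. \<gamma> (s + t) = \<gamma> s \<otimes>\<^bsub>G\<^esub> \<gamma> t)"

definition lie_exp ::
    "'g monoid \<Rightarrow> ('g::topological_space, 'e::euclidean_space) mfd \<Rightarrow> 'g tvec \<Rightarrow> 'g" where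
  "lie_exp G GM \<xi> = (THE \<gamma>. one_param_subgroup G GM \<gamma> \<and> velocity0 GM \<gamma> = \<xi>) 1"

text \<open>Non-degenerate, but not necessarily definite.\<close>

definition inv_inner_product ::
    "'g monoid \<Rightarrow> ('g::topological_space, 'e::euclidean_space) mfd \<Rightarrow> ('g tvec \<Rightarrow> 'g tvec \<Rightarrow> real) \<Rightarrow> bool" where
  "inv_inner_product G GM B \<longleftrightarrow>
     bilinear_on_tangent GM \<one>\<^bsub>G\<^esub> B \<and>
     (\<forall>\<xi>\<in>lie_alg G GM. \<forall>\<zeta>\<in>lie_alg G GM. B \<xi> \<zeta> = B \<zeta> \<xi>) \<and>
     (\<forall>\<xi>\<in>lie_alg G GM. (\<forall>\<zeta>\<in>lie_alg G GM. B \<xi> \<zeta> = 0) \<longrightarrow> \<xi> = (\<lambda>f. 0)) \<and>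
     (\<forall>g. \<forall>\<xi>\<in>lie_alg G GM. \<forall>\<zeta>\<in>lie_alg G GM. B (Ad G GM g \<xi>) (Ad G GM g \<zeta>) = B \<xi> \<zeta>)"

text \<open>
  \<open>MC_LL\<close> is \<open>[\<theta>\<^sup>L,\<theta>\<^sup>L]\<close>, with the same convention as for \<open>B(\<alpha>,\<beta>)\<close>; \<open>eta\<close> is
  \<open>1/12 B(\<theta>\<^sup>L,[\<theta>\<^sup>L,\<theta>\<^sup>L])\<close>, where the product of a 1-form and a 2-form is the sum over the cyclic
  permutations of the arguments.
\<close>

definition MC_LL ::
    "'g monoid \<Rightarrow> ('g::topological_space, 'e::euclidean_space) mfd \<Rightarrow> 'g \<Rightarrow> 'g tvec \<Rightarrow> 'g tvec \<Rightarrow> 'g tvec" where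
  "MC_LL G GM g u v =
     tdiff (lie_br G GM (MC_L G GM g u) (MC_L G GM g v)) (lie_br G GM (MC_L G GM g v) (MC_L G GM g u))"

definition eta ::
    "'g monoid \<Rightarrow> ('g::topological_space, 'e::euclidean_space) mfd \<Rightarrow> ('g tvec \<Rightarrow> 'g tvec \<Rightarrow> real)
      \<Rightarrow> 'g form3" where
  "eta G GM B g u v w = (1/12) *
     (B (MC_L G GM g u) (MC_LL G GM g v w) +
      B (MC_L G GM g v) (MC_LL G GM g w u) +
      B (MC_L G GM g w) (MC_LL G GM g u v))"


section \<open>Actions\<close>

definition lie_group_action ::
    "'g monoid \<Rightarrow> ('g::topological_space, 'e::euclidean_space) mfd
      \<Rightarrow> ('m::topological_space, 'd::euclidean_space) mfd \<Rightarrow> ('g \<Rightarrow> 'm \<Rightarrow> 'm) \<Rightarrow> bool" where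
  "lie_group_action G GM M \<rho> \<longleftrightarrow>
     (\<forall>m. \<rho> \<one>\<^bsub>G\<^esub> m = m) \<and> (\<forall>a b m. \<rho> (a \<otimes>\<^bsub>G\<^esub> b) m = \<rho> a (\<rho> b m)) \<and>
     smooth_map (prod_mfd GM M) M (\<lambda>(g, m). \<rho> g m)"

definition induced ::
    "'g monoid \<Rightarrow> ('g::topological_space, 'e::euclidean_space) mfd
      \<Rightarrow> ('m::topological_space, 'd::euclidean_space) mfd \<Rightarrow> ('g \<Rightarrow> 'm \<Rightarrow> 'm)
      \<Rightarrow> 'g tvec \<Rightarrow> 'm \<Rightarrow> 'm tvec" where
  "induced G GM M \<rho> \<xi> m = velocity0 M (\<lambda>t. \<rho> (lie_exp G GM (tscale (- t) \<xi>)) m)"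

text \<open>
  The last clause expresses smoothness of the map from \<open>\<gg> \<times> M\<close> to \<open>TM\<close>: a map into \<open>TM\<close> over a
  smooth map into \<open>M\<close> is smooth iff its composite with \<open>df\<close> is smooth for every smooth \<open>f\<close>, and
  smoothness on the vector space \<open>\<gg>\<close> is tested on linear maps \<open>L\<close> from \<open>'e\<close> to \<open>\<gg>\<close> (some of
  which are onto, as the dimension of \<open>\<gg>\<close> is at most that of \<open>'e\<close>).
\<close>

definition lie_alg_action ::
    "'g monoid \<Rightarrow> ('g::topological_space, 'e::euclidean_space) mfd
      \<Rightarrow> ('m::topological_space, 'd::euclidean_space) mfd \<Rightarrow> ('g tvec \<Rightarrow> 'm \<Rightarrow> 'm tvec) \<Rightarrow> bool" where
  "lie_alg_action G GM M \<A> \<longleftrightarrow>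
     (\<forall>\<xi>\<in>lie_alg G GM. \<A> \<xi> \<in> vector_fields M) \<and>
     (\<forall>\<xi>\<in>lie_alg G GM. \<forall>\<zeta>\<in>lie_alg G GM. \<forall>a b m.
        \<A> (lincomb a \<xi> b \<zeta>) m = lincomb a (\<A> \<xi> m) b (\<A> \<zeta> m)) \<and>
     (\<forall>\<xi>\<in>lie_alg G GM. \<forall>\<zeta>\<in>lie_alg G GM. \<A> (lie_br G GM \<xi> \<zeta>) = vf_bracket (\<A> \<xi>) (\<A> \<zeta>)) \<and>
     (\<forall>L :: 'e \<Rightarrow> 'g tvec.
        (\<forall>x. L x \<in> lie_alg G GM) \<and>
        (\<forall>x y a b. L (a *\<^sub>R x + b *\<^sub>R y) = lincomb a (L x) b (L y)) \<longrightarrow>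
        (\<forall>f\<in>smooth_fun M. (\<lambda>(x, m). \<A> (L x) m f) \<in> smooth_fun (prod_mfd (euclid :: ('e, 'e) mfd) M)))"


section \<open>q-Hamiltonian manifolds\<close>

text \<open>
  Equivariance of \<open>\<Phi>\<close> refers to the conjugation action on the group, whose generating vector fields
  are \<open>\<xi>\<^sup>L - \<xi>\<^sup>R\<close>.
\<close>

definition qham_lie_alg ::
    "'g monoid \<Rightarrow> ('g::{t2_space,second_countable_topology}, 'e::euclidean_space) mfd
      \<Rightarrow> ('g tvec \<Rightarrow> 'g tvec \<Rightarrow> real)
      \<Rightarrow> ('m::{t2_space,second_countable_topology}, 'd::euclidean_space) mfd
      \<Rightarrow> ('g tvec \<Rightarrow> 'm \<Rightarrow> 'm tvec) \<Rightarrow> 'm form2 \<Rightarrow> ('m \<Rightarrow> 'g) \<Rightarrow> bool" where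
  "qham_lie_alg G GM B M \<A> \<omega> \<Phi> \<longleftrightarrow>
     smooth_manifold M \<and> lie_alg_action G GM M \<A> \<and> two_form M \<omega> \<and> smooth_map M GM \<Phi> \<and>
     (\<forall>\<xi>\<in>lie_alg G GM. \<forall>m.
        dmap GM \<Phi> (\<A> \<xi> m) =
          tdiff (left_inv_field G GM \<xi> (\<Phi> m)) (right_inv_field G GM \<xi> (\<Phi> m))) \<and>
     d_eq M \<omega> (pull3 GM \<Phi> (eta G GM B)) \<and>
     (\<forall>\<xi>\<in>lie_alg G GM. \<forall>m. \<forall>v\<in>tangent M m.
        \<omega> m (\<A> \<xi> m) v =
          B \<xi> (lincomb (1/2) (MC_L G GM (\<Phi> m) (dmap GM \<Phi> v))
                       (1/2) (MC_R G GM (\<Phi> m) (dmap GM \<Phi> v)))) \<and>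
     (\<forall>m. {v \<in> tangent M m. \<forall>w\<in>tangent M m. \<omega> m v w = 0} =
          {\<A> \<xi> m | \<xi>. \<xi> \<in> lie_alg G GM \<and> Ad G GM (\<Phi> m) \<xi> = tscale (- 1) \<xi>})"

definition qham_group ::
    "'g monoid \<Rightarrow> ('g::{t2_space,second_countable_topology}, 'e::euclidean_space) mfd
      \<Rightarrow> ('g tvec \<Rightarrow> 'g tvec \<Rightarrow> real)
      \<Rightarrow> ('m::{t2_space,second_countable_topology}, 'd::euclidean_space) mfd
      \<Rightarrow> ('g \<Rightarrow> 'm \<Rightarrow> 'm) \<Rightarrow> 'm form2 \<Rightarrow> ('m \<Rightarrow> 'g) \<Rightarrow> bool" where
  "qham_group G GM B M \<rho> \<omega> \<Phi> \<longleftrightarrow>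
     lie_group_action G GM M \<rho> \<and>
     qham_lie_alg G GM B M (induced G GM M \<rho>) \<omega> \<Phi> \<and>
     (\<forall>g m. \<forall>u\<in>tangent M m. \<forall>v\<in>tangent M m. pull2 M (\<rho> g) \<omega> m u v = \<omega> m u v) \<and>
     (\<forall>g m. \<Phi> (\<rho> g m) = g \<otimes>\<^bsub>G\<^esub> \<Phi> m \<otimes>\<^bsub>G\<^esub> inv\<^bsub>G\<^esub> g)"


section \<open>Fusion\<close>

text \<open>
  The Lie algebra of \<open>G \<times> G\<close> is its tangent space at the unit, identified with \<open>\<gg> \<oplus> \<gg>\<close> by the
  differentials of the two projections.
\<close>

definition sum_form ::
    "('g::topological_space, 'e::euclidean_space) mfd \<Rightarrow> ('g tvec \<Rightarrow> 'g tvec \<Rightarrow> real)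
      \<Rightarrow> ('g \<times> 'g) tvec \<Rightarrow> ('g \<times> 'g) tvec \<Rightarrow> real" where
  "sum_form GM B u v = B (dmap GM fst u) (dmap GM fst v) + B (dmap GM snd u) (dmap GM snd v)"

definition diag_alg ::
    "('g::topological_space, 'e::euclidean_space) mfd \<Rightarrow> 'g tvec \<Rightarrow> ('g \<times> 'g) tvec" where
  "diag_alg GM \<xi> = dmap (prod_mfd GM GM) (\<lambda>g. (g, g)) \<xi>"

definition varsigma ::
    "'g monoid \<Rightarrow> ('g::topological_space, 'e::euclidean_space) mfd \<Rightarrow> ('g tvec \<Rightarrow> 'g tvec \<Rightarrow> real)
      \<Rightarrow> ('g \<times> 'g) form2" where
  "varsigma G GM B = (\<lambda>(a, b) u v. - (1/2) *
     (B (MC_L G GM a (dmap GM fst u)) (MC_R G GM b (dmap GM snd v)) -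
      B (MC_L G GM a (dmap GM fst v)) (MC_R G GM b (dmap GM snd u))))"

definition omega_fus ::
    "'g monoid \<Rightarrow> ('g::topological_space, 'e::euclidean_space) mfd \<Rightarrow> ('g tvec \<Rightarrow> 'g tvec \<Rightarrow> real)
      \<Rightarrow> 'm form2 \<Rightarrow> ('m \<Rightarrow> 'g \<times> 'g) \<Rightarrow> 'm form2" where
  "omega_fus G GM B \<omega> \<Phi> =
     (\<lambda>m u v. \<omega> m u v + pull2 (prod_mfd GM GM) \<Phi> (varsigma G GM B) m u v)"

definition Phi_fus :: "'g monoid \<Rightarrow> ('m \<Rightarrow> 'g \<times> 'g) \<Rightarrow> 'm \<Rightarrow> 'g" where
  "Phi_fus G \<Phi> = (\<lambda>(a, b). a \<otimes>\<^bsub>G\<^esub> b) \<circ> \<Phi>"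

end

theory Submission
  imports Defs
begin

text \<open>
  With \<open>\<Phi> = (\<Phi>\<^sub>1, \<Phi>\<^sub>2)\<close>, \<open>\<alpha> = \<Phi>\<^sub>1\<^sup>*\<theta>\<^sup>L\<close> and \<open>\<beta> = \<Phi>\<^sub>2\<^sup>*\<theta>\<^sup>R\<close>, the Maurer--Cartan forms pull back along
  \<open>\<Phi>\<^sub>1\<Phi>\<^sub>2\<close> to \<open>Ad (\<Phi>\<^sub>2\<^sup>-\<^sup>1) (\<alpha> + \<beta>)\<close> and \<open>Ad \<Phi>\<^sub>1 (\<alpha> + \<beta>)\<close>. Hence the moment map condition is linear algebra, and
  the equation for \<open>d\<omega>\<close> follows from \<open>d\<alpha> = -[\<alpha>,\<alpha>]\<close>, \<open>d\<beta> = [\<beta>,\<beta>]\<close> and the invariance of \<open>B\<close> after expanding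
  \<open>B(\<alpha> + \<beta>, [\<alpha> + \<beta>, \<alpha> + \<beta>])\<close>. The minimal degeneracy condition uses only the moment map conditions on both
  sides, no dimension count.

  As tangent vectors are derivations of global smooth functions, these computations rest on four facts:
  a derivation is a directional derivative in a chart (by cutoffs and Hadamard's lemma), it obeys the
  product rule on functions of two variables, derivations in different variables commute, and a vector field
  applied to one variable of a smooth function gives a smooth function. For actions of the group \<open>G\<close> one needs
  in addition that the exponential of a diagonal element of \<open>\<gg> \<oplus> \<gg>\<close> is diagonal. As \<open>lie_exp\<close> is a definite
  description, this requires existence and uniqueness of one-parameter subgroups, hence the solution of
  an ordinary differential equation in a chart.
\<close>

section \<open>Calculus on open subsets of a linear subspace\<close>

text \<open>Charts take values in a linear subspace \<open>V\<close>, and a derivative within a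
  chart domain is not determined off \<open>V\<close>; so derivatives are taken along vectors of
  \<open>V\<close> and expanded in an orthonormal basis of \<open>V\<close>. Functions with values
  in the Lie algebra are differentiated by testing them on smooth functions \<open>h\<close> of the
  group, so that the structure equations become identities between iterated derivatives of real
  functions of two points. The coefficient in \<open>varsigma\<close> fits two computations. In the
  moment map condition its contribution cancels the terms \<open>B x (\<alpha> m v)\<close> and
  \<open>B x (\<beta> m v)\<close> and supplies the missing conjugated ones. In the equation for the
  exterior derivative the expansion has eight terms: the two pure ones come from \<omega>, the six
  mixed ones from \<open>varsigma\<close>, because \<alpha> and \<beta> satisfy structure equations
  of opposite sign. In the kernel argument, pairing with the first factor alone works because, once
  the sum of \<alpha> and \<beta> on the vector vanishes, the conjugated terms of \<omega> and of
  \<open>varsigma\<close> cancel and leave exactly \<open>B x (\<alpha> m v)\<close>.\<close>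

definition relopen :: "'a::euclidean_space set \<Rightarrow> 'a set \<Rightarrow> bool" where
  "relopen V S \<longleftrightarrow> subspace V \<and> openin (top_of_set V) S"

lemma relopen_subspace: "relopen V S \<Longrightarrow> subspace V"
  by (simp add: relopen_def)

lemma relopen_subset: "relopen V S \<Longrightarrow> S \<subseteq> V"
  by (auto simp: relopen_def dest: openin_imp_subset)

lemma relopen_Int_open: "relopen V S \<Longrightarrow> open T \<Longrightarrow> relopen V (S \<inter> T)"
  by (auto simp: relopen_def intro: openin_Int_open)

lemma relopen_UNIV: "open S \<Longrightarrow> relopen UNIV S"
  by (simp add: relopen_def)

lemma relopen_space: "subspace V \<Longrightarrow> relopen V V"
  by (simp add: relopen_def)

lemma relopen_Times:
  assumes "relopen V S" "relopen W T"
  shows "relopen (V \<times> W) (S \<times> T)"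
  using assms unfolding relopen_def by (auto intro: subspace_Times openin_Times)

text \<open>This makes 0 an interior parameter of the line through \<open>x\<close>, so that
  derivatives within \<open>S\<close> become ordinary two-sided derivatives along the line.\<close>

lemma relopen_line:
  assumes "relopen V S" "x \<in> S" "v \<in> V"
  shows "open {t::real. x + t *\<^sub>R v \<in> S}"
proof -
  obtain W where W: "open W" "S = V \<inter> W"
    using assms(1) by (auto simp: relopen_def openin_open)
  have "subspace V" "x \<in> V"
    using assms relopen_subset by (auto simp: relopen_def)
  then have "x + t *\<^sub>R v \<in> V" for t
    using assms(3) by (simp add: subspace_add subspace_scale)
  then have "{t::real. x + t *\<^sub>R v \<in> S} = (\<lambda>t. x + t *\<^sub>R v) -` W"
    using W by auto
  moreover have "open ((\<lambda>t::real. x + t *\<^sub>R v) -` W)"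
    by (intro open_vimage W continuous_intros)
  ultimately show ?thesis by simp
qed

text \<open>A canonical substitute for the derivative \<open>f'\<close> in \<open>Ck_on\<close>,
  whose values off \<open>V\<close> are arbitrary: it sees only the values of \<open>f\<close> on
  one line.\<close>

definition dir_deriv :: "('a::real_normed_vector \<Rightarrow> 'b::real_normed_vector) \<Rightarrow> 'a \<Rightarrow> 'a \<Rightarrow> 'b" where
  "dir_deriv f x v = vector_derivative (\<lambda>t::real. f (x + t *\<^sub>R v)) (at 0)"

lemma dir_deriv_has_vector_derivative:
  assumes "relopen V S" "x \<in> S" "v \<in> V" "(f has_derivative A) (at x within S)"
  shows "((\<lambda>t. f (x + t *\<^sub>R v)) has_vector_derivative A v) (at 0)"
proof -
  let ?T = "{t::real. x + t *\<^sub>R v \<in> S}"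
  interpret A: bounded_linear A using assms(4) by (rule has_derivative_bounded_linear)
  have T: "open ?T" "0 \<in> ?T" using relopen_line[OF assms(1-3)] assms(2) by auto
  have 1: "((\<lambda>t::real. x + t *\<^sub>R v) has_derivative (\<lambda>t. t *\<^sub>R v)) (at 0 within ?T)"
    by (auto intro!: derivative_eq_intros)
  have "((\<lambda>t. f (x + t *\<^sub>R v)) has_derivative (\<lambda>t. A (t *\<^sub>R v))) (at 0 within ?T)"
    by (rule has_derivative_in_compose[OF 1]) (auto intro: has_derivative_subset[OF assms(4)])
  then have "((\<lambda>t. f (x + t *\<^sub>R v)) has_vector_derivative A v) (at 0 within ?T)"
    by (simp add: has_vector_derivative_def A.scaleR)
  then show ?thesis
    by (simp only: has_vector_derivative_within_open[OF T(2,1)])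
qed

lemma dir_deriv_eq:
  assumes "relopen V S" "x \<in> S" "v \<in> V" "(f has_derivative A) (at x within S)"
  shows "dir_deriv f x v = A v"
  unfolding dir_deriv_def
  using dir_deriv_has_vector_derivative[OF assms] by (rule vector_derivative_at)

lemma dir_deriv_cong:
  assumes "relopen V S" "x \<in> S" "v \<in> V" "\<And>y. y \<in> S \<Longrightarrow> f y = g y"
  shows "dir_deriv f x v = dir_deriv g x v"
proof -
  have "\<forall>\<^sub>F t in nhds 0. t \<in> {t::real. x + t *\<^sub>R v \<in> S}"
    using relopen_line[OF assms(1-3)] assms(2) by (intro eventually_nhds_in_open) auto
  then have "\<forall>\<^sub>F t in nhds 0. f (x + t *\<^sub>R v) = g (x + t *\<^sub>R v)"
    by (rule eventually_mono) (use assms(4) in auto)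
  then show ?thesis
    unfolding dir_deriv_def by (intro vector_derivative_cong_eq) (auto simp: eventually_at_filter eventually_mono)
qed

lemma Ck_on_cong:
  assumes "\<And>x. x \<in> S \<Longrightarrow> f x = g x"
  shows "Ck_on V S k f \<longleftrightarrow> Ck_on V S k g"
  using assms
proof (induction k arbitrary: f g)
  case 0 then show ?case by (auto cong: continuous_on_cong)
next
  case (Suc k)
  have "(f has_derivative A) (at x within S) \<longleftrightarrow> (g has_derivative A) (at x within S)" if "x \<in> S" for x A
    using Suc.prems that by (metis has_derivative_transform)
  then show ?case by simp
qed

text \<open>The existentially quantified derivative is replaced by a canonical one, which no longer
  depends on choices and is therefore local.\<close>

lemma Ck_on_Suc_iff:
  assumes "relopen V S"
  shows "Ck_on V S (Suc k) f \<longleftrightarrow>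
    (\<forall>x\<in>S. \<exists>A. (f has_derivative A) (at x within S)) \<and> (\<forall>v\<in>V. Ck_on V S k (\<lambda>x. dir_deriv f x v))"
    (is "?L \<longleftrightarrow> ?R")
proof -
  have eq: "Ck_on V S k (\<lambda>x. dir_deriv f x v) \<longleftrightarrow> Ck_on V S k (\<lambda>x. f' x v)"
    if "\<And>x. x \<in> S \<Longrightarrow> (f has_derivative f' x) (at x within S)" "v \<in> V" for f' v
    by (rule Ck_on_cong) (rule dir_deriv_eq[OF assms _ that(2) that(1)])
  show ?thesis
  proof
    assume ?L
    then obtain f' where f': "\<And>x. x \<in> S \<Longrightarrow> (f has_derivative f' x) (at x within S)"
      "\<And>v. v \<in> V \<Longrightarrow> Ck_on V S k (\<lambda>x. f' x v)" by auto
    then show ?R using eq[of f', OF f'(1)] by blast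
  next
    assume R: ?R
    then have "\<forall>x\<in>S. \<exists>A. (f has_derivative A) (at x within S)" ..
    from bchoice[OF this] obtain f' where f': "\<And>x. x \<in> S \<Longrightarrow> (f has_derivative f' x) (at x within S)" by blast
    then show ?L using R eq[of f', OF f'] by auto
  qed
qed

lemma Ck_on_SucE:
  assumes "Ck_on V S (Suc k) f"
  obtains f' where "\<And>x. x \<in> S \<Longrightarrow> (f has_derivative f' x) (at x within S)"
    "\<And>v. v \<in> V \<Longrightarrow> Ck_on V S k (\<lambda>x. f' x v)"
  using assms unfolding Ck_on.simps by blast

lemma Ck_on_SucI:
  assumes "\<And>x. x \<in> S \<Longrightarrow> (f has_derivative f' x) (at x within S)"
    "\<And>v. v \<in> V \<Longrightarrow> Ck_on V S k (\<lambda>x. f' x v)"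
  shows "Ck_on V S (Suc k) f"
  using assms unfolding Ck_on.simps by blast

lemma Ck_on_subset:
  assumes "Ck_on V S k f" "T \<subseteq> S"
  shows "Ck_on V T k f"
  using assms
proof (induction k arbitrary: f)
  case 0 then show ?case by (auto intro: continuous_on_subset)
next
  case (Suc k)
  from Suc.prems(1) obtain f' where f': "\<And>x. x \<in> S \<Longrightarrow> (f has_derivative f' x) (at x within S)"
    "\<And>v. v \<in> V \<Longrightarrow> Ck_on V S k (\<lambda>x. f' x v)" by (rule Ck_on_SucE) blast
  show ?case
  proof (rule Ck_on_SucI[of _ _ f'])
    show "(f has_derivative f' x) (at x within T)" if "x \<in> T" for x
      by (rule has_derivative_subset[OF f'(1) assms(2)]) (use that assms(2) in blast)
  qed (use f' Suc.IH assms(2) in blast)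
qed

lemma Ck_on_SucD:
  assumes "Ck_on V S (Suc k) f"
  shows "Ck_on V S k f"
  using assms
proof (induction k arbitrary: f)
  case 0 then show ?case by (auto simp: continuous_on_eq_continuous_within intro: has_derivative_continuous)
next
  case (Suc k)
  from Suc.prems obtain f' where f': "\<And>x. x \<in> S \<Longrightarrow> (f has_derivative f' x) (at x within S)"
    "\<And>v. v \<in> V \<Longrightarrow> Ck_on V S (Suc k) (\<lambda>x. f' x v)" by (rule Ck_on_SucE) blast
  show ?case
    by (rule Ck_on_SucI[of _ _ f']) (use f' Suc.IH in blast)+
qed

lemma Ck_on_continuous: "Ck_on V S k f \<Longrightarrow> continuous_on S f"
proof (induction k)
  case (Suc k) then show ?case using Ck_on_SucD by blast
qed simp

lemma at_within_Int_nhds_open: "open T \<Longrightarrow> x \<in> T \<Longrightarrow> at x within (S \<inter> T) = at x within S"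
  by (rule at_within_nhd[where S = T]) auto

text \<open>Derivatives chosen separately on different neighbourhoods need not fit together; the
  directional derivatives do, so the induction runs through \<open>Ck_on_Suc_iff\<close>.\<close>

lemma Ck_on_local:
  assumes "relopen V S"
    and "\<And>x. x \<in> S \<Longrightarrow> \<exists>T. open T \<and> x \<in> T \<and> Ck_on V (S \<inter> T) k f"
  shows "Ck_on V S k f"
  using assms(2)
proof (induction k arbitrary: f)
  case 0
  show ?case
    unfolding Ck_on.simps continuous_on_eq_continuous_within
  proof
    fix x assume "x \<in> S"
    then obtain T where "open T" "x \<in> T" "continuous_on (S \<inter> T) f" using 0 by auto
    then have "continuous (at x within (S \<inter> T)) f" using \<open>x \<in> S\<close> by (simp add: continuous_on_eq_continuous_within)
    then show "continuous (at x within S) f"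
      using \<open>open T\<close> \<open>x \<in> T\<close> by (metis at_within_Int_nhds_open continuous_within)
  qed
next
  case (Suc k)
  have "\<exists>A. (f has_derivative A) (at x within S)" if "x \<in> S" for x
  proof -
    have "x \<in> S" by fact
    with Suc.prems[OF that] obtain T f' where "open T" "x \<in> T"
      "(f has_derivative f' x) (at x within (S \<inter> T))" by auto
    then show ?thesis by (metis at_within_Int_nhds_open)
  qed
  moreover have "Ck_on V S k (\<lambda>x. dir_deriv f x v)" if "v \<in> V" for v
  proof (rule Suc.IH)
    fix x assume "x \<in> S"
    from Suc.prems[OF this] obtain T where T: "open T" "x \<in> T" "Ck_on V (S \<inter> T) (Suc k) f" by blast
    then show "\<exists>T. open T \<and> x \<in> T \<and> Ck_on V (S \<inter> T) k (\<lambda>x. dir_deriv f x v)"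
      using that Ck_on_Suc_iff[OF relopen_Int_open[OF assms(1) T(1)]] by blast
  qed
  ultimately show ?case using Ck_on_Suc_iff[OF assms(1)] by blast
qed

lemma Ck_on_const: "Ck_on V S k (\<lambda>x. c)"
proof (induction k arbitrary: c)
  case (Suc k)
  show ?case by (rule Ck_on_SucI[of _ _ "\<lambda>x v. 0"]) (auto intro: Suc)
qed auto

lemma Ck_on_bounded_linear: "bounded_linear L \<Longrightarrow> Ck_on V S k L"
proof (cases k)
  case (Suc j)
  assume "bounded_linear L"
  then show ?thesis unfolding Suc
    by (intro Ck_on_SucI[of _ _ "\<lambda>x. L"] Ck_on_const bounded_linear_imp_has_derivative)
qed (auto simp: linear_continuous_on)

lemma Ck_on_linear_compose:
  assumes "bounded_linear L" "Ck_on V S k f"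
  shows "Ck_on V S k (\<lambda>x. L (f x))"
  using assms(2)
proof (induction k arbitrary: f)
  case 0 then show ?case using assms(1) by (auto intro: bounded_linear.continuous_on)
next
  case (Suc k)
  from Suc.prems obtain f' where f': "\<And>x. x \<in> S \<Longrightarrow> (f has_derivative f' x) (at x within S)"
    "\<And>v. v \<in> V \<Longrightarrow> Ck_on V S k (\<lambda>x. f' x v)" by (rule Ck_on_SucE) blast
  show ?case
    by (rule Ck_on_SucI[of _ _ "\<lambda>x v. L (f' x v)"])
       (intro bounded_linear.has_derivative[OF assms(1)] f' Suc.IH; assumption)+
qed

lemma Ck_on_add:
  assumes "Ck_on V S k f" "Ck_on V S k g"
  shows "Ck_on V S k (\<lambda>x. f x + g x)"
  using assms
proof (induction k arbitrary: f g)
  case 0 then show ?case by (auto intro: continuous_intros)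
next
  case (Suc k)
  from Suc.prems(1) obtain f' where f': "\<And>x. x \<in> S \<Longrightarrow> (f has_derivative f' x) (at x within S)"
    "\<And>v. v \<in> V \<Longrightarrow> Ck_on V S k (\<lambda>x. f' x v)" by (rule Ck_on_SucE) blast
  from Suc.prems(2) obtain g' where g': "\<And>x. x \<in> S \<Longrightarrow> (g has_derivative g' x) (at x within S)"
    "\<And>v. v \<in> V \<Longrightarrow> Ck_on V S k (\<lambda>x. g' x v)" by (rule Ck_on_SucE) blast
  show ?case
    by (rule Ck_on_SucI[of _ _ "\<lambda>x v. f' x v + g' x v"])
       (intro has_derivative_add f' g' Suc.IH; assumption)+
qed

lemma Ck_on_scaleR:
  assumes "Ck_on V S k f" "Ck_on V S k g"
  shows "Ck_on V S k (\<lambda>x. f x *\<^sub>R g x)"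
  using assms
proof (induction k arbitrary: f g)
  case 0 then show ?case by (auto intro: continuous_intros)
next
  case (Suc k)
  from Suc.prems(1) obtain f' where f': "\<And>x. x \<in> S \<Longrightarrow> (f has_derivative f' x) (at x within S)"
    "\<And>v. v \<in> V \<Longrightarrow> Ck_on V S k (\<lambda>x. f' x v)" by (rule Ck_on_SucE) blast
  from Suc.prems(2) obtain g' where g': "\<And>x. x \<in> S \<Longrightarrow> (g has_derivative g' x) (at x within S)"
    "\<And>v. v \<in> V \<Longrightarrow> Ck_on V S k (\<lambda>x. g' x v)" by (rule Ck_on_SucE) blast
  show ?case
    by (rule Ck_on_SucI[of _ _ "\<lambda>x v. f x *\<^sub>R g' x v + f' x v *\<^sub>R g x"])
       (intro has_derivative_scaleR Ck_on_add f' g' Suc.IH Suc.prems[THEN Ck_on_SucD]; assumption)+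
qed

lemma Ck_on_sum:
  assumes "\<And>i. i \<in> I \<Longrightarrow> Ck_on V S k (f i)"
  shows "Ck_on V S k (\<lambda>x. \<Sum>i\<in>I. f i x)"
  using assms by (induction I rule: infinite_finite_induct) (auto intro: Ck_on_const Ck_on_add)

text \<open>For \<open>V = {0}\<close> this set is empty and all sums over it vanish, which is how
  manifolds of dimension zero are covered.\<close>

definition onb :: "'a::euclidean_space set \<Rightarrow> 'a set" where
  "onb V = (SOME B. B \<subseteq> V \<and> finite B \<and> pairwise orthogonal B \<and> (\<forall>b\<in>B. norm b = 1) \<and> span B = V)"

lemma onb:
  assumes "subspace V"
  shows "onb V \<subseteq> V" "finite (onb V)" "pairwise orthogonal (onb V)" "\<And>b. b \<in> onb V \<Longrightarrow> norm b = 1"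
    "span (onb V) = V"
proof -
  have "\<exists>B. B \<subseteq> V \<and> finite B \<and> pairwise orthogonal B \<and> (\<forall>b\<in>B. norm b = 1) \<and> span B = V"
    using orthonormal_basis_subspace[OF assms] by (metis independent_imp_finite)
  from someI_ex[OF this, folded onb_def]
  show "onb V \<subseteq> V" "finite (onb V)" "pairwise orthogonal (onb V)" "\<And>b. b \<in> onb V \<Longrightarrow> norm b = 1"
    "span (onb V) = V" by auto
qed

lemma onb_expand:
  assumes "subspace V" "x \<in> V"
  shows "(\<Sum>b\<in>onb V. (x \<bullet> b) *\<^sub>R b) = x"
  using onb[OF assms(1)] assms(2) by (intro orthonormal_basis_expand) auto

lemma onb_inner:
  assumes "subspace V" "b \<in> onb V" "c \<in> onb V"
  shows "b \<bullet> c = (if b = c then 1 else 0)"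
  using onb(3,4)[OF assms(1)] assms(2,3)
  by (auto simp: pairwise_def orthogonal_def norm_eq_1)

text \<open>The orthogonal projection onto a subspace \<open>V\<close>. As it fixes \<open>V\<close>
  pointwise, composing with it changes no function on \<open>V\<close> but discards what a
  derivative does off \<open>V\<close>.\<close>

definition proj :: "'a::euclidean_space set \<Rightarrow> 'a \<Rightarrow> 'a" where
  "proj V x = (\<Sum>b\<in>onb V. (x \<bullet> b) *\<^sub>R b)"

lemma bounded_linear_proj: "bounded_linear (proj V)"
  unfolding proj_def by (intro bounded_linear_sum bounded_linear_intros)

lemma proj_id: "subspace V \<Longrightarrow> x \<in> V \<Longrightarrow> proj V x = x"
  by (simp add: proj_def onb_expand)

lemma proj_in: "subspace V \<Longrightarrow> proj V x \<in> V"
  unfolding proj_def by (intro subspace_sum subspace_scale) (use onb(1) in auto)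

text \<open>On \<open>S\<close> the map agrees with its composite with \<open>proj W\<close>, so
  \<open>proj W\<close> composed with \<open>A\<close> is also a derivative, and the two agree along
  \<open>v\<close>.\<close>

lemma has_derivative_in_subspace:
  fixes f :: "'a::euclidean_space \<Rightarrow> 'b::euclidean_space"
  assumes "relopen V S" "x \<in> S" "v \<in> V" "(f has_derivative A) (at x within S)"
    and "subspace W" "f ` S \<subseteq> W"
  shows "A v \<in> W"
proof -
  have "((\<lambda>y. proj W (f y)) has_derivative (\<lambda>y. proj W (A y))) (at x within S)"
    by (rule bounded_linear.has_derivative[OF bounded_linear_proj assms(4)])
  then have "(f has_derivative (\<lambda>y. proj W (A y))) (at x within S)"
    by (rule has_derivative_transform[rotated 2]) (use assms in \<open>auto simp: proj_id image_subset_iff\<close>)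
  from dir_deriv_eq[OF assms(1-3) this] dir_deriv_eq[OF assms(1-4)]
  have "A v = proj W (A v)" by simp
  then show ?thesis using proj_in[OF assms(5)] by metis
qed

lemma Ck_on_compose:
  fixes f :: "'a::euclidean_space \<Rightarrow> 'b::euclidean_space" and g :: "'b \<Rightarrow> 'c::real_normed_vector"
  assumes "relopen V S" "subspace W" "T \<subseteq> W" "f ` S \<subseteq> T"
    and "Ck_on V S k f" "Ck_on W T k g"
  shows "Ck_on V S k (\<lambda>x. g (f x))"
  using assms(5,6)
proof (induction k arbitrary: g)
  case 0
  then show ?case using assms(4) by (auto intro: continuous_on_compose2)
next
  case (Suc k)
  from Suc.prems(1) obtain f' where f': "\<forall>x\<in>S. (f has_derivative f' x) (at x within S)"
    "\<forall>v\<in>V. Ck_on V S k (\<lambda>x. f' x v)" by (rule Ck_on_SucE) blast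
  from Suc.prems(2) obtain g' where g': "\<forall>x\<in>T. (g has_derivative g' x) (at x within T)"
    "\<forall>v\<in>W. Ck_on W T k (\<lambda>x. g' x v)" by (rule Ck_on_SucE) blast
  have f: "Ck_on V S k f" using Suc.prems(1) by (rule Ck_on_SucD)
  have der: "((\<lambda>x. g (f x)) has_derivative (\<lambda>v. g' (f x) (f' x v))) (at x within S)" if "x \<in> S" for x
    by (rule has_derivative_in_compose2[where g' = g' and t = T]) (use g'(1) f'(1) assms(4) that in blast)+
  have "Ck_on V S k (\<lambda>x. g' (f x) (f' x v))" if v: "v \<in> V" for v
  proof -
    \<comment> \<open>In the chain rule both the point and the direction of \<open>g'\<close> vary
      with \<open>x\<close>, whereas \<open>Ck_on\<close> speaks of fixed directions only. Expanding
      the direction in an orthonormal basis separates the two dependences.\<close>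
    have eq: "g' (f x) (f' x v) = (\<Sum>b\<in>onb W. (f' x v \<bullet> b) *\<^sub>R g' (f x) b)" if "x \<in> S" for x
    proof -
      have "f x \<in> T" using that assms(4) by auto
      then interpret bounded_linear "g' (f x)" using g'(1) has_derivative_bounded_linear by blast
      have "f' x v \<in> W"
        using has_derivative_in_subspace[OF assms(1) that v] f'(1) that assms(2-4) by blast
      then have "g' (f x) (f' x v) = g' (f x) (\<Sum>b\<in>onb W. (f' x v \<bullet> b) *\<^sub>R b)"
        using onb_expand[OF assms(2)] by simp
      also have "\<dots> = (\<Sum>b\<in>onb W. (f' x v \<bullet> b) *\<^sub>R g' (f x) b)"
        by (simp add: sum scaleR)
      finally show ?thesis .
    qed
    have "Ck_on V S k (\<lambda>x. (f' x v \<bullet> b) *\<^sub>R g' (f x) b)" if "b \<in> onb W" for b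
    proof (rule Ck_on_scaleR)
      show "Ck_on V S k (\<lambda>x. f' x v \<bullet> b)"
        using f'(2) v by (intro Ck_on_linear_compose[OF bounded_linear_inner_left]) auto
      have "b \<in> W" using that onb(1)[OF assms(2)] by auto
      then show "Ck_on V S k (\<lambda>x. g' (f x) b)"
        using Suc.IH[OF f, of "\<lambda>y. g' y b"] g'(2) by auto
    qed
    then have "Ck_on V S k (\<lambda>x. \<Sum>b\<in>onb W. (f' x v \<bullet> b) *\<^sub>R g' (f x) b)"
      by (rule Ck_on_sum)
    moreover have "Ck_on V S k (\<lambda>x. g' (f x) (f' x v)) =
        Ck_on V S k (\<lambda>x. \<Sum>b\<in>onb W. (f' x v \<bullet> b) *\<^sub>R g' (f x) b)"
      by (rule Ck_on_cong) (rule eq)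
    ultimately show ?thesis by simp
  qed
  with der show ?case by (rule Ck_on_SucI[of _ _ "\<lambda>x v. g' (f x) (f' x v)"])
qed

lemma smooth_onI: "(\<And>k. Ck_on V S k f) \<Longrightarrow> smooth_on V S f"
  and smooth_onD: "smooth_on V S f \<Longrightarrow> Ck_on V S k f"
  by (auto simp: smooth_on_def)

lemma smooth_on_cong: "(\<And>x. x \<in> S \<Longrightarrow> f x = g x) \<Longrightarrow> smooth_on V S f \<longleftrightarrow> smooth_on V S g"
  unfolding smooth_on_def using Ck_on_cong by metis

lemma smooth_on_subset: "smooth_on V S f \<Longrightarrow> T \<subseteq> S \<Longrightarrow> smooth_on V T f"
  unfolding smooth_on_def using Ck_on_subset by metis

lemma smooth_on_continuous: "smooth_on V S f \<Longrightarrow> continuous_on S f"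
  unfolding smooth_on_def using Ck_on_continuous by metis

lemma smooth_on_local:
  assumes "relopen V S" "\<And>x. x \<in> S \<Longrightarrow> \<exists>T. open T \<and> x \<in> T \<and> smooth_on V (S \<inter> T) f"
  shows "smooth_on V S f"
  unfolding smooth_on_def using Ck_on_local[OF assms(1)] assms(2) unfolding smooth_on_def by meson

lemma smooth_on_const: "smooth_on V S (\<lambda>x. c)"
  by (auto simp: smooth_on_def Ck_on_const)

lemma smooth_on_bounded_linear: "bounded_linear L \<Longrightarrow> smooth_on V S L"
  by (auto simp: smooth_on_def Ck_on_bounded_linear)

lemma smooth_on_linear_compose: "bounded_linear L \<Longrightarrow> smooth_on V S f \<Longrightarrow> smooth_on V S (\<lambda>x. L (f x))"
  by (auto simp: smooth_on_def Ck_on_linear_compose)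

lemma smooth_on_add: "smooth_on V S f \<Longrightarrow> smooth_on V S g \<Longrightarrow> smooth_on V S (\<lambda>x. f x + g x)"
  by (auto simp: smooth_on_def Ck_on_add)

lemma smooth_on_scaleR: "smooth_on V S f \<Longrightarrow> smooth_on V S g \<Longrightarrow> smooth_on V S (\<lambda>x. f x *\<^sub>R g x)"
  by (auto simp: smooth_on_def Ck_on_scaleR)

lemma smooth_on_mult:
  fixes f g :: "'a::euclidean_space \<Rightarrow> real"
  shows "smooth_on V S f \<Longrightarrow> smooth_on V S g \<Longrightarrow> smooth_on V S (\<lambda>x. f x * g x)"
  using smooth_on_scaleR[of V S f g] by simp

lemma smooth_on_sum: "(\<And>i. i \<in> I \<Longrightarrow> smooth_on V S (f i)) \<Longrightarrow> smooth_on V S (\<lambda>x. \<Sum>i\<in>I. f i x)"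
  by (auto simp: smooth_on_def Ck_on_sum)

lemma smooth_on_diff:
  assumes "smooth_on V S f" "smooth_on V S g" shows "smooth_on V S (\<lambda>x. f x - g x)"
  using smooth_on_add[OF assms(1) smooth_on_linear_compose[OF bounded_linear_minus[OF bounded_linear_ident] assms(2)]]
  by simp

lemma smooth_on_Pair:
  assumes "smooth_on V S f" "smooth_on V S g"
  shows "smooth_on V S (\<lambda>x. (f x, g x))"
proof -
  have "smooth_on V S (\<lambda>x. (f x, 0) + (0, g x))"
    by (intro smooth_on_add smooth_on_linear_compose[OF _ assms(1)] smooth_on_linear_compose[OF _ assms(2)]
        bounded_linear_Pair bounded_linear_ident bounded_linear_zero)
  then show ?thesis by simp
qed

lemma smooth_on_compose:
  fixes f :: "'a::euclidean_space \<Rightarrow> 'b::euclidean_space" and g :: "'b \<Rightarrow> 'c::real_normed_vector"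
  assumes "relopen V S" "subspace W" "T \<subseteq> W" "f ` S \<subseteq> T" "smooth_on V S f" "smooth_on W T g"
  shows "smooth_on V S (\<lambda>x. g (f x))"
  using assms Ck_on_compose unfolding smooth_on_def by metis

lemma smooth_on_dir_deriv:
  assumes "relopen V S" "smooth_on V S f" "v \<in> V"
  shows "smooth_on V S (\<lambda>x. dir_deriv f x v)"
  using assms Ck_on_Suc_iff[OF assms(1)] unfolding smooth_on_def by blast

text \<open>Precomposing the arbitrary derivative \<open>A\<close> with \<open>proj V\<close> gives
  one that is determined by directional derivatives along \<open>V\<close>.\<close>

lemma has_derivative_onb:
  assumes "relopen V S" "x \<in> S" "(f has_derivative A) (at x within S)"
  shows "(f has_derivative (\<lambda>v. \<Sum>b\<in>onb V. (v \<bullet> b) *\<^sub>R dir_deriv f x b)) (at x within S)"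
proof -
  note A = assms(3)
  interpret bounded_linear A using A by (rule has_derivative_bounded_linear)
  have V: "subspace V" using assms(1) by (rule relopen_subspace)
  have eq: "A (proj V v) = (\<Sum>b\<in>onb V. (v \<bullet> b) *\<^sub>R dir_deriv f x b)" for v
  proof -
    have "dir_deriv f x b = A b" if "b \<in> onb V" for b
      using dir_deriv_eq[OF assms(1,2) _ A] onb(1)[OF V] that by auto
    then show ?thesis by (simp add: proj_def sum scaleR)
  qed
  have "((\<lambda>y. proj V y) has_derivative proj V) (at x within S)"
    by (rule bounded_linear_imp_has_derivative[OF bounded_linear_proj])
  then have "((\<lambda>y. f (proj V y)) has_derivative (\<lambda>y. A (proj V y))) (at x within S)"
  proof (rule has_derivative_in_compose)
    have "proj V ` S = S" "proj V x = x"
      using relopen_subset[OF assms(1)] assms(2) proj_id[OF V] by (auto simp: image_iff subset_iff)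
    then show "(f has_derivative A) (at (proj V x) within proj V ` S)" using A by simp
  qed
  then have "(f has_derivative (\<lambda>y. A (proj V y))) (at x within S)"
    by (rule has_derivative_transform[rotated 2])
       (use assms(2) relopen_subset[OF assms(1)] proj_id[OF V] in \<open>auto simp: subset_iff\<close>)
  then show ?thesis by (simp add: eq)
qed

lemma dir_deriv_linear:
  assumes "relopen V S" "x \<in> S" "smooth_on V S f"
  shows "(f has_derivative (\<lambda>v. \<Sum>b\<in>onb V. (v \<bullet> b) *\<^sub>R dir_deriv f x b)) (at x within S)"
    and "v \<in> V \<Longrightarrow> dir_deriv f x v = (\<Sum>b\<in>onb V. (v \<bullet> b) *\<^sub>R dir_deriv f x b)"
proof -
  have "Ck_on V S (Suc 0) f" using assms(3) by (rule smooth_onD)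
  then obtain A where A: "(f has_derivative A) (at x within S)"
    using assms(1,2) Ck_on_Suc_iff by blast
  show 1: "(f has_derivative (\<lambda>v. \<Sum>b\<in>onb V. (v \<bullet> b) *\<^sub>R dir_deriv f x b)) (at x within S)"
    by (rule has_derivative_onb[OF assms(1,2) A])
  show "v \<in> V \<Longrightarrow> dir_deriv f x v = (\<Sum>b\<in>onb V. (v \<bullet> b) *\<^sub>R dir_deriv f x b)"
    using dir_deriv_eq[OF assms(1,2) _ 1] .
qed

section \<open>Bump functions and the Hadamard lemma\<close>

lemma Ck_on_real_SucI:
  fixes f g :: "real \<Rightarrow> real"
  assumes "\<And>x. x \<in> S \<Longrightarrow> (f has_field_derivative g x) (at x within S)" "Ck_on UNIV S k g"
  shows "Ck_on UNIV S (Suc k) f"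
proof (rule Ck_on_SucI)
  show "(f has_derivative (*) (g x)) (at x within S)" if "x \<in> S" for x
    using assms(1)[OF that] by (simp add: has_field_derivative_def)
  show "Ck_on UNIV S k (\<lambda>x. g x * v)" for v
    using Ck_on_scaleR[OF assms(2) Ck_on_const[where c = v]] by simp
qed

lemma smooth_on_inverse: "smooth_on UNIV {0<..} (inverse :: real \<Rightarrow> real)"
proof (rule smooth_onI)
  show "Ck_on UNIV {0<..} k (inverse :: real \<Rightarrow> real)" for k
  proof (induction k)
    case 0 then show ?case by (auto intro!: continuous_intros)
  next
    case (Suc k)
    show ?case
    proof (rule Ck_on_real_SucI)
      show "(inverse has_field_derivative (-1) *\<^sub>R (inverse x *\<^sub>R inverse x)) (at x within {0<..})"
        if "x \<in> {0<..}" for x :: real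
        using that DERIV_inverse[of x "{0<..}"] by (simp add: power2_eq_square numeral_2_eq_2)
      show "Ck_on UNIV {0<..} k (\<lambda>x::real. (-1) *\<^sub>R (inverse x *\<^sub>R inverse x))"
        by (intro Ck_on_scaleR Ck_on_const Suc)
    qed
  qed
qed

text \<open>With y = 1/x this is y^n exp(-y), extended by zero. The powers make the family closed
  under differentiation up to linear combinations, so all orders of smoothness follow by one
  induction over all \<open>n\<close> at once.\<close>

definition flat :: "nat \<Rightarrow> real \<Rightarrow> real" where
  "flat n x = (if x > 0 then inverse x ^ n * exp (- inverse x) else 0)"

lemma flat_tendsto_0: "(flat n \<longlongrightarrow> 0) (at 0)"
proof -
  have "((\<lambda>x. inverse x ^ n / exp (inverse x)) \<longlongrightarrow> 0) (at_right (0::real))"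
    using filterlim_compose[OF tendsto_power_div_exp_0 filterlim_inverse_at_top_right] .
  then have "(flat n \<longlongrightarrow> 0) (at_right 0)"
    by (rule Lim_transform_eventually) (auto simp: flat_def eventually_at_filter exp_minus divide_inverse)
  moreover have "(flat n \<longlongrightarrow> 0) (at_left 0)"
    by (rule Lim_transform_eventually[OF tendsto_const]) (auto simp: flat_def eventually_at_filter)
  ultimately show ?thesis by (simp add: filterlim_split_at)
qed

lemma flat_deriv: "(flat n has_field_derivative flat (n + 2) x - real n * flat (n + 1) x) (at x)"
proof -
  consider "x > 0" | "x < 0" | "x = 0" by linarith
  then show ?thesis
  proof cases
    case 1
    let ?y = "inverse x"
    have "((\<lambda>x. inverse x ^ n * exp (- inverse x)) has_field_derivative
        (real n * ?y ^ (n - 1) * (- (?y * ?y))) * exp (- ?y) + ?y ^ n * (exp (- ?y) * (?y * ?y))) (at x)"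
      using 1 by (auto intro!: derivative_eq_intros simp: power2_eq_square)
    also have "(real n * ?y ^ (n - 1) * (- (?y * ?y))) * exp (- ?y) + ?y ^ n * (exp (- ?y) * (?y * ?y))
        = flat (n + 2) x - real n * flat (n + 1) x"
      using 1 by (cases n) (auto simp: flat_def algebra_simps)
    finally have "((\<lambda>x. inverse x ^ n * exp (- inverse x)) has_field_derivative
        flat (n + 2) x - real n * flat (n + 1) x) (at x)" .
    then show ?thesis
      by (rule has_field_derivative_transform_within_open[of _ _ _ "{0<..}"]) (use 1 in \<open>auto simp: flat_def\<close>)
  next
    case 2
    have "((\<lambda>x. 0) has_field_derivative 0) (at x)" by simp
    then have "(flat n has_field_derivative 0) (at x)"
      by (rule has_field_derivative_transform_within_open[of _ _ _ "{..<0}"]) (use 2 in \<open>auto simp: flat_def\<close>)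
    then show ?thesis using 2 by (simp add: flat_def)
  next
    case 3
    \<comment> \<open>The difference quotient of \<open>flat n\<close> at 0 is
      \<open>flat (Suc n)\<close>, which tends to 0.\<close>
    have "((\<lambda>h. (flat n (0 + h) - flat n 0) / h) \<longlongrightarrow> 0) (at 0)"
      by (rule Lim_transform_eventually[OF flat_tendsto_0[of "Suc n"]])
         (auto simp: flat_def eventually_at_filter field_simps)
    then show ?thesis using 3 by (simp add: DERIV_def flat_def)
  qed
qed

lemma smooth_on_flat: "smooth_on UNIV UNIV (flat n)"
proof (rule smooth_onI)
  show "Ck_on UNIV UNIV k (flat n)" for k
  proof (induction k arbitrary: n)
    case 0
    show ?case using flat_deriv[of n] by (auto intro!: continuous_at_imp_continuous_on DERIV_isCont)
  next
    case (Suc k)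
    show ?case
    proof (rule Ck_on_real_SucI)
      show "(flat n has_field_derivative flat (n + 2) x + (- real n) *\<^sub>R flat (n + 1) x) (at x)" for x
        using flat_deriv[of n x] by simp
      show "Ck_on UNIV UNIV k (\<lambda>x. flat (n + 2) x + (- real n) *\<^sub>R flat (n + 1) x)"
        by (intro Ck_on_add Ck_on_scaleR Ck_on_const Suc)
    qed
  qed
qed

lemma flat_pos: "x > 0 \<Longrightarrow> flat n x > 0" and flat_nonpos: "x \<le> 0 \<Longrightarrow> flat n x = 0"
  by (auto simp: flat_def)

lemma flat_nonneg: "flat n x \<ge> 0"
  by (auto simp: flat_def)

text \<open>With s the squared distance to \<open>p\<close>, the quotient of flat(4 r^2 - s) by
  flat(4 r^2 - s) + flat(s - r^2): it is 1 up to radius \<open>r\<close> and 0 from radius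
  \<open>2 * r\<close> on. Working with the square keeps it smooth at the centre.\<close>

definition bump :: "'a::euclidean_space \<Rightarrow> real \<Rightarrow> 'a \<Rightarrow> real" where
  "bump p r x = flat 0 (4 * r\<^sup>2 - (norm (x - p))\<^sup>2) *
     inverse (flat 0 (4 * r\<^sup>2 - (norm (x - p))\<^sup>2) + flat 0 ((norm (x - p))\<^sup>2 - r\<^sup>2))"

lemma bump_denominator_pos:
  assumes "r > 0"
  shows "flat 0 (4 * r\<^sup>2 - s) + flat 0 (s - r\<^sup>2) > 0"
proof (cases "s < 4 * r\<^sup>2")
  case True
  then have "flat 0 (4 * r\<^sup>2 - s) > 0" by (intro flat_pos) simp
  then show ?thesis using flat_nonneg[of 0 "s - r\<^sup>2"] by simp
next
  case False
  moreover have "r\<^sup>2 > 0" using assms by simp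
  ultimately have "s - r\<^sup>2 > 0" by linarith
  then have "flat 0 (s - r\<^sup>2) > 0" by (rule flat_pos)
  then show ?thesis using flat_nonneg[of 0 "4 * r\<^sup>2 - s"] by simp
qed

lemma bump_eq_1:
  assumes "r > 0" "dist x p \<le> r"
  shows "bump p r x = 1"
proof -
  have "(norm (x - p))\<^sup>2 \<le> r\<^sup>2" using assms by (intro power_mono) (auto simp: dist_norm)
  then have "flat 0 ((norm (x - p))\<^sup>2 - r\<^sup>2) = 0" by (intro flat_nonpos) simp
  then show ?thesis using bump_denominator_pos[OF assms(1), of "(norm (x - p))\<^sup>2"] by (simp add: bump_def)
qed

lemma bump_eq_0:
  assumes "r > 0" "dist x p \<ge> 2 * r"
  shows "bump p r x = 0"
proof -
  have "(2 * r)\<^sup>2 \<le> (norm (x - p))\<^sup>2" using assms by (intro power_mono) (auto simp: dist_norm)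
  then have "flat 0 (4 * r\<^sup>2 - (norm (x - p))\<^sup>2) = 0" by (intro flat_nonpos) (simp add: power_mult_distrib)
  then show ?thesis by (simp add: bump_def)
qed

lemma smooth_on_real_compose:
  fixes f :: "'a::euclidean_space \<Rightarrow> real"
  assumes "relopen V S" "smooth_on V S f" "smooth_on UNIV T g" "f ` S \<subseteq> T"
  shows "smooth_on V S (\<lambda>x. g (f x))"
  using smooth_on_compose[OF assms(1) subspace_UNIV subset_UNIV assms(4,2,3)] .

lemma smooth_on_bump:
  fixes p :: "'a::euclidean_space"
  assumes "r > 0" "relopen V S"
  shows "smooth_on V S (bump p r)"
proof -
  have "smooth_on V S (\<lambda>x. \<Sum>b\<in>Basis. ((x \<bullet> b) - (p \<bullet> b)) * ((x \<bullet> b) - (p \<bullet> b)))"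
    by (intro smooth_on_sum smooth_on_mult smooth_on_diff smooth_on_const
        smooth_on_bounded_linear bounded_linear_inner_left)
  moreover have "(norm (x - p))\<^sup>2 = (\<Sum>b\<in>Basis. ((x \<bullet> b) - (p \<bullet> b)) * ((x \<bullet> b) - (p \<bullet> b)))" for x
    unfolding power2_norm_eq_inner by (subst euclidean_inner) (simp add: inner_diff_left)
  ultimately have N: "smooth_on V S (\<lambda>x. (norm (x - p))\<^sup>2)" by simp
  have A: "smooth_on V S (\<lambda>x. flat 0 (4 * r\<^sup>2 - (norm (x - p))\<^sup>2))"
    by (rule smooth_on_real_compose[OF assms(2) _ smooth_on_flat])
       (auto intro!: smooth_on_diff smooth_on_const N)
  have B: "smooth_on V S (\<lambda>x. flat 0 ((norm (x - p))\<^sup>2 - r\<^sup>2))"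
    by (rule smooth_on_real_compose[OF assms(2) _ smooth_on_flat])
       (auto intro!: smooth_on_diff smooth_on_const N)
  have "smooth_on V S (\<lambda>x. inverse (flat 0 (4 * r\<^sup>2 - (norm (x - p))\<^sup>2) + flat 0 ((norm (x - p))\<^sup>2 - r\<^sup>2)))"
    by (rule smooth_on_real_compose[OF assms(2) _ smooth_on_inverse])
       (auto intro!: smooth_on_add A B bump_denominator_pos assms(1))
  then show ?thesis unfolding bump_def[abs_def] using A by (intro smooth_on_mult)
qed

text \<open>Differentiating under the integral sign produces a factor \<open>t\<close> from the
  chain rule; the weight \<open>t ^ n\<close> with arbitrary \<open>n\<close> makes the statement
  stable under this and hence provable by induction on \<open>k\<close>.\<close>

lemma Ck_on_segment_integral:
  fixes f :: "'a::euclidean_space \<Rightarrow> real"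
  assumes "relopen V S" "convex S" "p \<in> S"
    and "Ck_on V S k f"
  shows "Ck_on V S k (\<lambda>x. integral (cbox 0 1) (\<lambda>t::real. t ^ n * f (p + t *\<^sub>R (x - p))))"
proof -
  have seg: "p + t *\<^sub>R (x - p) \<in> S" if "x \<in> S" "t \<in> cbox 0 1" for x and t :: real
    using convexD_alt[OF assms(2,3) that(1), of t] that(2) by (simp add: algebra_simps)
  have cont: "continuous_on (S \<times> cbox 0 1) (\<lambda>(x, t). t ^ n * g (p + t *\<^sub>R (x - p)))"
    if "continuous_on S g" for g :: "'a \<Rightarrow> real" and n
    unfolding case_prod_beta
    by (intro continuous_intros continuous_on_compose2[OF that]) (use seg in auto)
  show ?thesis
    using assms(4)
  proof (induction k arbitrary: f n)
    case 0
    then show ?case using integral_continuous_on_param[OF cont[of f n]] by simp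
  next
    case (Suc k)
    have f: "continuous_on S f" using Suc.prems by (rule Ck_on_continuous)
    have V: "subspace V" using assms(1) by (rule relopen_subspace)
    define D where "D z v = (\<Sum>b\<in>onb V. (v \<bullet> b) *\<^sub>R dir_deriv f z b)" for z v
    have D: "(f has_derivative D z) (at z within S)" and D': "v \<in> V \<Longrightarrow> dir_deriv f z v = D z v" if "z \<in> S" for z v
    proof -
      obtain A where A: "(f has_derivative A) (at z within S)"
        using Suc.prems \<open>z \<in> S\<close> Ck_on_Suc_iff[OF assms(1)] by blast
      show "(f has_derivative D z) (at z within S)"
        unfolding D_def by (rule has_derivative_onb[OF assms(1) \<open>z \<in> S\<close> A])
      from dir_deriv_eq[OF assms(1) \<open>z \<in> S\<close> _ this] show "v \<in> V \<Longrightarrow> dir_deriv f z v = D z v" .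
    qed
    have ck: "Ck_on V S k (\<lambda>z. dir_deriv f z v)" if "v \<in> V" for v
      using Suc.prems that Ck_on_Suc_iff[OF assms(1)] by blast
    \<comment> \<open>The Leibniz rule for integrals asks for a continuous family of bounded linear
      maps; written over the basis of \<open>V\<close>, its continuity is that of finitely many
      directional derivatives.\<close>
    define fx where "fx x t = (\<Sum>b\<in>onb V. (t ^ Suc n * dir_deriv f (p + t *\<^sub>R (x - p)) b) *\<^sub>R blinfun_inner_left b)"
      for x and t :: real
    have fx: "blinfun_apply (fx x t) v = t ^ Suc n * D (p + t *\<^sub>R (x - p)) v" for x t v
      by (simp add: fx_def D_def blinfun.sum_left blinfun.scaleR_left sum_distrib_left algebra_simps)
    have contfx: "continuous_on (S \<times> cbox 0 1) (\<lambda>(x, t). fx x t)"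
      unfolding fx_def case_prod_beta
    proof (intro continuous_on_sum continuous_on_scaleR continuous_on_const)
      fix b assume "b \<in> onb V"
      then have "b \<in> V" using onb(1)[OF V] by auto
      from cont[OF Ck_on_continuous[OF ck[OF this]], of "Suc n"]
      show "continuous_on (S \<times> cbox 0 1) (\<lambda>x. snd x ^ Suc n * dir_deriv f (p + snd x *\<^sub>R (fst x - p)) b)"
        by (simp add: case_prod_beta)
    qed
    have der: "((\<lambda>x. integral (cbox 0 1) (\<lambda>t. t ^ n * f (p + t *\<^sub>R (x - p)))) has_derivative
        blinfun_apply (integral (cbox 0 1) (fx x))) (at x within S)" if "x \<in> S" for x
    proof (rule leibniz_rule[OF _ _ contfx that assms(2)])
      fix x assume x: "x \<in> S"
      show "(\<lambda>t. t ^ n * f (p + t *\<^sub>R (x - p))) integrable_on cbox 0 1"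
        by (rule integrable_continuous) (intro continuous_intros continuous_on_compose2[OF f]; use x seg in auto)
    next
      fix x and t :: real assume x: "x \<in> S" and t: "t \<in> cbox 0 1"
      have "((\<lambda>x. p + t *\<^sub>R (x - p)) has_derivative (\<lambda>v. t *\<^sub>R v)) (at x within S)"
        by (auto intro!: derivative_eq_intros)
      then have "((\<lambda>x. f (p + t *\<^sub>R (x - p))) has_derivative (\<lambda>v. D (p + t *\<^sub>R (x - p)) (t *\<^sub>R v))) (at x within S)"
        by (rule has_derivative_in_compose2[rotated 3, where g' = D and t = S]) (use x t seg D in auto)
      then have "((\<lambda>x. t ^ n * f (p + t *\<^sub>R (x - p))) has_derivative
          (\<lambda>v. t ^ n * D (p + t *\<^sub>R (x - p)) (t *\<^sub>R v))) (at x within S)"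
        by (rule has_derivative_mult_right)
      moreover have "(\<lambda>v. t ^ n * D (p + t *\<^sub>R (x - p)) (t *\<^sub>R v)) = blinfun_apply (fx x t)"
        by (rule ext) (simp add: fx, simp add: D_def sum_distrib_left algebra_simps)
      ultimately show "((\<lambda>x. t ^ n * f (p + t *\<^sub>R (x - p))) has_derivative blinfun_apply (fx x t)) (at x within S)"
        by simp
    qed
    show ?case
    proof (rule Ck_on_SucI[OF der])
      fix v assume v: "v \<in> V"
      have "Ck_on V S k (\<lambda>x. blinfun_apply (integral (cbox 0 1) (fx x)) v) \<longleftrightarrow>
        Ck_on V S k (\<lambda>x. integral (cbox 0 1) (\<lambda>t. t ^ Suc n * dir_deriv f (p + t *\<^sub>R (x - p)) v))"
      proof (rule Ck_on_cong)
        fix x assume x: "x \<in> S"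
        have "continuous_on (cbox 0 1) (\<lambda>t. fx x t)"
          using continuous_on_compose2[OF contfx, of "cbox 0 1" "\<lambda>t. (x, t)"] x
          by (simp add: continuous_on_Pair continuous_on_const continuous_on_id image_subset_iff)
        then have "blinfun_apply (integral (cbox 0 1) (fx x)) v = integral (cbox 0 1) (\<lambda>t. blinfun_apply (fx x t) v)"
          by (intro blinfun_apply_integral integrable_continuous)
        also have "\<dots> = integral (cbox 0 1) (\<lambda>t. t ^ Suc n * dir_deriv f (p + t *\<^sub>R (x - p)) v)"
          by (rule integral_cong) (simp add: fx D'[OF seg[OF x] v])
        finally show "blinfun_apply (integral (cbox 0 1) (fx x)) v =
          integral (cbox 0 1) (\<lambda>t. t ^ Suc n * dir_deriv f (p + t *\<^sub>R (x - p)) v)" .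
      qed
      then show "Ck_on V S k (\<lambda>x. blinfun_apply (integral (cbox 0 1) (fx x)) v)"
        using Suc.IH[OF ck[OF v], of "Suc n"] by (simp only:)
    qed
  qed
qed

text \<open>The fundamental theorem of calculus along the segment from \<open>p\<close> to
  \<open>x\<close>: \<open>g b\<close> is the mean over the segment of the derivative in direction
  \<open>b\<close>.\<close>

lemma Hadamard:
  fixes f :: "'a::euclidean_space \<Rightarrow> real"
  assumes "relopen V S" "convex S" "p \<in> S" "smooth_on V S f"
  obtains g where "\<And>b. b \<in> onb V \<Longrightarrow> smooth_on V S (g b)"
    and "\<And>b. b \<in> onb V \<Longrightarrow> g b p = dir_deriv f p b"
    and "\<And>x. x \<in> S \<Longrightarrow> f x = f p + (\<Sum>b\<in>onb V. ((x - p) \<bullet> b) * g b x)"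
proof
  have V: "subspace V" using assms(1) by (rule relopen_subspace)
  define g where "g b x = integral (cbox 0 1) (\<lambda>t::real. t ^ 0 * dir_deriv f (p + t *\<^sub>R (x - p)) b)" for b x
  have sm: "smooth_on V S (\<lambda>x. dir_deriv f x b)" if "b \<in> onb V" for b
    using smooth_on_dir_deriv[OF assms(1,4)] onb(1)[OF V] that by auto
  show "smooth_on V S (g b)" if "b \<in> onb V" for b
    unfolding g_def by (rule smooth_onI, rule Ck_on_segment_integral[OF assms(1-3)], rule smooth_onD, rule sm[OF that])
  show "g b p = dir_deriv f p b" if "b \<in> onb V" for b
    by (simp add: g_def)
  fix x assume x: "x \<in> S"
  have seg: "p + t *\<^sub>R (x - p) \<in> S" if "t \<in> {0..1}" for t :: real
    using convexD_alt[OF assms(2,3) x, of t] that by (simp add: algebra_simps)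
  have "x - p \<in> V" using relopen_subset[OF assms(1)] x assms(3) V by (auto intro: subspace_diff)
  let ?h = "\<lambda>t. \<Sum>b\<in>onb V. ((x - p) \<bullet> b) * dir_deriv f (p + t *\<^sub>R (x - p)) b"
  have "((\<lambda>t. f (p + t *\<^sub>R (x - p))) has_vector_derivative ?h t) (at t within {0..1})" if t: "t \<in> {0..1}" for t
  proof -
    have "((\<lambda>t. p + t *\<^sub>R (x - p)) has_derivative (\<lambda>s. s *\<^sub>R (x - p))) (at t within {0..1})"
      by (auto intro!: derivative_eq_intros)
    then have "((\<lambda>t. f (p + t *\<^sub>R (x - p))) has_derivative
        (\<lambda>s. \<Sum>b\<in>onb V. ((s *\<^sub>R (x - p)) \<bullet> b) *\<^sub>R dir_deriv f (p + t *\<^sub>R (x - p)) b)) (at t within {0..1})"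
      by (rule has_derivative_in_compose2[where t = S and
            g' = "\<lambda>z v. \<Sum>b\<in>onb V. (v \<bullet> b) *\<^sub>R dir_deriv f z b", rotated 3])
         (use dir_deriv_linear(1)[OF assms(1) _ assms(4)] seg t in blast)+
    then show ?thesis
      unfolding has_vector_derivative_def
      by (rule has_derivative_eq_rhs) (simp add: sum_distrib_left mult.assoc)
  qed
  then have "(?h has_integral f (p + 1 *\<^sub>R (x - p)) - f (p + 0 *\<^sub>R (x - p))) {0..1}"
    by (intro fundamental_theorem_of_calculus) auto
  moreover have "(?h has_integral (\<Sum>b\<in>onb V. ((x - p) \<bullet> b) * g b x)) {0..1}"
  proof (intro has_integral_sum has_integral_mult_right)
    fix b assume b: "b \<in> onb V"
    have "(\<lambda>t. dir_deriv f (p + t *\<^sub>R (x - p)) b) integrable_on {0..1}"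
      by (intro integrable_continuous_interval continuous_on_compose2[OF smooth_on_continuous[OF sm[OF b]]])
         (use seg in \<open>auto intro!: continuous_intros\<close>)
    then show "((\<lambda>t. dir_deriv f (p + t *\<^sub>R (x - p)) b) has_integral g b x) {0..1}"
      by (simp add: g_def integrable_integral)
  qed (use onb(2)[OF V] in auto)
  ultimately have "f (p + 1 *\<^sub>R (x - p)) - f (p + 0 *\<^sub>R (x - p)) = (\<Sum>b\<in>onb V. ((x - p) \<bullet> b) * g b x)"
    by (rule has_integral_unique)
  then show "f x = f p + (\<Sum>b\<in>onb V. ((x - p) \<bullet> b) * g b x)" by simp
qed

section \<open>Rules for directional derivatives and symmetry of second derivatives\<close>

lemma dir_deriv_mult:
  fixes f g :: "'a::euclidean_space \<Rightarrow> real"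
  assumes "relopen V S" "x \<in> S" "v \<in> V" "smooth_on V S f" "smooth_on V S g"
  shows "dir_deriv (\<lambda>y. f y * g y) x v = f x * dir_deriv g x v + dir_deriv f x v * g x"
  using dir_deriv_eq[OF assms(1-3) has_derivative_mult[OF dir_deriv_linear(1)[OF assms(1,2,4)]
      dir_deriv_linear(1)[OF assms(1,2,5)]]]
    dir_deriv_linear(2)[OF assms(1,2,4,3)] dir_deriv_linear(2)[OF assms(1,2,5,3)]
  by simp

lemma dir_deriv_add:
  assumes "relopen V S" "x \<in> S" "v \<in> V" "smooth_on V S f" "smooth_on V S g"
  shows "dir_deriv (\<lambda>y. f y + g y) x v = dir_deriv f x v + dir_deriv g x v"
  using dir_deriv_eq[OF assms(1-3) has_derivative_add[OF dir_deriv_linear(1)[OF assms(1,2,4)]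
      dir_deriv_linear(1)[OF assms(1,2,5)]]]
    dir_deriv_linear(2)[OF assms(1,2,4,3)] dir_deriv_linear(2)[OF assms(1,2,5,3)]
  by simp

lemma dir_deriv_const: "dir_deriv (\<lambda>y. c) x v = 0"
  by (simp add: dir_deriv_def)

lemma dir_deriv_sum:
  assumes "relopen V S" "x \<in> S" "v \<in> V" "\<And>i. i \<in> I \<Longrightarrow> smooth_on V S (f i)"
  shows "dir_deriv (\<lambda>y. \<Sum>i\<in>I. f i y) x v = (\<Sum>i\<in>I. dir_deriv (f i) x v)"
  using assms(4)
  by (induction I rule: infinite_finite_induct)
     (simp_all add: dir_deriv_const dir_deriv_add[OF assms(1-3)] smooth_on_sum)

lemma dir_deriv_inner:
  assumes "relopen V S" "x \<in> S" "v \<in> V"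
  shows "dir_deriv (\<lambda>y. (y - p) \<bullet> b) x v = v \<bullet> b"
  by (rule dir_deriv_eq[OF assms]) (auto intro!: derivative_eq_intros)

lemma relopen_cball:
  assumes "relopen V S" "p \<in> S"
  obtains r where "r > 0" "cball p r \<inter> V \<subseteq> S"
proof -
  obtain W where W: "open W" "S = V \<inter> W"
    using assms(1) by (auto simp: relopen_def openin_open)
  then obtain r where "r > 0" "cball p r \<subseteq> W"
    using assms(2) open_contains_cball by blast
  then show thesis using W that by blast
qed

lemma relopen_ball: "subspace V \<Longrightarrow> relopen V (V \<inter> ball p r)"
  by (intro relopen_Int_open relopen_space open_ball)

text \<open>Differentiating twice, both sides become the same sum in terms of the Hadamard expansion \<open>f y = f x + \<Sum>\<^sub>b (y - x)\<^sub>b g\<^sub>b y\<close>.\<close>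

lemma dir_deriv_commute:
  fixes f :: "'a::euclidean_space \<Rightarrow> real"
  assumes "relopen V S" "x \<in> S" "u \<in> V" "v \<in> V" "smooth_on V S f"
  shows "dir_deriv (\<lambda>y. dir_deriv f y u) x v = dir_deriv (\<lambda>y. dir_deriv f y v) x u"
proof -
  have V: "subspace V" using assms(1) by (rule relopen_subspace)
  obtain r where r: "r > 0" "cball x r \<inter> V \<subseteq> S" using relopen_cball[OF assms(1,2)] by blast
  let ?T = "V \<inter> ball x r"
  have T: "relopen V ?T" "convex ?T" "x \<in> ?T"
    using relopen_ball[OF V] r relopen_subset[OF assms(1)] assms(2)
    by (auto intro: convex_Int subspace_imp_convex[OF V])
  have "smooth_on V ?T f" using assms(5) by (rule smooth_on_subset) (use r in auto)
  from Hadamard[OF T this] obtain g where g: "\<And>b. b \<in> onb V \<Longrightarrow> smooth_on V ?T (g b)"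
    and f: "\<And>y. y \<in> ?T \<Longrightarrow> f y = f x + (\<Sum>b\<in>onb V. ((y - x) \<bullet> b) * g b y)" by metis
  have lin: "smooth_on V ?T (\<lambda>y. (y - x) \<bullet> b)" for b
    by (intro smooth_on_linear_compose[OF bounded_linear_inner_left] smooth_on_diff smooth_on_const
        smooth_on_bounded_linear bounded_linear_ident)
  have d1: "dir_deriv f y u = (\<Sum>b\<in>onb V. ((y - x) \<bullet> b) * dir_deriv (g b) y u + (u \<bullet> b) * g b y)"
    if "y \<in> ?T" "u \<in> V" for y u
  proof -
    have "dir_deriv f y u = dir_deriv (\<lambda>y. f x + (\<Sum>b\<in>onb V. ((y - x) \<bullet> b) * g b y)) y u"
      by (rule dir_deriv_cong[OF T(1) that f])
    also have "\<dots> = (\<Sum>b\<in>onb V. ((y - x) \<bullet> b) * dir_deriv (g b) y u + (u \<bullet> b) * g b y)"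
      using that T(1) g lin
      by (simp add: dir_deriv_add[where S = ?T and V = V] smooth_on_const smooth_on_sum smooth_on_mult dir_deriv_const
          dir_deriv_sum[where S = ?T and V = V] dir_deriv_mult[where S = ?T and V = V] dir_deriv_inner[where S = ?T and V = V])
    finally show ?thesis .
  qed
  have d2: "dir_deriv (\<lambda>y. dir_deriv f y u) x v =
      (\<Sum>b\<in>onb V. (v \<bullet> b) * dir_deriv (g b) x u + (u \<bullet> b) * dir_deriv (g b) x v)"
    if "u \<in> V" "v \<in> V" for u v
  proof -
    have "dir_deriv (\<lambda>y. dir_deriv f y u) x v =
        dir_deriv (\<lambda>y. \<Sum>b\<in>onb V. ((y - x) \<bullet> b) * dir_deriv (g b) y u + (u \<bullet> b) * g b y) x v"
      by (rule dir_deriv_cong[OF T(1,3) that(2)]) (rule d1[OF _ that(1)])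
    also have "\<dots> = (\<Sum>b\<in>onb V. (v \<bullet> b) * dir_deriv (g b) x u + (u \<bullet> b) * dir_deriv (g b) x v)"
      using that T(1,3) g lin smooth_on_dir_deriv[OF T(1) g that(1)]
      by (simp add: dir_deriv_sum[where S = ?T and V = V] dir_deriv_add[where S = ?T and V = V]
          dir_deriv_mult[where S = ?T and V = V] dir_deriv_inner[where S = ?T and V = V]
          smooth_on_const smooth_on_add smooth_on_mult dir_deriv_const)
    finally show ?thesis .
  qed
  show ?thesis unfolding d2[OF assms(3,4)] d2[OF assms(4,3)] by (simp add: add.commute)
qed

section \<open>Ordinary differential equations\<close>

text \<open>The directional derivatives along the basis are bounded on the compact set, and the sum
  of these bounds dominates the operator norm because the basis vectors have norm 1.\<close>

lemma smooth_on_lipschitz: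
  fixes F :: "'a::euclidean_space \<Rightarrow> 'b::real_normed_vector"
  assumes "relopen V S" "smooth_on V S F" "compact K" "convex K" "K \<subseteq> S"
  obtains L where "L \<ge> 0" "\<And>x y. x \<in> K \<Longrightarrow> y \<in> K \<Longrightarrow> norm (F x - F y) \<le> L * norm (x - y)"
proof -
  have V: "subspace V" using assms(1) by (rule relopen_subspace)
  have "\<exists>M. \<forall>x\<in>K. norm (dir_deriv F x b) \<le> M" if "b \<in> onb V" for b
  proof -
    have "continuous_on K (\<lambda>x. dir_deriv F x b)"
      using smooth_on_continuous[OF smooth_on_dir_deriv[OF assms(1,2)]] onb(1)[OF V] that assms(5)
      by (blast intro: continuous_on_subset)
    then have "bounded ((\<lambda>x. dir_deriv F x b) ` K)"
      using assms(3) compact_continuous_image compact_imp_bounded by blast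
    then show ?thesis unfolding bounded_iff by blast
  qed
  then obtain M where M: "\<And>b x. b \<in> onb V \<Longrightarrow> x \<in> K \<Longrightarrow> norm (dir_deriv F x b) \<le> M b"
    by metis
  define L where "L = (\<Sum>b\<in>onb V. \<bar>M b\<bar>)"
  have "norm (F x - F y) \<le> L * norm (x - y)" if "x \<in> K" "y \<in> K" for x y
  proof (rule differentiable_bound[OF assms(4) _ _ that])
    fix z assume z: "z \<in> K"
    show "(F has_derivative (\<lambda>v. \<Sum>b\<in>onb V. (v \<bullet> b) *\<^sub>R dir_deriv F z b)) (at z within K)"
      using dir_deriv_linear(1)[OF assms(1) _ assms(2)] z assms(5) by (blast intro: has_derivative_subset)
    show "onorm (\<lambda>v. \<Sum>b\<in>onb V. (v \<bullet> b) *\<^sub>R dir_deriv F z b) \<le> L"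
    proof (rule onorm_le)
      fix v
      have "norm (\<Sum>b\<in>onb V. (v \<bullet> b) *\<^sub>R dir_deriv F z b) \<le> (\<Sum>b\<in>onb V. \<bar>M b\<bar> * norm v)"
      proof (rule sum_norm_le)
        fix b assume b: "b \<in> onb V"
        have "\<bar>v \<bullet> b\<bar> \<le> norm v" using Cauchy_Schwarz_ineq2[of v b] onb(4)[OF V b] by simp
        moreover have "norm (dir_deriv F z b) \<le> \<bar>M b\<bar>" using M[OF b z] by simp
        ultimately show "norm ((v \<bullet> b) *\<^sub>R dir_deriv F z b) \<le> \<bar>M b\<bar> * norm v"
          by (simp add: mult.commute mult_mono)
      qed
      then show "norm (\<Sum>b\<in>onb V. (v \<bullet> b) *\<^sub>R dir_deriv F z b) \<le> L * norm v"
        by (simp add: L_def sum_distrib_right)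
    qed
  qed
  then show thesis by (intro that[of L]) (auto simp: L_def intro: sum_nonneg)
qed

text \<open>Banach's fixed point theorem for the integral operator on bounded continuous functions.
  Integration starts at \<open>-\<tau>\<close>, which avoids oriented integrals, so \<open>p\<close>
  is the value at \<open>-\<tau>\<close> and not at 0. The interval has length
  \<open>2 * \<tau>\<close>, hence the hypothesis on \<open>4 * \<tau> * L\<close> gives the
  contraction constant 1/2.\<close>

lemma picard:
  fixes H :: "'a::euclidean_space \<Rightarrow> 'a"
  assumes cont: "continuous_on UNIV H" and L: "\<And>x y. norm (H x - H y) \<le> L * norm (x - y)"
    and C: "\<And>x. norm (H x) \<le> C" and "\<tau> \<ge> 0" "L \<ge> 0" "4 * \<tau> * L \<le> 1"
  obtains u where "continuous_on UNIV u"
    and "\<And>t. t \<in> {-\<tau>..\<tau>} \<Longrightarrow> u t = p + integral {-\<tau>..t} (\<lambda>s. H (u s))"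
proof -
  \<comment> \<open>Freezing time outside the interval yields functions on the whole line, as the
    complete metric space of bounded continuous functions requires.\<close>
  define clip where "clip t = max (-\<tau>) (min \<tau> t)" for t
  have clip: "clip t \<in> {-\<tau>..\<tau>}" for t using assms(4) by (auto simp: clip_def)
  define T where "T u t = p + integral {-\<tau>..clip t} (\<lambda>s. H (apply_bcontfun u s))" for u t
  have contH: "continuous_on A (\<lambda>s. H (apply_bcontfun u s))" for u and A :: "real set"
    by (rule continuous_on_compose2[OF cont]) auto
  have int: "(\<lambda>s. H (apply_bcontfun u s)) integrable_on {-\<tau>..clip t}" for u t
    by (intro integrable_continuous_interval contH)
  have nn: "0 \<le> clip t + \<tau>" "clip t + \<tau> \<le> 2 * \<tau>" for t using clip[of t] by auto
  have T: "T u \<in> bcontfun" for u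
  proof -
    have "continuous_on UNIV (\<lambda>t. integral {-\<tau>..clip t} (\<lambda>s. H (apply_bcontfun u s)))"
      by (rule continuous_on_compose2[OF indefinite_integral_continuous_1[OF integrable_continuous_interval[OF contH[where A="{-\<tau>..\<tau>}"]]]])
         (use clip in \<open>auto simp: clip_def intro!: continuous_intros\<close>)
    then have "continuous_on UNIV (T u)" unfolding T_def by (intro continuous_intros)
    moreover have "norm (T u t) \<le> norm p + C * (2 * \<tau>)" for t
    proof -
      have "0 \<le> C" using C[of 0] norm_ge_zero order_trans by blast
      have "norm (integral {-\<tau>..clip t} (\<lambda>s. H (apply_bcontfun u s))) \<le> C * (clip t - - \<tau>)"
        by (rule integral_bound) (use clip C contH in auto)
      also have "\<dots> \<le> C * (2 * \<tau>)" using nn[of t] \<open>0 \<le> C\<close> by (intro mult_left_mono) auto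
      finally show ?thesis unfolding T_def using norm_triangle_ineq[of p] by (smt (verit))
    qed
    then have "bounded (range (T u))" unfolding bounded_iff by blast
    ultimately show ?thesis by (simp add: bcontfun_def)
  qed
  have "dist (Bcontfun (T u)) (Bcontfun (T w)) \<le> (1/2) * dist u w" for u w
  proof (rule dist_bound)
    fix t
    have "dist (T u t) (T w t) =
        norm (integral {-\<tau>..clip t} (\<lambda>s. H (apply_bcontfun u s) - H (apply_bcontfun w s)))"
      by (simp add: T_def dist_norm integral_diff int)
    also have "\<dots> \<le> (L * dist u w) * (clip t - - \<tau>)"
    proof (rule integral_bound)
      fix s
      have "norm (H (apply_bcontfun u s) - H (apply_bcontfun w s)) \<le> L * dist (apply_bcontfun u s) (apply_bcontfun w s)"
        using L by (simp add: dist_norm)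
      also have "\<dots> \<le> L * dist u w" by (intro mult_left_mono dist_bounded assms)
      finally show "norm (H (apply_bcontfun u s) - H (apply_bcontfun w s)) \<le> L * dist u w" .
    qed (use clip in \<open>auto intro!: continuous_intros contH\<close>)
    also have "\<dots> \<le> (L * dist u w) * (2 * \<tau>)"
      using nn[of t] assms by (intro mult_left_mono) auto
    also have "\<dots> = (4 * \<tau> * L) * (dist u w / 2)" by simp
    also have "\<dots> \<le> 1 * (dist u w / 2)" using assms by (intro mult_right_mono) auto
    finally show "dist (Bcontfun (T u) t) (Bcontfun (T w) t) \<le> 1 / 2 * dist u w"
      by (simp add: Bcontfun_inverse T)
  qed
  then obtain u where u: "Bcontfun (T u) = u"
    using banach_fix_type[of "1/2" "\<lambda>u. Bcontfun (T u)"] by auto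
  have eq: "apply_bcontfun u t = T u t" for t using Bcontfun_inverse[OF T[of u]] u by simp
  show thesis
  proof (rule that[of "apply_bcontfun u"])
    fix t assume "t \<in> {-\<tau>..\<tau>}"
    then have "clip t = t" by (auto simp: clip_def)
    then show "apply_bcontfun u t = p + integral {-\<tau>..t} (\<lambda>s. H (apply_bcontfun u s))"
      using eq[of t] unfolding T_def by (simp only:)
  qed simp
qed

text \<open>Only the existence of some integral curve is recorded, without an initial value at time
  0; on a group the initial value can be corrected by a translation.\<close>

lemma integral_curve_exists:
  fixes F :: "'a::euclidean_space \<Rightarrow> 'a"
  assumes "relopen V S" "smooth_on V S F" "F ` S \<subseteq> V" "p \<in> S"
  obtains \<tau> u where "\<tau> > 0" "smooth_on UNIV {-\<tau><..<\<tau>} u" "u ` {-\<tau><..<\<tau>} \<subseteq> S"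
    and "\<And>t. t \<in> {-\<tau><..<\<tau>} \<Longrightarrow> (u has_vector_derivative F (u t)) (at t)"
proof -
  have V: "subspace V" using assms(1) by (rule relopen_subspace)
  have pV: "p \<in> V" using assms(4) relopen_subset[OF assms(1)] by auto
  obtain r where r: "r > 0" "cball p r \<inter> V \<subseteq> S" using relopen_cball[OF assms(1,4)] by blast
  define K where "K = cball p r \<inter> V"
  have "p \<in> K" using r pV by (simp add: K_def)
  then have "K \<noteq> {}" by auto
  moreover have "compact K" "convex K" "closed K" "K \<subseteq> S"
    using r pV closed_subspace[OF V] by (auto simp: K_def intro: compact_Int_closed convex_Int subspace_imp_convex[OF V])
  ultimately have K: "compact K" "convex K" "closed K" "K \<noteq> {}" "K \<subseteq> S" by auto
  obtain L where L: "L \<ge> 0" "\<And>x y. x \<in> K \<Longrightarrow> y \<in> K \<Longrightarrow> norm (F x - F y) \<le> L * norm (x - y)"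
    using smooth_on_lipschitz[OF assms(1,2) K(1,2,5)] by metis
  have contF: "continuous_on K F"
    using smooth_on_continuous[OF assms(2)] K(5) by (rule continuous_on_subset)
  then have "bounded (F ` K)" using K(1) by (intro compact_imp_bounded compact_continuous_image)
  then obtain C where C: "C > 0" "\<And>x. x \<in> K \<Longrightarrow> norm (F x) \<le> C"
    unfolding bounded_pos by auto
  \<comment> \<open>The field is known on \<open>S\<close> only. Precomposing with the nearest-point
    map to the compact convex set \<open>K\<close> makes it global and bounded with the same
    Lipschitz constant, and changes nothing on \<open>K\<close>.\<close>
  define H where "H x = F (closest_point K x)" for x
  have cpK: "closest_point K x \<in> K" for x by (rule closest_point_in_set[OF K(3,4)])
  have HL: "norm (H x - H y) \<le> L * norm (x - y)" for x y
  proof -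
    have "norm (H x - H y) \<le> L * norm (closest_point K x - closest_point K y)"
      unfolding H_def by (rule L(2)[OF cpK cpK])
    also have "\<dots> \<le> L * norm (x - y)"
      using closest_point_lipschitz[OF K(2,3,4)] L(1) by (intro mult_left_mono) (auto simp: dist_norm)
    finally show ?thesis .
  qed
  have contH: "continuous_on UNIV H"
    unfolding H_def
    by (rule continuous_on_compose2[OF contF continuous_on_closest_point[OF K(2,3,4)]]) (use cpK in auto)
  \<comment> \<open>The first bound keeps the curve within distance \<open>r\<close> of
    \<open>p\<close> over a time of length \<open>2 * \<tau>\<close>, the second gives the
    contraction; \<open>L + 1\<close> avoids division by zero.\<close>
  define \<tau> where "\<tau> = min (r / (2 * C)) (1 / (4 * (L + 1)))"
  have \<tau>: "\<tau> > 0" "4 * \<tau> * L \<le> 1" "2 * \<tau> * C \<le> r"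
  proof -
    show "\<tau> > 0" using r C L by (simp add: \<tau>_def)
    have "4 * \<tau> * L \<le> 4 * \<tau> * (L + 1)" using \<open>\<tau> > 0\<close> by simp
    also have "\<dots> \<le> 4 * (1 / (4 * (L + 1))) * (L + 1)"
      using L by (intro mult_right_mono mult_left_mono) (auto simp: \<tau>_def)
    also have "\<dots> = 1" using L by simp
    finally show "4 * \<tau> * L \<le> 1" .
    have "2 * \<tau> * C \<le> 2 * (r / (2 * C)) * C"
      using C by (intro mult_right_mono mult_left_mono) (auto simp: \<tau>_def)
    then show "2 * \<tau> * C \<le> r" using C by simp
  qed
  have HC: "norm (H x) \<le> C" for x
    using C(2)[OF cpK] by (simp add: H_def)
  have HV: "H x \<in> V" for x
    using assms(3) cpK[of x] K(5) unfolding H_def by blast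
  obtain u where u: "continuous_on UNIV u"
      "\<And>t. t \<in> {-\<tau>..\<tau>} \<Longrightarrow> u t = p + integral {-\<tau>..t} (\<lambda>s. H (u s))"
    using picard[OF contH HL HC less_imp_le[OF \<tau>(1)] L(1) \<tau>(2), where p = p] by metis
  have contHu: "continuous_on A (\<lambda>s. H (u s))" for A
    by (rule continuous_on_compose2[OF contH continuous_on_subset[OF u(1)]]) auto
  have uK: "u t \<in> K" if t: "t \<in> {-\<tau>..\<tau>}" for t
  proof -
    have int: "(\<lambda>s. H (u s)) integrable_on {-\<tau>..t}" by (intro integrable_continuous_interval contHu)
    have "norm (u t - p) \<le> C * (t - - \<tau>)"
      unfolding u(2)[OF t] using integral_bound[of "-\<tau>" t "\<lambda>s. H (u s)" C] t HC contHu by simp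
    also have "\<dots> \<le> C * (2 * \<tau>)" using t C by (intro mult_left_mono) auto
    finally have "u t \<in> cball p r" using \<tau>(3) by (simp add: dist_norm norm_minus_commute mult.commute mult.left_commute)
    \<comment> \<open>The projection is linear and fixes the integrand, hence the integral: the
      curve does not leave \<open>V\<close>.\<close>
    moreover have "proj V (integral {-\<tau>..t} (\<lambda>s. H (u s))) = integral {-\<tau>..t} (\<lambda>s. H (u s))"
      using integral_linear[OF int bounded_linear_proj[of V]] proj_id[OF V HV] by (simp add: o_def)
    then have "u t \<in> V"
      unfolding u(2)[OF t] using subspace_add[OF V pV proj_in[OF V, of "integral {-\<tau>..t} (\<lambda>s. H (u s))"]] by (simp only:)
    ultimately show ?thesis by (simp add: K_def)
  qed
  have der: "(u has_vector_derivative F (u t)) (at t)" if t: "t \<in> {-\<tau><..<\<tau>}" for t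
  proof -
    have t': "t \<in> {-\<tau>..\<tau>}" using t by simp
    have "((\<lambda>t. p + integral {-\<tau>..t} (\<lambda>s. H (u s))) has_vector_derivative 0 + H (u t)) (at t within {-\<tau>..\<tau>})"
      by (rule has_vector_derivative_add[OF has_vector_derivative_const
            integral_has_vector_derivative[OF contHu]]) (use t in simp)
    then have "(u has_vector_derivative H (u t)) (at t within {-\<tau>..\<tau>})"
      unfolding has_vector_derivative_def add_0_left
      by (rule has_derivative_transform[OF t', rotated]) (rule u(2))
    moreover have "at t within {-\<tau>..\<tau>} = at t" using t by (intro at_within_interior) (auto simp: interior_atLeastAtMost_real)
    moreover have "H (u t) = F (u t)" using uK[of t] t by (simp add: H_def closest_point_self)
    ultimately show ?thesis by simp
  qed
  have sub: "u ` {-\<tau><..<\<tau>} \<subseteq> S" using uK K(5) by fastforce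
  \<comment> \<open>Bootstrapping: the derivative of \<open>u\<close> is \<open>F\<close> along
    \<open>u\<close>, so each order of smoothness of \<open>u\<close> yields the next.\<close>
  have "Ck_on UNIV {-\<tau><..<\<tau>} k u" for k
  proof (induction k)
    case 0
    show ?case using u(1) by (auto intro: continuous_on_subset)
  next
    case (Suc k)
    show ?case
    proof (rule Ck_on_SucI)
      show "(u has_derivative (\<lambda>s. s *\<^sub>R F (u t))) (at t within {-\<tau><..<\<tau>})" if "t \<in> {-\<tau><..<\<tau>}" for t
        using der[OF that] unfolding has_vector_derivative_def by (rule has_derivative_at_withinI)
      have "Ck_on UNIV {-\<tau><..<\<tau>} k (\<lambda>t. F (u t))"
        by (rule Ck_on_compose[OF relopen_UNIV V relopen_subset[OF assms(1)] sub Suc smooth_onD[OF assms(2)]]) simp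
      then show "Ck_on UNIV {-\<tau><..<\<tau>} k (\<lambda>t. s *\<^sub>R F (u t))" for s
        by (intro Ck_on_scaleR Ck_on_const)
    qed
  qed
  then have "smooth_on UNIV {-\<tau><..<\<tau>} u" by (rule smooth_onI)
  with \<tau>(1) show thesis using sub der by (rule that)
qed

section \<open>Smooth maps\<close>

lemma chart_cover:
  assumes "smooth_manifold M"
  obtains U \<phi> where "(U, \<phi>) \<in> atlas M" "p \<in> U"
proof -
  have "p \<in> (\<Union>(U, \<phi>)\<in>atlas M. U)" using assms by (simp add: smooth_manifold_def)
  then show thesis using that by auto
qed

lemma manifold_model: "smooth_manifold M \<Longrightarrow> subspace (model M)"
  by (simp add: smooth_manifold_def)

lemma chart:
  assumes "smooth_manifold M" "(U, \<phi>) \<in> atlas M"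
  shows "open U" "relopen (model M) (\<phi> ` U)" "homeomorphism U (\<phi> ` U) \<phi> (inv_into U \<phi>)"
  using assms by (auto simp: smooth_manifold_def relopen_def)

lemma chart_inv:
  assumes "smooth_manifold M" "(U, \<phi>) \<in> atlas M" "p \<in> U"
  shows "inv_into U \<phi> (\<phi> p) = p"
  using homeomorphism_apply1[OF chart(3)[OF assms(1,2)] assms(3)] .

lemma chart_inj:
  assumes "smooth_manifold M" "(U, \<phi>) \<in> atlas M"
  shows "inj_on \<phi> U"
  using chart_inv[OF assms] by (metis inj_onI)

lemma chart_transition:
  assumes "smooth_manifold M" "(U, \<phi>) \<in> atlas M" "(W, \<psi>) \<in> atlas M"
  shows "smooth_on (model M) (\<phi> ` (U \<inter> W)) (\<psi> \<circ> inv_into U \<phi>)"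
  using assms unfolding smooth_manifold_def by blast

lemma chart_image_relopen:
  assumes "smooth_manifold M" "(U, \<phi>) \<in> atlas M" "open T" "T \<subseteq> U"
  shows "relopen (model M) (\<phi> ` T)"
proof -
  have "openin (top_of_set U) T" using assms(3,4) by (simp add: open_subset)
  then have "openin (top_of_set (\<phi> ` U)) (\<phi> ` T)"
    using chart(3)[OF assms(1,2)] homeomorphism_imp_open_map by blast
  then show ?thesis
    using chart(2)[OF assms(1,2)] openin_trans unfolding relopen_def by blast
qed

lemma chart_vimage_open:
  assumes "smooth_manifold M" "(U, \<phi>) \<in> atlas M" "open T"
  shows "open (U \<inter> \<phi> -` T)"
  using continuous_on_open_vimage[OF chart(1)[OF assms(1,2)], of \<phi>] homeomorphism_cont1[OF chart(3)[OF assms(1,2)]]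
    assms(3) by (metis inf_commute)

text \<open>One suitable pair of charts around each point is enough: any other pair differs from it
  by transition maps on both sides, and smoothness is local.\<close>

lemma smooth_mapI_local:
  assumes M: "smooth_manifold M" and N: "smooth_manifold N"
    and loc: "\<And>p. \<exists>U \<phi> W \<psi> T. (U, \<phi>) \<in> atlas M \<and> (W, \<psi>) \<in> atlas N \<and> open T \<and> p \<in> T \<and> T \<subseteq> U \<and> f ` T \<subseteq> W \<and>
      smooth_on (model M) (\<phi> ` T) (\<psi> \<circ> f \<circ> inv_into U \<phi>)"
  shows "smooth_map M N f"
proof -
  have "\<exists>T. open T \<and> p \<in> T \<and> continuous_on T f" for p
  proof -
    obtain U \<phi> W \<psi> T where *: "(U, \<phi>) \<in> atlas M" "(W, \<psi>) \<in> atlas N" "open T" "p \<in> T" "T \<subseteq> U" "f ` T \<subseteq> W"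
      "smooth_on (model M) (\<phi> ` T) (\<psi> \<circ> f \<circ> inv_into U \<phi>)" using loc[of p] by blast
    have "continuous_on T \<phi>"
      using homeomorphism_cont1[OF chart(3)[OF M *(1)]] *(5) by (rule continuous_on_subset)
    then have "continuous_on T (\<lambda>x. (\<psi> \<circ> f \<circ> inv_into U \<phi>) (\<phi> x))"
      by (rule continuous_on_compose2[OF smooth_on_continuous[OF *(7)]]) simp
    moreover have eq: "(\<psi> \<circ> f \<circ> inv_into U \<phi>) (\<phi> x) = \<psi> (f x)" if "x \<in> T" for x
      using chart_inv[OF M *(1)] that *(5) by auto
    ultimately have "continuous_on T (\<lambda>x. \<psi> (f x))" by (metis (no_types, lifting) continuous_on_cong)
    then have "continuous_on T (\<lambda>x. inv_into W \<psi> (\<psi> (f x)))"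
      by (rule continuous_on_compose2[OF homeomorphism_cont2[OF chart(3)[OF N *(2)]]]) (use *(6) in auto)
    moreover have "inv_into W \<psi> (\<psi> (f x)) = f x" if "x \<in> T" for x
      using chart_inv[OF N *(2)] that *(6) by auto
    ultimately have "continuous_on T f" by (metis (no_types, lifting) continuous_on_cong)
    then show ?thesis using *(3,4) by blast
  qed
  then have cont: "continuous_on UNIV f"
    by (metis continuous_on_eq_continuous_at continuous_at_imp_continuous_on)
  moreover have "smooth_on (model M) (\<phi>' ` (U' \<inter> f -` W')) (\<psi>' \<circ> f \<circ> inv_into U' \<phi>')"
    if c': "(U', \<phi>') \<in> atlas M" "(W', \<psi>') \<in> atlas N" for U' \<phi>' W' \<psi>'
  proof (rule smooth_on_local)
    have o: "open (f -` W')" using cont chart(1)[OF N c'(2)] by (rule open_vimage[rotated])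
    show ro: "relopen (model M) (\<phi>' ` (U' \<inter> f -` W'))"
      using chart(1)[OF M c'(1)] o by (intro chart_image_relopen[OF M c'(1)]) auto
    fix y assume "y \<in> \<phi>' ` (U' \<inter> f -` W')"
    then obtain p where p: "y = \<phi>' p" "p \<in> U'" "f p \<in> W'" by auto
    obtain U \<phi> W \<psi> T where *: "(U, \<phi>) \<in> atlas M" "(W, \<psi>) \<in> atlas N" "open T" "p \<in> T" "T \<subseteq> U" "f ` T \<subseteq> W"
      "smooth_on (model M) (\<phi> ` T) (\<psi> \<circ> f \<circ> inv_into U \<phi>)" using loc[of p] by blast
    define O' where "O' = T \<inter> U' \<inter> f -` W'"
    have O': "open O'" "p \<in> O'" "O' \<subseteq> U'" "O' \<subseteq> U"
      using * p o chart(1)[OF M c'(1)] by (auto simp: O'_def)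
    have ro': "relopen (model M) (\<phi>' ` O')" using O' by (intro chart_image_relopen[OF M c'(1)])
    obtain T2 where T2: "open T2" "\<phi>' ` O' = model M \<inter> T2"
      using ro' unfolding relopen_def openin_open by auto
    have "\<phi>' ` (U' \<inter> f -` W') \<inter> T2 = \<phi>' ` O'"
      using relopen_subset[OF ro] T2 O'_def by blast
    moreover have "smooth_on (model M) (\<phi>' ` O') (\<psi>' \<circ> f \<circ> inv_into U' \<phi>')"
    proof -
      have 1: "smooth_on (model M) (\<phi>' ` O') (\<phi> \<circ> inv_into U' \<phi>')"
        using chart_transition[OF M c'(1) *(1)] by (rule smooth_on_subset) (use O' in auto)
      have i1: "(\<phi> \<circ> inv_into U' \<phi>') ` (\<phi>' ` O') \<subseteq> \<phi> ` O'"
        using chart_inv[OF M c'(1)] O'(3) by force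
      have 2: "smooth_on (model M) (\<phi> ` O') (\<psi> \<circ> f \<circ> inv_into U \<phi>)"
        using *(7) by (rule smooth_on_subset) (auto simp: O'_def)
      have i2: "(\<psi> \<circ> f \<circ> inv_into U \<phi>) ` (\<phi> ` O') \<subseteq> \<psi> ` (W \<inter> W')"
        using chart_inv[OF M *(1)] O'(4) *(6) by (force simp: O'_def)
      have sub: "\<psi> ` (W \<inter> W') \<subseteq> model N" using relopen_subset[OF chart(2)[OF N *(2)]] by blast
      have im: "(\<lambda>y. (\<psi> \<circ> f \<circ> inv_into U \<phi>) ((\<phi> \<circ> inv_into U' \<phi>') y)) ` (\<phi>' ` O') \<subseteq> \<psi> ` (W \<inter> W')"
        using i1 i2 unfolding image_subset_iff by blast
      have st: "smooth_on (model M) (\<phi>' ` O') (\<lambda>y. (\<psi> \<circ> f \<circ> inv_into U \<phi>) ((\<phi> \<circ> inv_into U' \<phi>') y))"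
        by (rule smooth_on_compose[OF ro' manifold_model[OF M] _ i1 1 2])
           (intro relopen_subset chart_image_relopen[OF M *(1)] O')
      have "smooth_on (model M) (\<phi>' ` O')
          (\<lambda>y. (\<psi>' \<circ> inv_into W \<psi>) ((\<psi> \<circ> f \<circ> inv_into U \<phi>) ((\<phi> \<circ> inv_into U' \<phi>') y)))"
        by (rule smooth_on_compose[OF ro' manifold_model[OF N] sub im st chart_transition[OF N *(2) c'(2)]])
      then show ?thesis
      proof (rule smooth_on_cong[THEN iffD1, rotated])
        fix y assume "y \<in> \<phi>' ` O'"
        then obtain q where q: "y = \<phi>' q" "q \<in> O'" by auto
        then have "q \<in> U'" "q \<in> U" "f q \<in> W" using O' *(6) by (auto simp: O'_def)
        then show "(\<psi>' \<circ> inv_into W \<psi>) ((\<psi> \<circ> f \<circ> inv_into U \<phi>) ((\<phi> \<circ> inv_into U' \<phi>') y)) =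
            (\<psi>' \<circ> f \<circ> inv_into U' \<phi>') y"
          by (simp add: q chart_inv[OF M c'(1)] chart_inv[OF M *(1)] chart_inv[OF N *(2)])
      qed
    qed
    moreover have "y \<in> T2" using T2 O' p by auto
    ultimately show "\<exists>T. open T \<and> y \<in> T \<and>
        smooth_on (model M) (\<phi>' ` (U' \<inter> f -` W') \<inter> T) (\<psi>' \<circ> f \<circ> inv_into U' \<phi>')"
      using T2(1) by metis
  qed
  ultimately show ?thesis unfolding smooth_map_def by auto
qed

lemma smooth_map_continuous: "smooth_map M N f \<Longrightarrow> continuous_on UNIV f"
  by (simp add: smooth_map_def)

lemma smooth_map_vimage_open: "smooth_map M N f \<Longrightarrow> open T \<Longrightarrow> open (f -` T)"
  using smooth_map_continuous open_vimage by blast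

lemma smooth_mapD:
  assumes "smooth_map M N f" "(U, \<phi>) \<in> atlas M" "(W, \<psi>) \<in> atlas N" "T \<subseteq> U" "f ` T \<subseteq> W"
  shows "smooth_on (model M) (\<phi> ` T) (\<psi> \<circ> f \<circ> inv_into U \<phi>)"
proof -
  have "smooth_on (model M) (\<phi> ` (U \<inter> f -` W)) (\<psi> \<circ> f \<circ> inv_into U \<phi>)"
    using assms(1-3) unfolding smooth_map_def by blast
  then show ?thesis by (rule smooth_on_subset) (use assms(4,5) in blast)
qed

lemma smooth_map_compose:
  assumes M: "smooth_manifold M" and N: "smooth_manifold N" and P: "smooth_manifold P"
    and f: "smooth_map M N f" and g: "smooth_map N P g"
  shows "smooth_map M P (\<lambda>x. g (f x))"
proof (rule smooth_mapI_local[OF M P])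
  fix p
  obtain U \<phi> where U: "(U, \<phi>) \<in> atlas M" "p \<in> U" using chart_cover[OF M] .
  obtain W \<psi> where W: "(W, \<psi>) \<in> atlas N" "f p \<in> W" using chart_cover[OF N] .
  obtain X \<kappa> where X: "(X, \<kappa>) \<in> atlas P" "g (f p) \<in> X" using chart_cover[OF P] .
  define Y where "Y = W \<inter> g -` X"
  define T where "T = U \<inter> f -` Y"
  have Y: "open Y" using chart(1)[OF N W(1)] smooth_map_vimage_open[OF g chart(1)[OF P X(1)]] by (auto simp: Y_def)
  have T: "open T" using chart(1)[OF M U(1)] smooth_map_vimage_open[OF f Y] by (auto simp: T_def)
  have 1: "smooth_on (model M) (\<phi> ` T) (\<psi> \<circ> f \<circ> inv_into U \<phi>)"
    by (rule smooth_mapD[OF f U(1) W(1)]) (auto simp: T_def Y_def)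
  have 2: "smooth_on (model N) (\<psi> ` Y) (\<kappa> \<circ> g \<circ> inv_into W \<psi>)"
    by (rule smooth_mapD[OF g W(1) X(1)]) (auto simp: Y_def)
  have inv: "\<And>q. q \<in> T \<Longrightarrow> inv_into U \<phi> (\<phi> q) = q" "\<And>q. q \<in> T \<Longrightarrow> inv_into W \<psi> (\<psi> (f q)) = f q"
    using chart_inv[OF M U(1)] chart_inv[OF N W(1)] by (auto simp: T_def Y_def)
  have ro: "relopen (model M) (\<phi> ` T)"
    using T by (intro chart_image_relopen[OF M U(1)]) (auto simp: T_def)
  have sub: "\<psi> ` Y \<subseteq> model N"
    using Y by (intro relopen_subset chart_image_relopen[OF N W(1)]) (auto simp: Y_def)
  have im: "(\<psi> \<circ> f \<circ> inv_into U \<phi>) ` (\<phi> ` T) \<subseteq> \<psi> ` Y"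
    using inv by (auto simp: T_def)
  have "smooth_on (model M) (\<phi> ` T) (\<lambda>y. (\<kappa> \<circ> g \<circ> inv_into W \<psi>) ((\<psi> \<circ> f \<circ> inv_into U \<phi>) y))"
    by (rule smooth_on_compose[OF ro manifold_model[OF N] sub im 1 2])
  then have "smooth_on (model M) (\<phi> ` T) (\<kappa> \<circ> (\<lambda>x. g (f x)) \<circ> inv_into U \<phi>)"
    by (rule smooth_on_cong[THEN iffD1, rotated]) (use inv in auto)
  moreover have "p \<in> T" "T \<subseteq> U" "(\<lambda>x. g (f x)) ` T \<subseteq> X" using U W X by (auto simp: T_def Y_def)
  ultimately show "\<exists>U \<phi> W \<psi> T. (U, \<phi>) \<in> atlas M \<and> (W, \<psi>) \<in> atlas P \<and> open T \<and> p \<in> T \<and> T \<subseteq> U \<and>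
      (\<lambda>x. g (f x)) ` T \<subseteq> W \<and> smooth_on (model M) (\<phi> ` T) (\<psi> \<circ> (\<lambda>x. g (f x)) \<circ> inv_into U \<phi>)"
    using U(1) X(1) T by blast
qed

lemma smooth_manifold_euclid: "smooth_manifold euclid"
proof -
  have "id ` UNIV = UNIV" by simp
  moreover have "inv_into UNIV id = id" by (simp add: inv_id)
  moreover have "homeomorphism UNIV UNIV id id" by (simp add: homeomorphism_def)
  ultimately show ?thesis
    by (auto simp: smooth_manifold_def euclid_def o_def id_def intro: smooth_on_bounded_linear[OF bounded_linear_ident])
qed

lemma smooth_map_id: "smooth_manifold M \<Longrightarrow> smooth_map M M (\<lambda>x. x)"
  unfolding smooth_map_def using chart_transition by (fastforce simp: o_def)

lemma smooth_map_const:
  assumes M: "smooth_manifold M" and N: "smooth_manifold N"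
  shows "smooth_map M N (\<lambda>x. c)"
proof (rule smooth_mapI_local[OF M N])
  fix p
  obtain U \<phi> where U: "(U, \<phi>) \<in> atlas M" "p \<in> U" using chart_cover[OF M] .
  obtain W \<psi> where W: "(W, \<psi>) \<in> atlas N" "c \<in> W" using chart_cover[OF N] .
  have "smooth_on (model M) (\<phi> ` U) (\<psi> \<circ> (\<lambda>x. c) \<circ> inv_into U \<phi>)"
    by (simp add: o_def smooth_on_const)
  then show "\<exists>U \<phi> W \<psi> T. (U, \<phi>) \<in> atlas M \<and> (W, \<psi>) \<in> atlas N \<and> open T \<and> p \<in> T \<and> T \<subseteq> U \<and>
      (\<lambda>x. c) ` T \<subseteq> W \<and> smooth_on (model M) (\<phi> ` T) (\<psi> \<circ> (\<lambda>x. c) \<circ> inv_into U \<phi>)"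
    using U W chart(1)[OF M U(1)] by blast
qed

section \<open>Product manifolds and maps into and out of them\<close>

lemma prod_model: "model (prod_mfd M N) = model M \<times> model N"
  by (simp add: prod_mfd_def)

lemma prod_chart:
  "(U, \<phi>) \<in> atlas M \<Longrightarrow> (W, \<psi>) \<in> atlas N \<Longrightarrow> (U \<times> W, map_prod \<phi> \<psi>) \<in> atlas (prod_mfd M N)"
  by (force simp: prod_mfd_def)

lemma prod_chartE:
  assumes "(X, \<kappa>) \<in> atlas (prod_mfd M N)"
  obtains U \<phi> W \<psi> where "(U, \<phi>) \<in> atlas M" "(W, \<psi>) \<in> atlas N" "X = U \<times> W" "\<kappa> = map_prod \<phi> \<psi>"
  using assms by (auto simp: prod_mfd_def)

lemma prod_chart_inv:
  assumes "inj_on \<phi> U" "inj_on \<psi> W" "y \<in> \<phi> ` U" "z \<in> \<psi> ` W"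
  shows "inv_into (U \<times> W) (map_prod \<phi> \<psi>) (y, z) = (inv_into U \<phi> y, inv_into W \<psi> z)"
proof -
  have "inj_on (map_prod \<phi> \<psi>) (U \<times> W)" using assms(1,2) by (rule map_prod_inj_on)
  moreover have "(inv_into U \<phi> y, inv_into W \<psi> z) \<in> U \<times> W" using assms(3,4) by (simp add: inv_into_into)
  moreover have "map_prod \<phi> \<psi> (inv_into U \<phi> y, inv_into W \<psi> z) = (y, z)"
    using assms(3,4) by (simp add: f_inv_into_f)
  ultimately show ?thesis by (metis inv_into_f_f)
qed

lemma map_prod_image_Times: "map_prod f g ` (A \<times> B) = f ` A \<times> g ` B"
  by auto

lemma smooth_on_fst_snd:
  assumes "relopen V S" "relopen W T"
  shows "smooth_on V S f \<Longrightarrow> smooth_on (V \<times> W) (S \<times> T) (\<lambda>z. f (fst z))"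
    and "smooth_on W T g \<Longrightarrow> smooth_on (V \<times> W) (S \<times> T) (\<lambda>z. g (snd z))"
proof -
  note ro = relopen_Times[OF assms]
  assume f: "smooth_on V S f"
  show "smooth_on (V \<times> W) (S \<times> T) (\<lambda>z. f (fst z))"
    by (rule smooth_on_compose[OF ro relopen_subspace[OF assms(1)] relopen_subset[OF assms(1)] _
          smooth_on_bounded_linear[OF bounded_linear_fst] f]) auto
next
  note ro = relopen_Times[OF assms]
  assume g: "smooth_on W T g"
  show "smooth_on (V \<times> W) (S \<times> T) (\<lambda>z. g (snd z))"
    by (rule smooth_on_compose[OF ro relopen_subspace[OF assms(2)] relopen_subset[OF assms(2)] _
          smooth_on_bounded_linear[OF bounded_linear_snd] g]) auto
qed

lemma smooth_manifold_prod:
  assumes M: "smooth_manifold M" and N: "smooth_manifold N"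
  shows "smooth_manifold (prod_mfd M N)"
  unfolding smooth_manifold_def
proof (intro conjI ballI, goal_cases)
  case 1
  show ?case by (simp add: prod_model subspace_Times manifold_model M N)
next
  case 2
  have "z \<in> (\<Union>(U, \<phi>)\<in>atlas (prod_mfd M N). U)" for z
  proof -
    obtain U \<phi> where U: "(U, \<phi>) \<in> atlas M" "fst z \<in> U" using chart_cover[OF M] .
    obtain W \<psi> where W: "(W, \<psi>) \<in> atlas N" "snd z \<in> W" using chart_cover[OF N] .
    have "z \<in> U \<times> W" using U W by (simp add: mem_Times_iff)
    then show ?thesis using prod_chart[OF U(1) W(1)] by (auto intro!: bexI[of _ "(U \<times> W, map_prod \<phi> \<psi>)"])
  qed
  then show ?case by auto
next
  case (3 c)
  obtain X \<kappa> where c: "c = (X, \<kappa>)" by fastforce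
  with 3 obtain U \<phi> W \<psi> where *: "(U, \<phi>) \<in> atlas M" "(W, \<psi>) \<in> atlas N" "X = U \<times> W" "\<kappa> = map_prod \<phi> \<psi>"
    using prod_chartE by blast
  have "open (U \<times> W)" using chart(1)[OF M *(1)] chart(1)[OF N *(2)] by (rule open_Times)
  moreover have "relopen (model M \<times> model N) (\<phi> ` U \<times> \<psi> ` W)"
    using chart(2)[OF M *(1)] chart(2)[OF N *(2)] by (rule relopen_Times)
  moreover have "homeomorphism (U \<times> W) (\<phi> ` U \<times> \<psi> ` W) (map_prod \<phi> \<psi>) (inv_into (U \<times> W) (map_prod \<phi> \<psi>))"
  proof (rule homeomorphismI)
    have hom: "homeomorphism U (\<phi> ` U) \<phi> (inv_into U \<phi>)" "homeomorphism W (\<psi> ` W) \<psi> (inv_into W \<psi>)"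
      using chart(3)[OF M *(1)] chart(3)[OF N *(2)] by auto
    have eq: "inv_into (U \<times> W) (map_prod \<phi> \<psi>) z = (inv_into U \<phi> (fst z), inv_into W \<psi> (snd z))"
      if "z \<in> \<phi> ` U \<times> \<psi> ` W" for z
      using prod_chart_inv[OF chart_inj[OF M *(1)] chart_inj[OF N *(2)], of "fst z" "snd z"] that by auto
    have "continuous_on (U \<times> W) (\<lambda>z. (\<phi> (fst z), \<psi> (snd z)))"
      by (intro continuous_on_Pair continuous_on_compose2[OF homeomorphism_cont1[OF hom(1)]]
          continuous_on_compose2[OF homeomorphism_cont1[OF hom(2)]] continuous_on_fst continuous_on_snd continuous_on_id) auto
    then show "continuous_on (U \<times> W) (map_prod \<phi> \<psi>)" by (simp add: map_prod_def case_prod_beta)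
    have "continuous_on (\<phi> ` U \<times> \<psi> ` W) (\<lambda>z. (inv_into U \<phi> (fst z), inv_into W \<psi> (snd z)))"
      by (intro continuous_on_Pair continuous_on_compose2[OF homeomorphism_cont2[OF hom(1)]]
          continuous_on_compose2[OF homeomorphism_cont2[OF hom(2)]] continuous_on_fst continuous_on_snd continuous_on_id) auto
    then show "continuous_on (\<phi> ` U \<times> \<psi> ` W) (inv_into (U \<times> W) (map_prod \<phi> \<psi>))"
      by (rule continuous_on_eq) (simp add: eq)
    show "inv_into (U \<times> W) (map_prod \<phi> \<psi>) ` (\<phi> ` U \<times> \<psi> ` W) \<subseteq> U \<times> W"
      using eq by (auto simp: inv_into_into)
    show "inv_into (U \<times> W) (map_prod \<phi> \<psi>) (map_prod \<phi> \<psi> z) = z" if "z \<in> U \<times> W" for z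
      using that eq[of "map_prod \<phi> \<psi> z"] chart_inv[OF M *(1)] chart_inv[OF N *(2)] by auto
    show "map_prod \<phi> \<psi> (inv_into (U \<times> W) (map_prod \<phi> \<psi>) z) = z" if "z \<in> \<phi> ` U \<times> \<psi> ` W" for z
      using that eq by (auto simp: f_inv_into_f)
  qed auto
  ultimately show ?case
    unfolding c *(3,4) by (simp add: prod_model map_prod_image_Times relopen_def)
next
  case (4 c)
  obtain X \<kappa> where c: "c = (X, \<kappa>)" by fastforce
  with 4 obtain U \<phi> W \<psi> where *: "(U, \<phi>) \<in> atlas M" "(W, \<psi>) \<in> atlas N" "X = U \<times> W" "\<kappa> = map_prod \<phi> \<psi>"
    using prod_chartE by blast
  show ?case
    unfolding c prod.case
  proof
    fix d assume "d \<in> atlas (prod_mfd M N)"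
    moreover obtain X' \<kappa>' where d: "d = (X', \<kappa>')" by fastforce
    ultimately obtain U' \<phi>' W' \<psi>' where **: "(U', \<phi>') \<in> atlas M" "(W', \<psi>') \<in> atlas N" "X' = U' \<times> W'" "\<kappa>' = map_prod \<phi>' \<psi>'"
      using prod_chartE by blast
    have ro: "relopen (model M) (\<phi> ` (U \<inter> U'))" "relopen (model N) (\<psi> ` (W \<inter> W'))"
      using chart(1)[OF M] chart(1)[OF N] * ** by (auto intro!: chart_image_relopen[OF M *(1)] chart_image_relopen[OF N *(2)])
    have "smooth_on (model M \<times> model N) (\<phi> ` (U \<inter> U') \<times> \<psi> ` (W \<inter> W'))
       (\<lambda>z. ((\<phi>' \<circ> inv_into U \<phi>) (fst z), (\<psi>' \<circ> inv_into W \<psi>) (snd z)))"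
      by (intro smooth_on_Pair smooth_on_fst_snd ro chart_transition[OF M *(1) **(1)] chart_transition[OF N *(2) **(2)])
    then have "smooth_on (model M \<times> model N) (\<phi> ` (U \<inter> U') \<times> \<psi> ` (W \<inter> W'))
       (map_prod \<phi>' \<psi>' \<circ> inv_into (U \<times> W) (map_prod \<phi> \<psi>))"
      by (rule smooth_on_cong[THEN iffD1, rotated])
         (use prod_chart_inv[OF chart_inj[OF M *(1)] chart_inj[OF N *(2)]] in auto)
    moreover have "map_prod \<phi> \<psi> ` (U \<times> W \<inter> U' \<times> W') = \<phi> ` (U \<inter> U') \<times> \<psi> ` (W \<inter> W')"
      by auto
    ultimately show "case d of (W, \<psi>) \<Rightarrow> smooth_on (model (prod_mfd M N)) (\<kappa> ` (X \<inter> W)) (\<psi> \<circ> inv_into X \<kappa>)"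
      unfolding d * ** by (simp add: prod_model)
  qed
qed

lemma smooth_map_fst:
  assumes M: "smooth_manifold M" and N: "smooth_manifold N"
  shows "smooth_map (prod_mfd M N) M fst" and "smooth_map (prod_mfd M N) N snd"
proof -
  have *: "\<exists>U \<phi> W \<psi>. (U, \<phi>) \<in> atlas M \<and> (W, \<psi>) \<in> atlas N \<and> p \<in> U \<times> W" for p
  proof -
    obtain U \<phi> where "(U, \<phi>) \<in> atlas M" "fst p \<in> U" using chart_cover[OF M] .
    moreover obtain W \<psi> where "(W, \<psi>) \<in> atlas N" "snd p \<in> W" using chart_cover[OF N] .
    ultimately show ?thesis by (metis mem_Times_iff)
  qed
  note MN = smooth_manifold_prod[OF M N]
  show "smooth_map (prod_mfd M N) M fst"
  proof (rule smooth_mapI_local[OF MN M])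
    fix p
    obtain U \<phi> W \<psi> where c: "(U, \<phi>) \<in> atlas M" "(W, \<psi>) \<in> atlas N" "p \<in> U \<times> W" using *[of p] by blast
    have "smooth_on (model (prod_mfd M N)) (map_prod \<phi> \<psi> ` (U \<times> W)) fst"
      by (intro smooth_on_bounded_linear bounded_linear_fst)
    then have "smooth_on (model (prod_mfd M N)) (map_prod \<phi> \<psi> ` (U \<times> W)) (\<phi> \<circ> fst \<circ> inv_into (U \<times> W) (map_prod \<phi> \<psi>))"
      by (rule smooth_on_cong[THEN iffD1, rotated])
         (use prod_chart_inv[OF chart_inj[OF M c(1)] chart_inj[OF N c(2)]] chart_inv[OF M c(1)] in auto)
    then show "\<exists>U \<phi> W \<psi> T. (U, \<phi>) \<in> atlas (prod_mfd M N) \<and> (W, \<psi>) \<in> atlas M \<and> open T \<and> p \<in> T \<and> T \<subseteq> U \<and>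
      fst ` T \<subseteq> W \<and> smooth_on (model (prod_mfd M N)) (\<phi> ` T) (\<psi> \<circ> fst \<circ> inv_into U \<phi>)"
      using prod_chart[OF c(1,2)] c chart(1)[OF MN prod_chart[OF c(1,2)]]
      by (intro exI[of _ "U \<times> W"] exI[of _ "map_prod \<phi> \<psi>"] exI[of _ U] exI[of _ \<phi>]) auto
  qed
  show "smooth_map (prod_mfd M N) N snd"
  proof (rule smooth_mapI_local[OF MN N])
    fix p
    obtain U \<phi> W \<psi> where c: "(U, \<phi>) \<in> atlas M" "(W, \<psi>) \<in> atlas N" "p \<in> U \<times> W" using *[of p] by blast
    have "smooth_on (model (prod_mfd M N)) (map_prod \<phi> \<psi> ` (U \<times> W)) snd"
      by (intro smooth_on_bounded_linear bounded_linear_snd)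
    then have "smooth_on (model (prod_mfd M N)) (map_prod \<phi> \<psi> ` (U \<times> W)) (\<psi> \<circ> snd \<circ> inv_into (U \<times> W) (map_prod \<phi> \<psi>))"
      by (rule smooth_on_cong[THEN iffD1, rotated])
         (use prod_chart_inv[OF chart_inj[OF M c(1)] chart_inj[OF N c(2)]] chart_inv[OF N c(2)] in auto)
    then show "\<exists>U \<phi> W \<psi> T. (U, \<phi>) \<in> atlas (prod_mfd M N) \<and> (W, \<psi>) \<in> atlas N \<and> open T \<and> p \<in> T \<and> T \<subseteq> U \<and>
      snd ` T \<subseteq> W \<and> smooth_on (model (prod_mfd M N)) (\<phi> ` T) (\<psi> \<circ> snd \<circ> inv_into U \<phi>)"
      using prod_chart[OF c(1,2)] c chart(1)[OF MN prod_chart[OF c(1,2)]]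
      by (intro exI[of _ "U \<times> W"] exI[of _ "map_prod \<phi> \<psi>"] exI[of _ W] exI[of _ \<psi>]) auto
  qed
qed

lemma smooth_map_Pair:
  assumes P: "smooth_manifold P" and M: "smooth_manifold M" and N: "smooth_manifold N"
    and f: "smooth_map P M f" and g: "smooth_map P N g"
  shows "smooth_map P (prod_mfd M N) (\<lambda>x. (f x, g x))"
proof (rule smooth_mapI_local[OF P smooth_manifold_prod[OF M N]])
  fix p
  obtain X \<kappa> where X: "(X, \<kappa>) \<in> atlas P" "p \<in> X" using chart_cover[OF P] .
  obtain U \<phi> where U: "(U, \<phi>) \<in> atlas M" "f p \<in> U" using chart_cover[OF M] .
  obtain W \<psi> where W: "(W, \<psi>) \<in> atlas N" "g p \<in> W" using chart_cover[OF N] .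
  define T where "T = X \<inter> f -` U \<inter> g -` W"
  have T: "open T" using chart(1)[OF P X(1)] smooth_map_vimage_open[OF f chart(1)[OF M U(1)]]
    smooth_map_vimage_open[OF g chart(1)[OF N W(1)]] by (auto simp: T_def)
  have "smooth_on (model P) (\<kappa> ` T) (\<lambda>y. ((\<phi> \<circ> f \<circ> inv_into X \<kappa>) y, (\<psi> \<circ> g \<circ> inv_into X \<kappa>) y))"
    by (intro smooth_on_Pair smooth_mapD[OF f X(1) U(1)] smooth_mapD[OF g X(1) W(1)]) (auto simp: T_def)
  then have "smooth_on (model P) (\<kappa> ` T) (map_prod \<phi> \<psi> \<circ> (\<lambda>x. (f x, g x)) \<circ> inv_into X \<kappa>)"
    by (simp add: o_def)
  moreover have "p \<in> T" "T \<subseteq> X" "(\<lambda>x. (f x, g x)) ` T \<subseteq> U \<times> W" using X U W by (auto simp: T_def)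
  ultimately show "\<exists>U \<phi> W \<psi> T. (U, \<phi>) \<in> atlas P \<and> (W, \<psi>) \<in> atlas (prod_mfd M N) \<and> open T \<and> p \<in> T \<and> T \<subseteq> U \<and>
      (\<lambda>x. (f x, g x)) ` T \<subseteq> W \<and> smooth_on (model P) (\<phi> ` T) (\<psi> \<circ> (\<lambda>x. (f x, g x)) \<circ> inv_into U \<phi>)"
    using X(1) prod_chart[OF U(1) W(1)] T by blast
qed

section \<open>Real-valued smooth functions and cutoffs\<close>

lemma smooth_funD:
  assumes "f \<in> smooth_fun M" "(U, \<phi>) \<in> atlas M"
  shows "smooth_on (model M) (\<phi> ` U) (f \<circ> inv_into U \<phi>)"
proof -
  have "smooth_on (model M) (\<phi> ` U) (id \<circ> f \<circ> inv_into U \<phi>)"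
    using assms by (intro smooth_mapD[of M line f U \<phi> UNIV id U]) (auto simp: smooth_fun_def euclid_def)
  then show ?thesis by (simp add: o_def)
qed

lemma smooth_funI_local:
  assumes M: "smooth_manifold M"
    and "\<And>p. \<exists>U \<phi> T. (U, \<phi>) \<in> atlas M \<and> open T \<and> p \<in> T \<and> T \<subseteq> U \<and>
      smooth_on (model M) (\<phi> ` T) (f \<circ> inv_into U \<phi>)"
  shows "f \<in> smooth_fun M"
proof -
  have "smooth_map M line f"
  proof (rule smooth_mapI_local[OF M smooth_manifold_euclid])
    fix p
    obtain U \<phi> T where "(U, \<phi>) \<in> atlas M" "open T" "p \<in> T" "T \<subseteq> U"
      "smooth_on (model M) (\<phi> ` T) (f \<circ> inv_into U \<phi>)" using assms(2) by blast
    then show "\<exists>U \<phi> W \<psi> T. (U, \<phi>) \<in> atlas M \<and> (W, \<psi>) \<in> atlas line \<and> open T \<and> p \<in> T \<and> T \<subseteq> U \<and> f ` T \<subseteq> W \<and>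
      smooth_on (model M) (\<phi> ` T) (\<psi> \<circ> f \<circ> inv_into U \<phi>)"
      by (intro exI[of _ U] exI[of _ \<phi>] exI[of _ UNIV] exI[of _ id] exI[of _ T]) (auto simp: euclid_def o_def)
  qed
  then show ?thesis by (simp add: smooth_fun_def)
qed

lemma smooth_funI_chart:
  assumes M: "smooth_manifold M"
    and "\<And>U \<phi>. (U, \<phi>) \<in> atlas M \<Longrightarrow> smooth_on (model M) (\<phi> ` U) (f \<circ> inv_into U \<phi>)"
  shows "f \<in> smooth_fun M"
proof (rule smooth_funI_local[OF M])
  fix p
  obtain U \<phi> where "(U, \<phi>) \<in> atlas M" "p \<in> U" using chart_cover[OF M] .
  then show "\<exists>U \<phi> T. (U, \<phi>) \<in> atlas M \<and> open T \<and> p \<in> T \<and> T \<subseteq> U \<and>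
      smooth_on (model M) (\<phi> ` T) (f \<circ> inv_into U \<phi>)"
    using chart(1)[OF M] assms(2) by blast
qed

lemma smooth_fun_const: "smooth_manifold M \<Longrightarrow> (\<lambda>x. c) \<in> smooth_fun M"
  by (rule smooth_funI_chart) (auto simp: o_def smooth_on_const)

lemma smooth_fun_add:
  "smooth_manifold M \<Longrightarrow> f \<in> smooth_fun M \<Longrightarrow> g \<in> smooth_fun M \<Longrightarrow> (\<lambda>x. f x + g x) \<in> smooth_fun M"
  by (rule smooth_funI_chart, assumption, drule smooth_funD, assumption, drule smooth_funD, assumption)
     (auto simp: o_def intro: smooth_on_add)

lemma smooth_fun_mult:
  "smooth_manifold M \<Longrightarrow> f \<in> smooth_fun M \<Longrightarrow> g \<in> smooth_fun M \<Longrightarrow> (\<lambda>x. f x * g x) \<in> smooth_fun M"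
  by (rule smooth_funI_chart, assumption, drule smooth_funD, assumption, drule smooth_funD, assumption)
     (auto simp: o_def intro: smooth_on_mult)

lemma smooth_fun_diff:
  assumes "smooth_manifold M" "f \<in> smooth_fun M" "g \<in> smooth_fun M"
  shows "(\<lambda>x. f x - g x) \<in> smooth_fun M"
  using smooth_fun_add[OF assms(1,2) smooth_fun_mult[OF assms(1) smooth_fun_const[OF assms(1), of "-1"] assms(3)]]
  by simp

lemma smooth_fun_sum:
  "smooth_manifold M \<Longrightarrow> (\<And>i. i \<in> I \<Longrightarrow> f i \<in> smooth_fun M) \<Longrightarrow> (\<lambda>x. \<Sum>i\<in>I. f i x) \<in> smooth_fun M"
  by (induction I rule: infinite_finite_induct) (auto intro: smooth_fun_const smooth_fun_add)

lemma smooth_fun_compose: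
  assumes "smooth_manifold M" "smooth_manifold N" "smooth_map M N F" "h \<in> smooth_fun N"
  shows "(\<lambda>x. h (F x)) \<in> smooth_fun M"
  using smooth_map_compose[OF assms(1,2) smooth_manifold_euclid assms(3)] assms(4) by (simp add: smooth_fun_def)

text \<open>The preimage of \<open>K\<close> under the chart is compact, hence closed because the
  manifold is Hausdorff. So a point outside \<open>U\<close> has a neighbourhood on which the
  extension vanishes.\<close>

lemma smooth_fun_extend:
  fixes M :: "('m::{t2_space,second_countable_topology}, 'e::euclidean_space) mfd"
  assumes M: "smooth_manifold M" and U: "(U, \<phi>) \<in> atlas M"
    and K: "compact K" "K \<subseteq> \<phi> ` U" and g: "smooth_on (model M) (\<phi> ` U) g"
    and 0: "\<And>y. y \<in> \<phi> ` U \<Longrightarrow> y \<notin> K \<Longrightarrow> g y = 0"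
  shows "(\<lambda>q. if q \<in> U then g (\<phi> q) else 0) \<in> smooth_fun M" (is "?f \<in> _")
proof (rule smooth_funI_local[OF M])
  fix p
  show "\<exists>U \<phi> T. (U, \<phi>) \<in> atlas M \<and> open T \<and> p \<in> T \<and> T \<subseteq> U \<and> smooth_on (model M) (\<phi> ` T) (?f \<circ> inv_into U \<phi>)"
  proof (cases "p \<in> U")
    case True
    have "smooth_on (model M) (\<phi> ` U) (?f \<circ> inv_into U \<phi>)"
      using g by (rule smooth_on_cong[THEN iffD1, rotated]) (use chart_inv[OF M U] in auto)
    then show ?thesis using U chart(1)[OF M U] True by blast
  next
    case False
    have "continuous_on K (inv_into U \<phi>)"
      using homeomorphism_cont2[OF chart(3)[OF M U]] K(2) by (rule continuous_on_subset)
    then have C: "closed (inv_into U \<phi> ` K)"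
      using K(1) by (intro compact_imp_closed compact_continuous_image)
    have pC: "p \<notin> inv_into U \<phi> ` K" using False K(2) by (auto simp: inv_into_into subset_iff)
    obtain U' \<phi>' where U': "(U', \<phi>') \<in> atlas M" "p \<in> U'" using chart_cover[OF M] .
    define T where "T = U' - inv_into U \<phi> ` K"
    have T: "open T" "p \<in> T" "T \<subseteq> U'" using C pC U' chart(1)[OF M U'(1)] by (auto simp: T_def)
    have z: "g (\<phi> q) = 0" if "q \<in> T" "q \<in> U" for q
    proof -
      have "\<phi> q \<notin> K" using that chart_inv[OF M U that(2)] by (force simp: T_def)
      then show ?thesis using 0 that by auto
    qed
    have "smooth_on (model M) (\<phi>' ` T) (?f \<circ> inv_into U' \<phi>')"
      by (rule smooth_on_cong[THEN iffD1, rotated, OF smooth_on_const[of _ _ 0]])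
         (use z chart_inv[OF M U'(1)] T(3) in \<open>auto simp: subset_iff\<close>)
    then show ?thesis using U' T by blast
  qed
qed

lemma chart_ball:
  assumes M: "smooth_manifold M" and U: "(U, \<phi>) \<in> atlas M" "p \<in> U"
  obtains r where "r > 0" "cball (\<phi> p) (3 * r) \<inter> model M \<subseteq> \<phi> ` U"
proof -
  obtain r where "r > 0" "cball (\<phi> p) r \<inter> model M \<subseteq> \<phi> ` U"
    using relopen_cball[OF chart(2)[OF M U(1)]] U(2) by blast
  then show thesis using that[of "r / 3"] by simp
qed

text \<open>The cutoff vanishes from radius \<open>2 * r\<close> on while \<open>g\<close> is smooth
  up to \<open>3 * r\<close>: the open ball of radius \<open>3 * r\<close> and the complement of the
  closed one of radius \<open>2 * r\<close> overlap, and the product is smooth on both.\<close>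

lemma smooth_fun_cutoff:
  fixes M :: "('m::{t2_space,second_countable_topology}, 'e::euclidean_space) mfd"
  assumes M: "smooth_manifold M" and U: "(U, \<phi>) \<in> atlas M" "p \<in> U"
    and r: "r > 0" "cball (\<phi> p) (3 * r) \<inter> model M \<subseteq> \<phi> ` U"
    and g: "smooth_on (model M) (model M \<inter> ball (\<phi> p) (3 * r)) g"
  shows "(\<lambda>q. if q \<in> U then bump (\<phi> p) r (\<phi> q) * g (\<phi> q) else 0) \<in> smooth_fun M"
proof (rule smooth_fun_extend[OF M U(1)])
  note ro = chart(2)[OF M U(1)]
  have V: "subspace (model M)" by (rule manifold_model[OF M])
  show "compact (cball (\<phi> p) (2 * r) \<inter> model M)" by (intro compact_Int_closed closed_subspace V) simp
  show "cball (\<phi> p) (2 * r) \<inter> model M \<subseteq> \<phi> ` U" using r by auto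
  show "smooth_on (model M) (\<phi> ` U) (\<lambda>y. bump (\<phi> p) r y * g y)"
  proof (rule smooth_on_local[OF ro])
    fix y assume y: "y \<in> \<phi> ` U"
    show "\<exists>T. open T \<and> y \<in> T \<and> smooth_on (model M) (\<phi> ` U \<inter> T) (\<lambda>y. bump (\<phi> p) r y * g y)"
    proof (cases "y \<in> ball (\<phi> p) (3 * r)")
      case True
      have "\<phi> ` U \<inter> ball (\<phi> p) (3 * r) \<subseteq> model M \<inter> ball (\<phi> p) (3 * r)" using relopen_subset[OF ro] by auto
      with g have "smooth_on (model M) (\<phi> ` U \<inter> ball (\<phi> p) (3 * r)) g" by (rule smooth_on_subset)
      moreover have "smooth_on (model M) (\<phi> ` U \<inter> ball (\<phi> p) (3 * r)) (bump (\<phi> p) r)"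
        by (rule smooth_on_bump[OF r(1) relopen_Int_open[OF ro open_ball]])
      ultimately show ?thesis using True by (intro exI[of _ "ball (\<phi> p) (3 * r)"]) (auto intro: smooth_on_mult)
    next
      case False
      have "smooth_on (model M) (\<phi> ` U \<inter> - cball (\<phi> p) (2 * r)) (\<lambda>y. bump (\<phi> p) r y * g y)"
        by (rule smooth_on_cong[THEN iffD1, rotated, OF smooth_on_const[of _ _ 0]])
           (auto simp: dist_commute not_le bump_eq_0[OF r(1) less_imp_le])
      then show ?thesis using False r(1) by (intro exI[of _ "- cball (\<phi> p) (2 * r)"]) auto
    qed
  qed
  show "bump (\<phi> p) r y * g y = 0" if "y \<in> \<phi> ` U" "y \<notin> cball (\<phi> p) (2 * r) \<inter> model M" for y
  proof -
    have "2 * r \<le> dist y (\<phi> p)" using that relopen_subset[OF ro] by (auto simp: dist_commute)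
    then show ?thesis by (simp add: bump_eq_0[OF r(1)])
  qed
qed

lemma smooth_fun_bump:
  fixes M :: "('m::{t2_space,second_countable_topology}, 'e::euclidean_space) mfd"
  assumes M: "smooth_manifold M" and T: "open T" "p \<in> T"
  obtains f where "f \<in> smooth_fun M" "f p = 1" "\<And>q. q \<notin> T \<Longrightarrow> f q = 0"
proof -
  obtain U \<phi> where U: "(U, \<phi>) \<in> atlas M" "p \<in> U" using chart_cover[OF M] .
  have "relopen (model M) (\<phi> ` (U \<inter> T))" using T chart(1)[OF M U(1)] by (intro chart_image_relopen[OF M U(1)]) auto
  then obtain r0 where r0: "r0 > 0" "cball (\<phi> p) r0 \<inter> model M \<subseteq> \<phi> ` (U \<inter> T)"
    using relopen_cball U(2) T(2) by (metis IntI imageI)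
  define r where "r = r0 / 3"
  have r: "r > 0" "cball (\<phi> p) (3 * r) \<inter> model M \<subseteq> \<phi> ` (U \<inter> T)" using r0 by (auto simp: r_def)
  define f where "f q = (if q \<in> U then bump (\<phi> p) r (\<phi> q) * 1 else 0)" for q
  show thesis
  proof
    show "f \<in> smooth_fun M"
      unfolding f_def using r by (intro smooth_fun_cutoff[OF M U]) (auto intro: smooth_on_const)
    show "f p = 1" using U r by (simp add: f_def bump_eq_1)
    fix q assume q: "q \<notin> T"
    show "f q = 0"
    proof (cases "q \<in> U")
      case True
      have "\<phi> q \<notin> cball (\<phi> p) (3 * r)"
      proof
        assume "\<phi> q \<in> cball (\<phi> p) (3 * r)"
        moreover have "\<phi> q \<in> model M" using True relopen_subset[OF chart(2)[OF M U(1)]] by auto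
        ultimately obtain q' where "q' \<in> U \<inter> T" "\<phi> q = \<phi> q'" using r by blast
        then show False using chart_inj[OF M U(1)] True q by (auto dest: inj_onD)
      qed
      then show ?thesis using bump_eq_0[OF r(1), of "\<phi> q" "\<phi> p"] r(1) by (simp add: f_def dist_commute)
    qed (simp add: f_def)
  qed
qed

lemma smooth_fun_separate:
  fixes M :: "('m::{t2_space,second_countable_topology}, 'e::euclidean_space) mfd"
  assumes "smooth_manifold M" "\<And>f. f \<in> smooth_fun M \<Longrightarrow> f p = f q"
  shows "p = q"
proof (rule ccontr)
  assume "p \<noteq> q"
  then obtain f where "f \<in> smooth_fun M" "f p = 1" "f q = 0"
    using smooth_fun_bump[OF assms(1), of "- {q}" p] by auto
  with assms(2)[of f] show False by simp
qed

section \<open>Tangent vectors\<close>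

lemma tangent_lin:
  assumes "v \<in> tangent M p" "f \<in> smooth_fun M" "g \<in> smooth_fun M"
  shows "v (\<lambda>x. a * f x + b * g x) = a * v f + b * v g"
  using assms by (simp add: tangent_def)

lemma tangent_mult:
  assumes "v \<in> tangent M p" "f \<in> smooth_fun M" "g \<in> smooth_fun M"
  shows "v (\<lambda>x. f x * g x) = f p * v g + g p * v f"
  using assms by (simp add: tangent_def)

lemma tangent_not_smooth: "v \<in> tangent M p \<Longrightarrow> f \<notin> smooth_fun M \<Longrightarrow> v f = 0"
  by (simp add: tangent_def)

lemma tangent_add:
  assumes "v \<in> tangent M p" "f \<in> smooth_fun M" "g \<in> smooth_fun M"
  shows "v (\<lambda>x. f x + g x) = v f + v g"
  using tangent_lin[OF assms, of 1 1] by simp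

lemma tangent_diff:
  assumes "v \<in> tangent M p" "f \<in> smooth_fun M" "g \<in> smooth_fun M"
  shows "v (\<lambda>x. f x - g x) = v f - v g"
  using tangent_lin[OF assms, of 1 "-1"] by simp

lemma tangent_cmult:
  assumes "v \<in> tangent M p" "f \<in> smooth_fun M"
  shows "v (\<lambda>x. a * f x) = a * v f"
  using tangent_lin[OF assms assms(2), of a 0] by simp

lemma tangent_const:
  assumes "smooth_manifold M" "v \<in> tangent M p"
  shows "v (\<lambda>x. c) = 0"
proof -
  note s = smooth_fun_const[OF assms(1)]
  have "v (\<lambda>x. 1) = 0" using tangent_mult[OF assms(2) s s, of 1 1] by simp
  then show ?thesis using tangent_cmult[OF assms(2) s, of c 1] by simp
qed

lemma tangent_sum:
  assumes "smooth_manifold M" "v \<in> tangent M p" "\<And>i. i \<in> I \<Longrightarrow> f i \<in> smooth_fun M"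
  shows "v (\<lambda>x. \<Sum>i\<in>I. f i x) = (\<Sum>i\<in>I. v (f i))"
  using assms(3)
  by (induction I rule: infinite_finite_induct)
     (simp_all add: tangent_const[OF assms(1,2)] tangent_add[OF assms(2)] smooth_fun_sum[OF assms(1)])

lemma tangentI:
  assumes "\<And>f g a b. f \<in> smooth_fun M \<Longrightarrow> g \<in> smooth_fun M \<Longrightarrow> v (\<lambda>x. a * f x + b * g x) = a * v f + b * v g"
    and "\<And>f g. f \<in> smooth_fun M \<Longrightarrow> g \<in> smooth_fun M \<Longrightarrow> v (\<lambda>x. f x * g x) = f p * v g + g p * v f"
    and "\<And>f. f \<notin> smooth_fun M \<Longrightarrow> v f = 0"
  shows "v \<in> tangent M p"
  using assms unfolding tangent_def by blast

lemma tangent_eqI: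
  assumes "u \<in> tangent M p" "v \<in> tangent M q" "\<And>f. f \<in> smooth_fun M \<Longrightarrow> u f = v f"
  shows "u = v"
proof
  show "u f = v f" for f
    using assms tangent_not_smooth[OF assms(1)] tangent_not_smooth[OF assms(2)] by (cases "f \<in> smooth_fun M") auto
qed

lemma tangent_lincomb:
  assumes "u \<in> tangent M p" "v \<in> tangent M p"
  shows "lincomb a u b v \<in> tangent M p"
  by (rule tangentI)
     (simp_all add: lincomb_def tangent_lin[OF assms(1)] tangent_lin[OF assms(2)] tangent_mult[OF assms(1)]
      tangent_mult[OF assms(2)] tangent_not_smooth[OF assms(1)] tangent_not_smooth[OF assms(2)] algebra_simps)

lemma tscale_lincomb: "tscale a u = lincomb a u 0 u"
  by (simp add: tscale_def lincomb_def)

lemma tdiff_lincomb: "tdiff u v = lincomb 1 u (-1) v"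
  by (simp add: tdiff_def lincomb_def)

lemma tangent_tscale: "u \<in> tangent M p \<Longrightarrow> tscale a u \<in> tangent M p"
  by (simp add: tscale_lincomb tangent_lincomb)

lemma tangent_tdiff: "u \<in> tangent M p \<Longrightarrow> v \<in> tangent M p \<Longrightarrow> tdiff u v \<in> tangent M p"
  by (simp add: tdiff_lincomb tangent_lincomb)

lemma tangent_zero: "(\<lambda>f. 0) \<in> tangent M p"
  by (rule tangentI) auto

lemma dmap_apply: "h \<in> smooth_fun N \<Longrightarrow> dmap N F v h = v (\<lambda>x. h (F x))"
  by (simp add: dmap_def o_def)

lemma dmap_tangent:
  assumes M: "smooth_manifold M" and N: "smooth_manifold N" and F: "smooth_map M N F"
    and v: "v \<in> tangent M p"
  shows "dmap N F v \<in> tangent N (F p)"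
proof (rule tangentI)
  note c = smooth_fun_compose[OF M N F]
  show "dmap N F v (\<lambda>x. a * f x + b * g x) = a * dmap N F v f + b * dmap N F v g"
    if "f \<in> smooth_fun N" "g \<in> smooth_fun N" for f g a b
    using that tangent_lin[OF v c c]
    by (simp add: dmap_apply smooth_fun_add[OF N] smooth_fun_mult[OF N] smooth_fun_const[OF N])
  show "dmap N F v (\<lambda>x. f x * g x) = f (F p) * dmap N F v g + g (F p) * dmap N F v f"
    if "f \<in> smooth_fun N" "g \<in> smooth_fun N" for f g
    using that tangent_mult[OF v c c] by (simp add: dmap_apply smooth_fun_mult[OF N])
qed (simp add: dmap_def)

lemma dmap_compose:
  assumes "smooth_manifold N" "smooth_manifold P" "smooth_map N P G"
  shows "dmap P G (dmap N F v) = dmap P (\<lambda>x. G (F x)) v"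
proof
  fix h
  show "dmap P G (dmap N F v) h = dmap P (\<lambda>x. G (F x)) v h"
    using smooth_fun_compose[OF assms, of h] by (simp add: dmap_def o_def)
qed

lemma dmap_id: "v \<in> tangent M p \<Longrightarrow> dmap M (\<lambda>x. x) v = v"
  by (rule ext) (simp add: dmap_def o_def tangent_not_smooth)

lemma dmap_lincomb: "dmap N F (lincomb a u b v) = lincomb a (dmap N F u) b (dmap N F v)"
  by (rule ext) (simp add: dmap_def lincomb_def)

lemma dmap_tdiff: "dmap N F (tdiff u v) = tdiff (dmap N F u) (dmap N F v)"
  by (simp add: tdiff_lincomb dmap_lincomb)

lemma dmap_tscale: "dmap N F (tscale a u) = tscale a (dmap N F u)"
  by (simp add: tscale_lincomb dmap_lincomb)

text \<open>Multiplying \<open>f - g\<close> by a bump function supported in \<open>T\<close> gives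
  zero, and by the Leibniz rule the derivative of this product is that of \<open>f - g\<close>,
  since \<open>f - g\<close> vanishes at \<open>p\<close> and the bump is 1 there.\<close>

lemma tangent_local:
  fixes M :: "('m::{t2_space,second_countable_topology}, 'e::euclidean_space) mfd"
  assumes M: "smooth_manifold M" and v: "v \<in> tangent M p"
    and fg: "f \<in> smooth_fun M" "g \<in> smooth_fun M" and T: "open T" "p \<in> T" "\<And>x. x \<in> T \<Longrightarrow> f x = g x"
  shows "v f = v g"
proof -
  obtain h where h: "h \<in> smooth_fun M" "h p = 1" "\<And>q. q \<notin> T \<Longrightarrow> h q = 0"
    using smooth_fun_bump[OF M T(1,2)] by blast
  let ?d = "\<lambda>x. f x - g x"
  have d: "?d \<in> smooth_fun M" by (rule smooth_fun_diff[OF M fg])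
  have "(\<lambda>x. ?d x * h x) = (\<lambda>x. 0)" using h(3) T(3) by fastforce
  then have "v (\<lambda>x. ?d x * h x) = 0" using tangent_const[OF M v] by simp
  moreover have "?d p = 0" using T by simp
  ultimately have "v ?d = 0" using tangent_mult[OF v d h(1)] h(2) by simp
  then show ?thesis using tangent_diff[OF v fg] by simp
qed

text \<open>The \<open>x b\<close> are globally smooth, hence legitimate arguments of derivations.
  The formula is demanded at every point of \<open>T\<close>, so that it applies to vector fields,
  whose base point varies.\<close>

definition coords :: "('m::topological_space, 'e::euclidean_space) mfd \<Rightarrow> 'm set \<Rightarrow> ('m \<Rightarrow> 'e) \<Rightarrow> 'm set
    \<Rightarrow> ('e \<Rightarrow> 'm \<Rightarrow> real) \<Rightarrow> bool" where
  "coords M U \<phi> T x \<longleftrightarrow> open T \<and> T \<subseteq> U \<and>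
     (\<forall>b\<in>onb (model M). x b \<in> smooth_fun M) \<and>
     (\<forall>q\<in>T. \<forall>v\<in>tangent M q. \<forall>f\<in>smooth_fun M.
        v f = (\<Sum>b\<in>onb (model M). v (x b) * dir_deriv (f \<circ> inv_into U \<phi>) (\<phi> q) b))"

lemma coordsD:
  assumes "coords M U \<phi> T x"
  shows "open T" "T \<subseteq> U" "\<And>b. b \<in> onb (model M) \<Longrightarrow> x b \<in> smooth_fun M"
    and "\<And>q v f. q \<in> T \<Longrightarrow> v \<in> tangent M q \<Longrightarrow> f \<in> smooth_fun M \<Longrightarrow>
      v f = (\<Sum>b\<in>onb (model M). v (x b) * dir_deriv (f \<circ> inv_into U \<phi>) (\<phi> q) b)"
  using assms unfolding coords_def by blast+

text \<open>Hadamard's lemma at \<open>\<phi> q\<close> writes \<open>f\<close> minus its value at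
  \<open>q\<close> as a sum of products with one factor vanishing at \<open>q\<close>. Cutoffs make
  all functions global, \<open>tangent_local\<close> ignores the change this causes away from
  \<open>T\<close>, and the Leibniz rule keeps only the derivatives of the vanishing factors. The
  domain is convex, so every \<open>q\<close> in \<open>T\<close> can serve as centre.\<close>

lemma local_coordinates:
  fixes M :: "('m::{t2_space,second_countable_topology}, 'e::euclidean_space) mfd"
  assumes M: "smooth_manifold M" and U: "(U, \<phi>) \<in> atlas M" "p \<in> U"
  obtains T x where "p \<in> T" "coords M U \<phi> T x"
proof -
  obtain r where r: "r > 0" "cball (\<phi> p) (3 * r) \<inter> model M \<subseteq> \<phi> ` U" using chart_ball[OF M U] .
  let ?V = "model M"
  have V: "subspace ?V" by (rule manifold_model[OF M])
  note ro = chart(2)[OF M U(1)]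
  define S where "S = ?V \<inter> ball (\<phi> p) (3 * r)"
  have S: "relopen ?V S" "convex S" "S \<subseteq> \<phi> ` U"
    using r relopen_ball[OF V] by (auto simp: S_def intro!: convex_Int subspace_imp_convex[OF V])
  define ext where "ext g q = (if q \<in> U then bump (\<phi> p) r (\<phi> q) * g (\<phi> q) else 0)" for g :: "'e \<Rightarrow> real" and q
  have ext: "ext g \<in> smooth_fun M" if "smooth_on ?V S g" for g
    unfolding ext_def using smooth_fun_cutoff[OF M U r] that by (simp add: S_def)
  define T where "T = U \<inter> \<phi> -` ball (\<phi> p) r"
  have T: "open T" "p \<in> T" "T \<subseteq> U"
    using chart_vimage_open[OF M U(1) open_ball] U(2) r(1) by (auto simp: T_def)
  have extT: "ext g q = g (\<phi> q)" if "q \<in> T" for g q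
    using that bump_eq_1[OF r(1), of "\<phi> q" "\<phi> p"] by (auto simp: ext_def T_def dist_commute)
  define x where "x b = ext (\<lambda>y. y \<bullet> b)" for b
  have x: "x b \<in> smooth_fun M" for b
    unfolding x_def by (intro ext smooth_on_bounded_linear bounded_linear_inner_left)
  have "v f = (\<Sum>b\<in>onb ?V. v (x b) * dir_deriv (f \<circ> inv_into U \<phi>) (\<phi> q) b)"
    if q: "q \<in> T" and v: "v \<in> tangent M q" and f: "f \<in> smooth_fun M" for q v f
  proof -
    let ?f = "f \<circ> inv_into U \<phi>"
    have qS: "\<phi> q \<in> S" using q relopen_subset[OF ro] r(1) by (auto simp: S_def T_def)
    have sf: "smooth_on ?V S ?f" using smooth_funD[OF f U(1)] S(3) by (rule smooth_on_subset)
    show "v f = (\<Sum>b\<in>onb ?V. v (x b) * dir_deriv ?f (\<phi> q) b)"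
    proof (rule Hadamard[OF S(1,2) qS sf])
      fix g assume g: "\<And>b. b \<in> onb ?V \<Longrightarrow> smooth_on ?V S (g b)"
        "\<And>b. b \<in> onb ?V \<Longrightarrow> g b (\<phi> q) = dir_deriv ?f (\<phi> q) b"
        "\<And>y. y \<in> S \<Longrightarrow> ?f y = ?f (\<phi> q) + (\<Sum>b\<in>onb ?V. ((y - \<phi> q) \<bullet> b) * g b y)"
      let ?h = "\<lambda>z. \<Sum>b\<in>onb ?V. (x b z - \<phi> q \<bullet> b) * ext (g b) z"
      have sm: "(\<lambda>z. x b z - \<phi> q \<bullet> b) \<in> smooth_fun M" for b
        by (intro smooth_fun_diff smooth_fun_const M x)
      have sm': "(\<lambda>z. (x b z - \<phi> q \<bullet> b) * ext (g b) z) \<in> smooth_fun M" if "b \<in> onb ?V" for b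
        by (intro smooth_fun_mult M sm ext g(1) that)
      have h: "?h \<in> smooth_fun M" by (intro smooth_fun_sum M sm')
      have "v f = v (\<lambda>z. f q + ?h z)"
      proof (rule tangent_local[OF M v f _ T(1) q])
        show "(\<lambda>z. f q + ?h z) \<in> smooth_fun M" by (intro smooth_fun_add smooth_fun_const M h)
        fix z assume z: "z \<in> T"
        then have "z \<in> U" "\<phi> z \<in> S" using relopen_subset[OF ro] r(1) by (auto simp: S_def T_def)
        then have "f z = ?f (\<phi> q) + (\<Sum>b\<in>onb ?V. ((\<phi> z - \<phi> q) \<bullet> b) * g b (\<phi> z))"
          using g(3)[of "\<phi> z"] chart_inv[OF M U(1)] by simp
        then show "f z = f q + ?h z"
          using chart_inv[OF M U(1)] q T(3) by (simp add: x_def extT[OF z] inner_diff_left subset_iff)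
      qed
      also have "\<dots> = v ?h"
        using tangent_add[OF v smooth_fun_const[OF M] h, of "f q"] tangent_const[OF M v] by simp
      also have "\<dots> = (\<Sum>b\<in>onb ?V. v (\<lambda>z. (x b z - \<phi> q \<bullet> b) * ext (g b) z))"
        by (rule tangent_sum[OF M v sm'])
      also have "\<dots> = (\<Sum>b\<in>onb ?V. v (x b) * dir_deriv ?f (\<phi> q) b)"
      proof (rule sum.cong[OF refl])
        fix b assume b: "b \<in> onb ?V"
        have "v (\<lambda>z. (x b z - \<phi> q \<bullet> b) * ext (g b) z) =
            (x b q - \<phi> q \<bullet> b) * v (ext (g b)) + ext (g b) q * v (\<lambda>z. x b z - \<phi> q \<bullet> b)"
          by (rule tangent_mult[OF v sm ext[OF g(1)[OF b]]])
        also have "x b q = \<phi> q \<bullet> b" by (simp add: x_def extT[OF q])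
        also have "ext (g b) q = dir_deriv ?f (\<phi> q) b" using g(2)[OF b] by (simp add: extT[OF q])
        also have "v (\<lambda>z. x b z - \<phi> q \<bullet> b) = v (x b)"
          using tangent_diff[OF v x smooth_fun_const[OF M], of b "\<phi> q \<bullet> b"] tangent_const[OF M v] by simp
        finally show "v (\<lambda>z. (x b z - \<phi> q \<bullet> b) * ext (g b) z) = v (x b) * dir_deriv ?f (\<phi> q) b"
          by (simp add: o_def)
      qed
      finally show "v f = (\<Sum>b\<in>onb ?V. v (x b) * dir_deriv ?f (\<phi> q) b)" .
    qed
  qed
  then have "coords M U \<phi> T x" using T x unfolding coords_def by blast
  with T(2) show thesis by (rule that)
qed

lemma coordinate_tangent:
  assumes M: "smooth_manifold M" and U: "(U, \<phi>) \<in> atlas M" "p \<in> U" and w: "w \<in> model M"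
  shows "(\<lambda>f. if f \<in> smooth_fun M then dir_deriv (f \<circ> inv_into U \<phi>) (\<phi> p) w else 0) \<in> tangent M p"
proof (rule tangentI)
  fix f g a b assume f: "f \<in> smooth_fun M" and g: "g \<in> smooth_fun M"
  note ro = chart(2)[OF M U(1)]
  have p: "\<phi> p \<in> \<phi> ` U" using U(2) by simp
  note sf = smooth_funD[OF f U(1)] and sg = smooth_funD[OF g U(1)]
  show "(if (\<lambda>x. a * f x + b * g x) \<in> smooth_fun M
        then dir_deriv ((\<lambda>x. a * f x + b * g x) \<circ> inv_into U \<phi>) (\<phi> p) w else 0) =
       a * (if f \<in> smooth_fun M then dir_deriv (f \<circ> inv_into U \<phi>) (\<phi> p) w else 0) +
       b * (if g \<in> smooth_fun M then dir_deriv (g \<circ> inv_into U \<phi>) (\<phi> p) w else 0)"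
    using f g dir_deriv_add[OF ro p w smooth_on_mult[OF smooth_on_const[of _ _ a] sf] smooth_on_mult[OF smooth_on_const[of _ _ b] sg]]
      dir_deriv_mult[OF ro p w smooth_on_const[of _ _ a] sf] dir_deriv_mult[OF ro p w smooth_on_const[of _ _ b] sg]
    by (simp add: smooth_fun_add smooth_fun_mult smooth_fun_const M o_def dir_deriv_const)
  show "(if (\<lambda>x. f x * g x) \<in> smooth_fun M then dir_deriv ((\<lambda>x. f x * g x) \<circ> inv_into U \<phi>) (\<phi> p) w else 0) =
       f p * (if g \<in> smooth_fun M then dir_deriv (g \<circ> inv_into U \<phi>) (\<phi> p) w else 0) +
       g p * (if f \<in> smooth_fun M then dir_deriv (f \<circ> inv_into U \<phi>) (\<phi> p) w else 0)"
    using f g dir_deriv_mult[OF ro p w sf sg] chart_inv[OF M U]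
    by (simp add: smooth_fun_mult M o_def)
qed simp

text \<open>A derivation is recovered from its values on finitely many functions. This lets bilinear
  forms on tangent vectors be written as polynomials in such values.\<close>

lemma tangent_basis:
  fixes M :: "('m::{t2_space,second_countable_topology}, 'e::euclidean_space) mfd"
  assumes M: "smooth_manifold M"
  obtains I :: "'e set" and x e where "finite I" "\<And>b. b \<in> I \<Longrightarrow> x b \<in> smooth_fun M"
    and "\<And>b. b \<in> I \<Longrightarrow> e b \<in> tangent M p"
    and "\<And>v. v \<in> tangent M p \<Longrightarrow> v = (\<lambda>f. \<Sum>b\<in>I. v (x b) * e b f)"
proof -
  obtain U \<phi> where U: "(U, \<phi>) \<in> atlas M" "p \<in> U" using chart_cover[OF M] .
  obtain T x where pT: "p \<in> T" and co: "coords M U \<phi> T x"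
    using local_coordinates[OF M U] .
  note T = coordsD(1)[OF co] pT coordsD(2)[OF co] and xs = coordsD(3)[OF co] and x = coordsD(4)[OF co]
  define e where "e b = (\<lambda>f. if f \<in> smooth_fun M then dir_deriv (f \<circ> inv_into U \<phi>) (\<phi> p) b else 0)" for b
  note V = manifold_model[OF M]
  show thesis
  proof (rule that[of "onb (model M)" x e])
    show "e b \<in> tangent M p" if "b \<in> onb (model M)" for b
      unfolding e_def using coordinate_tangent[OF M U] onb(1)[OF V] that by blast
    show "v = (\<lambda>f. \<Sum>b\<in>onb (model M). v (x b) * e b f)" if v: "v \<in> tangent M p" for v
    proof
      fix f
      show "v f = (\<Sum>b\<in>onb (model M). v (x b) * e b f)"
        using x[OF T(2) v, of f] tangent_not_smooth[OF v, of f] by (cases "f \<in> smooth_fun M") (simp_all add: e_def)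
    qed
  qed (use onb(2)[OF V] xs in auto)
qed

section \<open>Derivations acting on one variable of a function on a product\<close>

lemma smooth_fun_slice:
  assumes M: "smooth_manifold M" and N: "smooth_manifold N" and F: "F \<in> smooth_fun (prod_mfd N M)"
  shows "(\<lambda>m. F (n, m)) \<in> smooth_fun M" and "(\<lambda>n. F (n, m)) \<in> smooth_fun N"
proof -
  show "(\<lambda>m. F (n, m)) \<in> smooth_fun M"
    by (rule smooth_fun_compose[OF M smooth_manifold_prod[OF N M] _ F])
       (intro smooth_map_Pair smooth_map_const smooth_map_id M N)
  show "(\<lambda>n. F (n, m)) \<in> smooth_fun N"
    by (rule smooth_fun_compose[OF N smooth_manifold_prod[OF N M] _ F])
       (intro smooth_map_Pair smooth_map_const smooth_map_id M N)
qed

lemma smooth_on_prod_chart: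
  assumes M: "smooth_manifold M" and N: "smooth_manifold N" and F: "F \<in> smooth_fun (prod_mfd N M)"
    and U: "(U, \<phi>) \<in> atlas M" and W: "(W, \<psi>) \<in> atlas N"
  shows "smooth_on (model N \<times> model M) (\<psi> ` W \<times> \<phi> ` U) (\<lambda>z. F (inv_into W \<psi> (fst z), inv_into U \<phi> (snd z)))"
proof -
  have "smooth_on (model N \<times> model M) (\<psi> ` W \<times> \<phi> ` U) (F \<circ> inv_into (W \<times> U) (map_prod \<psi> \<phi>))"
    using smooth_funD[OF F prod_chart[OF W U]] by (simp add: prod_model map_prod_image_Times)
  then show ?thesis
    by (rule smooth_on_cong[THEN iffD1, rotated])
       (use prod_chart_inv[OF chart_inj[OF N W] chart_inj[OF M U]] in auto)
qed

lemma smooth_fun_prodI: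
  assumes M: "smooth_manifold M" and N: "smooth_manifold N"
    and loc: "\<And>n m. \<exists>W \<psi> U \<phi> T. (W, \<psi>) \<in> atlas N \<and> (U, \<phi>) \<in> atlas M \<and> n \<in> W \<and> open T \<and> m \<in> T \<and> T \<subseteq> U \<and>
      smooth_on (model N \<times> model M) (\<psi> ` W \<times> \<phi> ` T) (\<lambda>z. F (inv_into W \<psi> (fst z), inv_into U \<phi> (snd z)))"
  shows "F \<in> smooth_fun (prod_mfd N M)"
proof (rule smooth_funI_local[OF smooth_manifold_prod[OF N M]])
  fix p :: "'c \<times> 'a"
  obtain W \<psi> U \<phi> T where *: "(W, \<psi>) \<in> atlas N" "(U, \<phi>) \<in> atlas M" "fst p \<in> W" "open T" "snd p \<in> T" "T \<subseteq> U"
    "smooth_on (model N \<times> model M) (\<psi> ` W \<times> \<phi> ` T) (\<lambda>z. F (inv_into W \<psi> (fst z), inv_into U \<phi> (snd z)))"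
    using loc[of "fst p" "snd p"] by blast
  have "smooth_on (model N \<times> model M) (\<psi> ` W \<times> \<phi> ` T) (F \<circ> inv_into (W \<times> U) (map_prod \<psi> \<phi>))"
    using *(7) by (rule smooth_on_cong[THEN iffD1, rotated])
       (use prod_chart_inv[OF chart_inj[OF N *(1)] chart_inj[OF M *(2)]] *(6) in auto)
  then have "smooth_on (model (prod_mfd N M)) (map_prod \<psi> \<phi> ` (W \<times> T)) (F \<circ> inv_into (W \<times> U) (map_prod \<psi> \<phi>))"
    by (simp add: prod_model map_prod_image_Times)
  moreover have "open (W \<times> T)" using chart(1)[OF N *(1)] *(4) by (rule open_Times)
  moreover have "p \<in> W \<times> T" "W \<times> T \<subseteq> W \<times> U" using * by (auto simp: mem_Times_iff)
  ultimately show "\<exists>U \<phi> T. (U, \<phi>) \<in> atlas (prod_mfd N M) \<and> open T \<and> p \<in> T \<and> T \<subseteq> U \<and>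
      smooth_on (model (prod_mfd N M)) (\<phi> ` T) (F \<circ> inv_into U \<phi>)"
    using prod_chart[OF *(1,2)] by blast
qed

lemma dir_deriv_slice:
  shows "dir_deriv (\<lambda>y. H (z, y)) y v = dir_deriv H (z, y) (0, v)"
    and "dir_deriv (\<lambda>z. H (z, y)) z w = dir_deriv H (z, y) (w, 0)"
  by (simp_all add: dir_deriv_def)

text \<open>In coordinates the function is the sum over \<open>b\<close> of the component of
  \<open>X\<close> times a partial derivative of \<open>F\<close>; here the coordinate formula is
  used at all points near \<open>m0\<close>.\<close>

lemma smooth_fun_vf_param:
  fixes M :: "('m::{t2_space,second_countable_topology}, 'e::euclidean_space) mfd"
    and N :: "('n::{t2_space,second_countable_topology}, 'f::euclidean_space) mfd"
  assumes M: "smooth_manifold M" and N: "smooth_manifold N" and F: "F \<in> smooth_fun (prod_mfd N M)"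
    and X: "X \<in> vector_fields M"
  shows "(\<lambda>(n, m). X m (\<lambda>m'. F (n, m'))) \<in> smooth_fun (prod_mfd N M)"
proof (rule smooth_fun_prodI[OF M N])
  fix n0 m0
  obtain W \<psi> where W: "(W, \<psi>) \<in> atlas N" "n0 \<in> W" using chart_cover[OF N] .
  obtain U \<phi> where U: "(U, \<phi>) \<in> atlas M" "m0 \<in> U" using chart_cover[OF M] .
  obtain T x where pT: "m0 \<in> T" and co: "coords M U \<phi> T x"
    using local_coordinates[OF M U] .
  note T = coordsD(1)[OF co] pT coordsD(2)[OF co] and xs = coordsD(3)[OF co] and x = coordsD(4)[OF co]
  let ?H = "\<lambda>z. F (inv_into W \<psi> (fst z), inv_into U \<phi> (snd z))"
  have ro: "relopen (model N) (\<psi> ` W)" "relopen (model M) (\<phi> ` U)" "relopen (model M) (\<phi> ` T)"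
    using chart(2)[OF N W(1)] chart(2)[OF M U(1)] chart_image_relopen[OF M U(1) T(1,3)] by auto
  have H: "smooth_on (model N \<times> model M) (\<psi> ` W \<times> \<phi> ` T) ?H"
    by (rule smooth_on_subset[OF smooth_on_prod_chart[OF M N F U(1) W(1)]]) (use T(3) in auto)
  have "smooth_on (model N \<times> model M) (\<psi> ` W \<times> \<phi> ` T)
      (\<lambda>z. \<Sum>b\<in>onb (model M). ((\<lambda>m. X m (x b)) \<circ> inv_into U \<phi>) (snd z) * dir_deriv ?H z (0, b))"
  proof (intro smooth_on_sum smooth_on_mult)
    fix b assume b: "b \<in> onb (model M)"
    have "(\<lambda>m. X m (x b)) \<in> smooth_fun M" using X xs[OF b] by (simp add: vector_fields_def)
    then have "smooth_on (model M) (\<phi> ` U) ((\<lambda>m. X m (x b)) \<circ> inv_into U \<phi>)"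
      by (rule smooth_funD[OF _ U(1)])
    then have "smooth_on (model M) (\<phi> ` T) ((\<lambda>m. X m (x b)) \<circ> inv_into U \<phi>)"
      by (rule smooth_on_subset) (use T(3) in auto)
    then show "smooth_on (model N \<times> model M) (\<psi> ` W \<times> \<phi> ` T) (\<lambda>z. ((\<lambda>m. X m (x b)) \<circ> inv_into U \<phi>) (snd z))"
      by (rule smooth_on_fst_snd(2)[OF ro(1,3)])
    show "smooth_on (model N \<times> model M) (\<psi> ` W \<times> \<phi> ` T) (\<lambda>z. dir_deriv ?H z (0, b))"
      using b onb(1)[OF manifold_model[OF M]] manifold_model[OF N]
      by (intro smooth_on_dir_deriv relopen_Times ro H) (auto simp: subspace_0)
  qed
  then have "smooth_on (model N \<times> model M) (\<psi> ` W \<times> \<phi> ` T)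
     (\<lambda>z. (case (inv_into W \<psi> (fst z), inv_into U \<phi> (snd z)) of (n, m) \<Rightarrow> X m (\<lambda>m'. F (n, m'))))"
  proof (rule smooth_on_cong[THEN iffD1, rotated])
    fix z assume "z \<in> \<psi> ` W \<times> \<phi> ` T"
    then obtain n m where nm: "z = (\<psi> n, \<phi> m)" "n \<in> W" "m \<in> T" by auto
    then have inv: "inv_into W \<psi> (fst z) = n" "inv_into U \<phi> (snd z) = m"
      using chart_inv[OF N W(1)] chart_inv[OF M U(1)] T(3) by auto
    have "X m \<in> tangent M m" using X by (simp add: vector_fields_def)
    from x[OF nm(3) this smooth_fun_slice(1)[OF M N F]]
    have "X m (\<lambda>m'. F (n, m')) = (\<Sum>b\<in>onb (model M). X m (x b) * dir_deriv ((\<lambda>m'. F (n, m')) \<circ> inv_into U \<phi>) (\<phi> m) b)" .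
    moreover have "dir_deriv ((\<lambda>m'. F (n, m')) \<circ> inv_into U \<phi>) (\<phi> m) b = dir_deriv ?H z (0, b)" for b
      using dir_deriv_slice(1)[of ?H "\<psi> n" "\<phi> m" b] inv by (simp add: nm o_def)
    ultimately show "(\<Sum>b\<in>onb (model M). ((\<lambda>m. X m (x b)) \<circ> inv_into U \<phi>) (snd z) * dir_deriv ?H z (0, b)) =
      (case (inv_into W \<psi> (fst z), inv_into U \<phi> (snd z)) of (n, m) \<Rightarrow> X m (\<lambda>m'. F (n, m')))"
      by (simp add: inv)
  qed
  then show "\<exists>W \<psi> U \<phi> T. (W, \<psi>) \<in> atlas N \<and> (U, \<phi>) \<in> atlas M \<and> n0 \<in> W \<and> open T \<and> m0 \<in> T \<and> T \<subseteq> U \<and>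
      smooth_on (model N \<times> model M) (\<psi> ` W \<times> \<phi> ` T)
        (\<lambda>z. (case (inv_into W \<psi> (fst z), inv_into U \<phi> (snd z)) of (n, m) \<Rightarrow> X m (\<lambda>m'. F (n, m'))))"
    using W U T by blast
qed

lemma smooth_fun_tangent_param:
  fixes M :: "('m::{t2_space,second_countable_topology}, 'e::euclidean_space) mfd"
    and N :: "('n::{t2_space,second_countable_topology}, 'f::euclidean_space) mfd"
  assumes M: "smooth_manifold M" and N: "smooth_manifold N" and F: "F \<in> smooth_fun (prod_mfd N M)"
    and v: "v \<in> tangent M p"
  shows "(\<lambda>n. v (\<lambda>m. F (n, m))) \<in> smooth_fun N"
proof (rule smooth_funI_chart[OF N])
  fix W \<psi> assume W: "(W, \<psi>) \<in> atlas N"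
  obtain U \<phi> where U: "(U, \<phi>) \<in> atlas M" "p \<in> U" using chart_cover[OF M] .
  obtain T x where pT: "p \<in> T" and co: "coords M U \<phi> T x"
    using local_coordinates[OF M U] .
  note T = coordsD(1)[OF co] pT coordsD(2)[OF co] and xs = coordsD(3)[OF co] and x = coordsD(4)[OF co]
  let ?H = "\<lambda>z. F (inv_into W \<psi> (fst z), inv_into U \<phi> (snd z))"
  have ro: "relopen (model N) (\<psi> ` W)" "relopen (model M) (\<phi> ` U)"
    using chart(2)[OF N W] chart(2)[OF M U(1)] by auto
  note roP = relopen_Times[OF ro]
  have H: "smooth_on (model N \<times> model M) (\<psi> ` W \<times> \<phi> ` U) ?H"
    by (rule smooth_on_prod_chart[OF M N F U(1) W])
  have "smooth_on (model N) (\<psi> ` W) (\<lambda>y. \<Sum>b\<in>onb (model M). v (x b) * dir_deriv ?H (y, \<phi> p) (0, b))"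
  proof (intro smooth_on_sum smooth_on_mult smooth_on_const)
    fix b assume b: "b \<in> onb (model M)"
    have d: "smooth_on (model N \<times> model M) (\<psi> ` W \<times> \<phi> ` U) (\<lambda>z. dir_deriv ?H z (0, b))"
      using b onb(1)[OF manifold_model[OF M]] manifold_model[OF N]
      by (intro smooth_on_dir_deriv roP H) (auto simp: subspace_0)
    have i: "smooth_on (model N) (\<psi> ` W) (\<lambda>y. (y, \<phi> p))"
      by (intro smooth_on_Pair smooth_on_const smooth_on_bounded_linear bounded_linear_ident)
    show "smooth_on (model N) (\<psi> ` W) (\<lambda>y. dir_deriv ?H (y, \<phi> p) (0, b))"
      by (rule smooth_on_compose[OF ro(1) relopen_subspace[OF roP] relopen_subset[OF roP] _ i d]) (use U in auto)
  qed
  then show "smooth_on (model N) (\<psi> ` W) ((\<lambda>n. v (\<lambda>m. F (n, m))) \<circ> inv_into W \<psi>)"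
  proof (rule smooth_on_cong[THEN iffD1, rotated])
    fix y assume "y \<in> \<psi> ` W"
    then obtain n where n: "y = \<psi> n" "n \<in> W" by auto
    then have inv: "inv_into W \<psi> y = n" using chart_inv[OF N W] by simp
    have "dir_deriv ((\<lambda>m. F (n, m)) \<circ> inv_into U \<phi>) (\<phi> p) b = dir_deriv ?H (y, \<phi> p) (0, b)" for b
      using dir_deriv_slice(1)[of ?H y "\<phi> p" b] inv by (simp add: o_def)
    then show "(\<Sum>b\<in>onb (model M). v (x b) * dir_deriv ?H (y, \<phi> p) (0, b)) =
        ((\<lambda>n. v (\<lambda>m. F (n, m))) \<circ> inv_into W \<psi>) y"
      using x[OF T(2) v smooth_fun_slice(1)[OF M N F]] by (simp add: inv)
  qed
qed

text \<open>Expanding both derivations in coordinates reduces this to the symmetry of the mixed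
  second derivatives in the directions \<open>(0, b)\<close> and \<open>(c, 0)\<close>.\<close>

lemma tangent_commute:
  fixes M :: "('m::{t2_space,second_countable_topology}, 'e::euclidean_space) mfd"
    and N :: "('n::{t2_space,second_countable_topology}, 'f::euclidean_space) mfd"
  assumes M: "smooth_manifold M" and N: "smooth_manifold N" and F: "F \<in> smooth_fun (prod_mfd N M)"
    and v: "v \<in> tangent M p" and u: "u \<in> tangent N q"
  shows "u (\<lambda>n. v (\<lambda>m. F (n, m))) = v (\<lambda>m. u (\<lambda>n. F (n, m)))"
proof -
  obtain U \<phi> where U: "(U, \<phi>) \<in> atlas M" "p \<in> U" using chart_cover[OF M] .
  obtain T x where pT: "p \<in> T" and co: "coords M U \<phi> T x"
    using local_coordinates[OF M U] .
  note T = coordsD(1)[OF co] pT coordsD(2)[OF co] and xs = coordsD(3)[OF co] and x = coordsD(4)[OF co]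
  obtain W \<psi> where W: "(W, \<psi>) \<in> atlas N" "q \<in> W" using chart_cover[OF N] .
  obtain T' x' where pT': "q \<in> T'" and co': "coords N W \<psi> T' x'"
    using local_coordinates[OF N W] .
  note T' = coordsD(1)[OF co'] pT' coordsD(2)[OF co'] and xs' = coordsD(3)[OF co'] and x' = coordsD(4)[OF co']
  let ?H = "\<lambda>z. F (inv_into W \<psi> (fst z), inv_into U \<phi> (snd z))"
  have ro: "relopen (model N) (\<psi> ` W)" "relopen (model M) (\<phi> ` U)"
    using chart(2)[OF N W(1)] chart(2)[OF M U(1)] by auto
  note roP = relopen_Times[OF ro]
  have H: "smooth_on (model N \<times> model M) (\<psi> ` W \<times> \<phi> ` U) ?H"
    by (rule smooth_on_prod_chart[OF M N F U(1) W(1)])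
  have z0: "(\<psi> q, \<phi> p) \<in> \<psi> ` W \<times> \<phi> ` U" using U W by auto
  have bV: "(0, b) \<in> model N \<times> model M" if "b \<in> onb (model M)" for b
    using that onb(1)[OF manifold_model[OF M]] subspace_0[OF manifold_model[OF N]] by auto
  have cV: "(c, 0) \<in> model N \<times> model M" if "c \<in> onb (model N)" for c
    using that onb(1)[OF manifold_model[OF N]] subspace_0[OF manifold_model[OF M]] by auto
  have vF: "v (\<lambda>m. F (n, m)) = (\<Sum>b\<in>onb (model M). v (x b) * dir_deriv ?H (\<psi> n, \<phi> p) (0, b))" if "n \<in> W" for n
  proof -
    have "dir_deriv ((\<lambda>m. F (n, m)) \<circ> inv_into U \<phi>) (\<phi> p) b = dir_deriv ?H (\<psi> n, \<phi> p) (0, b)" for b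
      using dir_deriv_slice(1)[of ?H "\<psi> n" "\<phi> p" b] chart_inv[OF N W(1) that] by (simp add: o_def)
    then show ?thesis using x[OF T(2) v smooth_fun_slice(1)[OF M N F]] by simp
  qed
  have uF: "u (\<lambda>n. F (n, m)) = (\<Sum>c\<in>onb (model N). u (x' c) * dir_deriv ?H (\<psi> q, \<phi> m) (c, 0))" if "m \<in> U" for m
  proof -
    have "dir_deriv ((\<lambda>n. F (n, m)) \<circ> inv_into W \<psi>) (\<psi> q) c = dir_deriv ?H (\<psi> q, \<phi> m) (c, 0)" for c
      using dir_deriv_slice(2)[of ?H "\<phi> m" "\<psi> q" c] chart_inv[OF M U(1) that] by (simp add: o_def)
    then show ?thesis using x'[OF T'(2) u smooth_fun_slice(2)[OF M N F]] by simp
  qed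
  have F': "(\<lambda>z. F (snd z, fst z)) \<in> smooth_fun (prod_mfd M N)"
    by (rule smooth_fun_compose[OF smooth_manifold_prod[OF M N] smooth_manifold_prod[OF N M] _ F])
       (intro smooth_map_Pair smooth_map_fst smooth_manifold_prod M N)
  have sv: "(\<lambda>n. v (\<lambda>m. F (n, m))) \<in> smooth_fun N" by (rule smooth_fun_tangent_param[OF M N F v])
  have su: "(\<lambda>m. u (\<lambda>n. F (n, m))) \<in> smooth_fun M" using smooth_fun_tangent_param[OF N M F' u] by simp
  have dH: "smooth_on (model N \<times> model M) (\<psi> ` W \<times> \<phi> ` U) (\<lambda>z. dir_deriv ?H z w)" if "w \<in> model N \<times> model M" for w
    by (rule smooth_on_dir_deriv[OF roP H that])
  have "u (\<lambda>n. v (\<lambda>m. F (n, m))) = (\<Sum>c\<in>onb (model N). u (x' c) * (\<Sum>b\<in>onb (model M).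
      v (x b) * dir_deriv (\<lambda>z. dir_deriv ?H z (0, b)) (\<psi> q, \<phi> p) (c, 0)))"
  proof (subst x'[OF T'(2) u sv], rule sum.cong[OF refl], rule arg_cong[where f = "(*) _"])
    fix c assume c: "c \<in> onb (model N)"
    have "dir_deriv ((\<lambda>n. v (\<lambda>m. F (n, m))) \<circ> inv_into W \<psi>) (\<psi> q) c =
        dir_deriv (\<lambda>y. (\<lambda>z. \<Sum>b\<in>onb (model M). v (x b) * dir_deriv ?H z (0, b)) (y, \<phi> p)) (\<psi> q) c"
      by (rule dir_deriv_cong[OF ro(1)])
         (use W c onb(1)[OF manifold_model[OF N]] vF chart_inv[OF N W(1)] in auto)
    also have "\<dots> = dir_deriv (\<lambda>z. \<Sum>b\<in>onb (model M). v (x b) * dir_deriv ?H z (0, b)) (\<psi> q, \<phi> p) (c, 0)"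
      by (rule dir_deriv_slice(2))
    also have "\<dots> = (\<Sum>b\<in>onb (model M). v (x b) * dir_deriv (\<lambda>z. dir_deriv ?H z (0, b)) (\<psi> q, \<phi> p) (c, 0))"
      by (subst dir_deriv_sum[OF roP z0 cV[OF c]])
         (auto intro!: smooth_on_mult smooth_on_const dH bV sum.cong
           simp: dir_deriv_mult[OF roP z0 cV[OF c] smooth_on_const dH[OF bV]] dir_deriv_const)
    finally show "dir_deriv ((\<lambda>n. v (\<lambda>m. F (n, m))) \<circ> inv_into W \<psi>) (\<psi> q) c =
      (\<Sum>b\<in>onb (model M). v (x b) * dir_deriv (\<lambda>z. dir_deriv ?H z (0, b)) (\<psi> q, \<phi> p) (c, 0))" .
  qed
  also have "\<dots> = (\<Sum>b\<in>onb (model M). v (x b) * (\<Sum>c\<in>onb (model N).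
      u (x' c) * dir_deriv (\<lambda>z. dir_deriv ?H z (c, 0)) (\<psi> q, \<phi> p) (0, b)))"
    unfolding sum_distrib_left
    by (subst sum.swap)
       (auto intro!: sum.cong simp: dir_deriv_commute[OF roP z0 bV cV H] mult.left_commute)
  also have "\<dots> = v (\<lambda>m. u (\<lambda>n. F (n, m)))"
  proof (subst x[OF T(2) v su], rule sum.cong[OF refl], rule arg_cong[where f = "(*) _"])
    fix b assume b: "b \<in> onb (model M)"
    have "dir_deriv ((\<lambda>m. u (\<lambda>n. F (n, m))) \<circ> inv_into U \<phi>) (\<phi> p) b =
        dir_deriv (\<lambda>y. (\<lambda>z. \<Sum>c\<in>onb (model N). u (x' c) * dir_deriv ?H z (c, 0)) (\<psi> q, y)) (\<phi> p) b"
      by (rule dir_deriv_cong[OF ro(2)])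
         (use U b onb(1)[OF manifold_model[OF M]] uF chart_inv[OF M U(1)] in auto)
    also have "\<dots> = dir_deriv (\<lambda>z. \<Sum>c\<in>onb (model N). u (x' c) * dir_deriv ?H z (c, 0)) (\<psi> q, \<phi> p) (0, b)"
      by (rule dir_deriv_slice(1))
    also have "\<dots> = (\<Sum>c\<in>onb (model N). u (x' c) * dir_deriv (\<lambda>z. dir_deriv ?H z (c, 0)) (\<psi> q, \<phi> p) (0, b))"
      by (subst dir_deriv_sum[OF roP z0 bV[OF b]])
         (auto intro!: smooth_on_mult smooth_on_const dH cV sum.cong
           simp: dir_deriv_mult[OF roP z0 bV[OF b] smooth_on_const dH[OF cV]] dir_deriv_const)
    finally show "(\<Sum>c\<in>onb (model N). u (x' c) * dir_deriv (\<lambda>z. dir_deriv ?H z (c, 0)) (\<psi> q, \<phi> p) (0, b)) =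
      dir_deriv ((\<lambda>m. u (\<lambda>n. F (n, m))) \<circ> inv_into U \<phi>) (\<phi> p) b" by simp
  qed
  finally show ?thesis .
qed

text \<open>Linearity of the total derivative of \<open>F\<close> at the diagonal point: its value
  on \<open>(b, b)\<close> is the sum of those on \<open>(b, 0)\<close> and \<open>(0, b)\<close>.
  All later product rules on the group are instances of this.\<close>

lemma tangent_diagonal:
  fixes M :: "('m::{t2_space,second_countable_topology}, 'e::euclidean_space) mfd"
  assumes M: "smooth_manifold M" and F: "F \<in> smooth_fun (prod_mfd M M)" and v: "v \<in> tangent M p"
  shows "v (\<lambda>y. F (y, y)) = v (\<lambda>y. F (y, p)) + v (\<lambda>y. F (p, y))"
proof -
  obtain U \<phi> where U: "(U, \<phi>) \<in> atlas M" "p \<in> U" using chart_cover[OF M] .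
  obtain T x where pT: "p \<in> T" and co: "coords M U \<phi> T x"
    using local_coordinates[OF M U] .
  note T = coordsD(1)[OF co] pT coordsD(2)[OF co] and xs = coordsD(3)[OF co] and x = coordsD(4)[OF co]
  have V: "subspace (model M)" by (rule manifold_model[OF M])
  let ?H = "\<lambda>z. F (inv_into U \<phi> (fst z), inv_into U \<phi> (snd z))"
  note ro = chart(2)[OF M U(1)]
  note roP = relopen_Times[OF ro ro]
  have H: "smooth_on (model M \<times> model M) (\<phi> ` U \<times> \<phi> ` U) ?H"
    by (rule smooth_on_prod_chart[OF M M F U(1) U(1)])
  have z0: "(\<phi> p, \<phi> p) \<in> \<phi> ` U \<times> \<phi> ` U" using U by auto
  define D where "D w = (\<Sum>b\<in>onb (model M \<times> model M). (w \<bullet> b) *\<^sub>R dir_deriv ?H (\<phi> p, \<phi> p) b)" for w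
  have D: "(?H has_derivative D) (at (\<phi> p, \<phi> p) within \<phi> ` U \<times> \<phi> ` U)"
    unfolding D_def by (rule dir_deriv_linear(1)[OF roP z0 H])
  have D': "dir_deriv ?H (\<phi> p, \<phi> p) w = D w" if "w \<in> model M \<times> model M" for w
    using dir_deriv_eq[OF roP z0 that D] .
  have Dadd: "D (v + w) = D v + D w" for v w
    using has_derivative_bounded_linear[OF D] by (simp add: bounded_linear.linear linear_add)
  have key: "dir_deriv ((\<lambda>y. F (y, y)) \<circ> inv_into U \<phi>) (\<phi> p) b =
      dir_deriv ((\<lambda>y. F (y, p)) \<circ> inv_into U \<phi>) (\<phi> p) b + dir_deriv ((\<lambda>y. F (p, y)) \<circ> inv_into U \<phi>) (\<phi> p) b"
    if "b \<in> onb (model M)" for b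
  proof -
    have b: "b \<in> model M" using that onb(1)[OF V] by auto
    have d: "((\<lambda>y. (y, y)) has_derivative (\<lambda>v. (v, v))) (at (\<phi> p) within \<phi> ` U)"
      by (auto intro!: derivative_eq_intros)
    have im: "(\<lambda>y. (y, y)) ` \<phi> ` U \<subseteq> \<phi> ` U \<times> \<phi> ` U" by auto
    have "((\<lambda>y. ?H (y, y)) has_derivative (\<lambda>v. D (v, v))) (at (\<phi> p) within \<phi> ` U)"
      by (rule has_derivative_in_compose[OF d has_derivative_subset[OF D im]])
    then have "dir_deriv (\<lambda>y. ?H (y, y)) (\<phi> p) b = D (b, b)"
      by (rule dir_deriv_eq[OF ro imageI[OF U(2)] b])
    also have "\<dots> = D (b, 0) + D (0, b)" using Dadd[of "(b, 0)" "(0, b)"] by simp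
    also have "\<dots> = dir_deriv (\<lambda>y. ?H (y, \<phi> p)) (\<phi> p) b + dir_deriv (\<lambda>y. ?H (\<phi> p, y)) (\<phi> p) b"
      using D' b subspace_0[OF V] unfolding dir_deriv_slice[of ?H] by simp
    finally show ?thesis by (simp add: o_def chart_inv[OF M U])
  qed
  have d: "(\<lambda>y. F (y, y)) \<in> smooth_fun M"
    by (rule smooth_fun_compose[OF M smooth_manifold_prod[OF M M] _ F])
       (intro smooth_map_Pair smooth_map_id M)
  show ?thesis
    unfolding x[OF T(2) v d] x[OF T(2) v smooth_fun_slice(1)[OF M M F]] x[OF T(2) v smooth_fun_slice(2)[OF M M F]]
    by (simp add: key sum.distrib distrib_left)
qed

text \<open>The diagonal rule on the product manifold itself, applied to \<open>h\<close> with its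
  two components read off from two different points.\<close>

lemma tangent_prod_decomp:
  fixes M :: "('m::{t2_space,second_countable_topology}, 'e::euclidean_space) mfd"
    and N :: "('n::{t2_space,second_countable_topology}, 'f::euclidean_space) mfd"
  assumes M: "smooth_manifold M" and N: "smooth_manifold N"
    and u: "u \<in> tangent (prod_mfd M N) (p, q)" and h: "h \<in> smooth_fun (prod_mfd M N)"
  shows "u h = dmap M fst u (\<lambda>x. h (x, q)) + dmap N snd u (\<lambda>y. h (p, y))"
proof -
  note MN = smooth_manifold_prod[OF M N]
  let ?F = "\<lambda>z. h (fst (fst z), snd (snd z))"
  have "smooth_map (prod_mfd (prod_mfd M N) (prod_mfd M N)) (prod_mfd M N) (\<lambda>z. (fst (fst z), snd (snd z)))"
    by (intro smooth_map_Pair smooth_manifold_prod M N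
        smooth_map_compose[OF smooth_manifold_prod[OF MN MN] MN M smooth_map_fst(1)[OF MN MN] smooth_map_fst(1)[OF M N]]
        smooth_map_compose[OF smooth_manifold_prod[OF MN MN] MN N smooth_map_fst(2)[OF MN MN] smooth_map_fst(2)[OF M N]])
  then have "?F \<in> smooth_fun (prod_mfd (prod_mfd M N) (prod_mfd M N))"
    by (rule smooth_fun_compose[OF smooth_manifold_prod[OF MN MN] MN _ h])
  from tangent_diagonal[OF MN this u] show ?thesis
    by (simp add: dmap_apply smooth_fun_slice[OF N M h])
qed

text \<open>Curried variants of the preceding facts, so that \<open>F\<close> can be supplied as a
  function of two separate arguments.\<close>

lemma tangent_param_curried:
  fixes M :: "('m::{t2_space,second_countable_topology}, 'e::euclidean_space) mfd"
    and N :: "('n::{t2_space,second_countable_topology}, 'f::euclidean_space) mfd"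
  assumes "smooth_manifold M" "smooth_manifold N" "(\<lambda>z. F (fst z) (snd z)) \<in> smooth_fun (prod_mfd N M)"
    and "v \<in> tangent M p"
  shows "(\<lambda>n. v (\<lambda>m. F n m)) \<in> smooth_fun N"
  using smooth_fun_tangent_param[OF assms] by simp

lemma vf_param_curried:
  fixes M :: "('m::{t2_space,second_countable_topology}, 'e::euclidean_space) mfd"
    and N :: "('n::{t2_space,second_countable_topology}, 'f::euclidean_space) mfd"
  assumes "smooth_manifold M" "smooth_manifold N" "(\<lambda>z. F (fst z) (snd z)) \<in> smooth_fun (prod_mfd N M)"
    and "X \<in> vector_fields M"
  shows "(\<lambda>z. X (snd z) (\<lambda>m. F (fst z) m)) \<in> smooth_fun (prod_mfd N M)"
  using smooth_fun_vf_param[OF assms] by (simp add: case_prod_beta')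

lemma tangent_commute_curried:
  fixes M :: "('m::{t2_space,second_countable_topology}, 'e::euclidean_space) mfd"
    and N :: "('n::{t2_space,second_countable_topology}, 'f::euclidean_space) mfd"
  assumes "smooth_manifold M" "smooth_manifold N" "(\<lambda>z. F (fst z) (snd z)) \<in> smooth_fun (prod_mfd N M)"
    and "v \<in> tangent M p" "u \<in> tangent N q"
  shows "u (\<lambda>n. v (\<lambda>m. F n m)) = v (\<lambda>m. u (\<lambda>n. F n m))"
  using tangent_commute[OF assms] by simp

lemma tangent_diagonal_curried:
  fixes M :: "('m::{t2_space,second_countable_topology}, 'e::euclidean_space) mfd"
  assumes "smooth_manifold M" "(\<lambda>z. F (fst z) (snd z)) \<in> smooth_fun (prod_mfd M M)" "v \<in> tangent M p"
  shows "v (\<lambda>y. F y y) = v (\<lambda>y. F y p) + v (\<lambda>y. F p y)"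
  using tangent_diagonal[OF assms] by simp

lemma vector_fieldsD:
  assumes "X \<in> vector_fields M"
  shows "X p \<in> tangent M p" "f \<in> smooth_fun M \<Longrightarrow> (\<lambda>p. X p f) \<in> smooth_fun M"
  using assms by (auto simp: vector_fields_def)

lemma smooth_fun_vf_diagonal:
  fixes M :: "('m::{t2_space,second_countable_topology}, 'e::euclidean_space) mfd"
  assumes M: "smooth_manifold M" and F: "(\<lambda>z. F (fst z) (snd z)) \<in> smooth_fun (prod_mfd M M)"
    and X: "X \<in> vector_fields M"
  shows "(\<lambda>m. X m (\<lambda>y. F m y)) \<in> smooth_fun M"
proof -
  have d: "smooth_map M (prod_mfd M M) (\<lambda>x. (x, x))" by (intro smooth_map_Pair smooth_map_id M)
  show ?thesis
    using smooth_fun_compose[OF M smooth_manifold_prod[OF M M] d vf_param_curried[OF M M F X]] by simp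
qed

text \<open>The point \<open>n\<close> occurs twice, as base point of \<open>X\<close> and as
  parameter of \<open>F\<close>; the product rule differentiates the two occurrences
  separately.\<close>

lemma vf_diagonal:
  fixes M :: "('m::{t2_space,second_countable_topology}, 'e::euclidean_space) mfd"
  assumes M: "smooth_manifold M" and F: "(\<lambda>z. F (fst z) (snd z)) \<in> smooth_fun (prod_mfd M M)"
    and X: "X \<in> vector_fields M" and v: "v \<in> tangent M m"
  shows "v (\<lambda>n. X n (\<lambda>y. F n y)) = v (\<lambda>n. X m (\<lambda>y. F n y)) + v (\<lambda>n. X n (\<lambda>y. F m y))"
  using tangent_diagonal_curried[OF M vf_param_curried[OF M M F X] v] by simp

lemma vf_bracket_tangent:
  assumes M: "smooth_manifold M" and X: "X \<in> vector_fields M" and Y: "Y \<in> vector_fields M"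
  shows "vf_bracket X Y p \<in> tangent M p"
proof (rule tangentI)
  note XT = vector_fieldsD[OF X] and YT = vector_fieldsD[OF Y]
  fix f g a b assume f: "f \<in> smooth_fun M" and g: "g \<in> smooth_fun M"
  show "vf_bracket X Y p (\<lambda>x. a * f x + b * g x) = a * vf_bracket X Y p f + b * vf_bracket X Y p g"
    using f g by (simp add: vf_bracket_def tangent_lin[OF XT(1)] tangent_lin[OF YT(1)] XT(2) YT(2) algebra_simps)
  show "vf_bracket X Y p (\<lambda>x. f x * g x) = f p * vf_bracket X Y p g + g p * vf_bracket X Y p f"
    using f g
    by (simp add: vf_bracket_def tangent_mult[OF XT(1)] tangent_mult[OF YT(1)]
        tangent_add[OF XT(1)] tangent_add[OF YT(1)] smooth_fun_mult M XT(2) YT(2) algebra_simps)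
next
  fix f assume "f \<notin> smooth_fun M"
  then show "vf_bracket X Y p f = 0"
    using tangent_not_smooth[OF vector_fieldsD(1)[OF X]] tangent_not_smooth[OF vector_fieldsD(1)[OF Y]]
      tangent_const[OF M vector_fieldsD(1)[OF X]] tangent_const[OF M vector_fieldsD(1)[OF Y]]
    by (simp add: vf_bracket_def)
qed

lemma smooth_fun_pair_compose:
  assumes M: "smooth_manifold M" and N: "smooth_manifold N" and P: "smooth_manifold P" and f: "smooth_map M P f"
  shows "smooth_map (prod_mfd M N) P (\<lambda>z. f (fst z))" and "smooth_map (prod_mfd N M) P (\<lambda>z. f (snd z))"
  by (rule smooth_map_compose[OF smooth_manifold_prod[OF M N] M P smooth_map_fst(1)[OF M N] f],
      rule smooth_map_compose[OF smooth_manifold_prod[OF N M] M P smooth_map_fst(2)[OF N M] f])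

text \<open>The two conclusions are proved together because \<open>lin\<close> can be applied to a
  partial sum only if that sum is known to be tangent.\<close>

lemma linear_on_tangent_sum:
  assumes lin: "\<And>a u b v. u \<in> tangent M p \<Longrightarrow> v \<in> tangent M p \<Longrightarrow> L (lincomb a u b v) = a * L u + b * L v"
    and "finite J" "\<And>b. b \<in> J \<Longrightarrow> e b \<in> tangent M p"
  shows "(\<lambda>f. \<Sum>b\<in>J. c b * e b f) \<in> tangent M p \<and> L (\<lambda>f. \<Sum>b\<in>J. c b * e b f) = (\<Sum>b\<in>J. c b * L (e b))"
  using assms(2,3)
proof (induction J rule: finite_induct)
  case empty
  have "L (lincomb 0 (\<lambda>f. 0) 0 (\<lambda>f. 0)) = 0" by (subst lin) (auto intro: tangent_zero)
  then show ?case by (simp add: lincomb_def tangent_zero)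
next
  case (insert j J)
  let ?s = "\<lambda>f. \<Sum>b\<in>J. c b * e b f"
  have s: "?s \<in> tangent M p" "L ?s = (\<Sum>b\<in>J. c b * L (e b))" and j: "e j \<in> tangent M p"
    using insert by auto
  have "(\<lambda>f. \<Sum>b\<in>insert j J. c b * e b f) = lincomb (c j) (e j) 1 ?s"
    using insert by (simp add: lincomb_def)
  then show ?case using lin[OF j s(1)] tangent_lincomb[OF j s(1)] s(2) insert by simp
qed

section \<open>Lie groups\<close>

locale lie_grp =
  fixes G :: "'g::{t2_space,second_countable_topology} monoid" and GM :: "('g, 'e::euclidean_space) mfd"
  assumes lie: "lie_group G GM"
begin

abbreviation mul (infixl "\<cdot>" 70) where "a \<cdot> b \<equiv> a \<otimes>\<^bsub>G\<^esub> b"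
abbreviation iv where "iv a \<equiv> inv\<^bsub>G\<^esub> a"
abbreviation unit where "unit \<equiv> \<one>\<^bsub>G\<^esub>"
abbreviation alg where "alg \<equiv> tangent GM unit"
abbreviation br where "br \<equiv> lie_br G GM"

lemma gm: "smooth_manifold GM"
  using lie by (simp add: lie_group_def)

lemma grp: "group G" "carrier G = UNIV"
  using lie by (auto simp: lie_group_def)

lemma g_simps [simp]:
  "a \<cdot> b \<cdot> c = a \<cdot> (b \<cdot> c)" "unit \<cdot> a = a" "a \<cdot> unit = a" "iv a \<cdot> a = unit" "a \<cdot> iv a = unit"
  "iv a \<cdot> (a \<cdot> b) = b" "a \<cdot> (iv a \<cdot> b) = b" "iv (a \<cdot> b) = iv b \<cdot> iv a" "iv (iv a) = a" "iv unit = unit"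
proof -
  interpret group G by (rule grp)
  note c = grp(2)
  show assoc: "a \<cdot> b \<cdot> c = a \<cdot> (b \<cdot> c)" for a b c using m_assoc c by simp
  show one: "unit \<cdot> a = a" "a \<cdot> unit = a" for a using c by simp_all
  show i: "iv a \<cdot> a = unit" "a \<cdot> iv a = unit" for a using c by simp_all
  show "iv a \<cdot> (a \<cdot> b) = b" "a \<cdot> (iv a \<cdot> b) = b" using assoc[symmetric] one i by simp_all
  show "iv (a \<cdot> b) = iv b \<cdot> iv a" "iv (iv a) = a" "iv unit = unit" using inv_mult_group c by simp_all
qed

lemma smooth_mult:
  assumes "smooth_manifold M" "smooth_map M GM f" "smooth_map M GM g"
  shows "smooth_map M GM (\<lambda>x. f x \<cdot> g x)"
proof -
  have "smooth_map (prod_mfd GM GM) GM (\<lambda>(a, b). a \<cdot> b)" using lie by (simp add: lie_group_def)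
  from smooth_map_compose[OF assms(1) smooth_manifold_prod[OF gm gm] gm smooth_map_Pair[OF assms(1) gm gm assms(2,3)] this]
  show ?thesis by simp
qed

lemma smooth_inv:
  assumes "smooth_manifold M" "smooth_map M GM f"
  shows "smooth_map M GM (\<lambda>x. iv (f x))"
proof -
  have "smooth_map GM GM (\<lambda>a. iv a)" using lie by (simp add: lie_group_def)
  from smooth_map_compose[OF assms(1) gm gm assms(2) this] show ?thesis .
qed

lemma smooth_fst: "smooth_map (prod_mfd GM GM) GM (\<lambda>z. fst z)"
  and smooth_snd: "smooth_map (prod_mfd GM GM) GM (\<lambda>z. snd z)"
  using smooth_map_fst[OF gm gm] by simp_all

lemmas gg = smooth_manifold_prod[OF gm gm]

lemmas smooth_g = smooth_mult smooth_inv smooth_map_const[OF _ gm] smooth_map_id gm gg smooth_fst smooth_snd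

lemma smooth_fun_map: "h \<in> smooth_fun GM \<Longrightarrow> smooth_manifold M \<Longrightarrow> smooth_map M GM f \<Longrightarrow> (\<lambda>x. h (f x)) \<in> smooth_fun M"
  using smooth_fun_compose[OF _ gm] by blast

lemma MC_L_apply: "h \<in> smooth_fun GM \<Longrightarrow> MC_L G GM g v h = v (\<lambda>x. h (iv g \<cdot> x))"
  and MC_R_apply: "h \<in> smooth_fun GM \<Longrightarrow> MC_R G GM g v h = v (\<lambda>x. h (x \<cdot> iv g))"
  and Ad_apply: "h \<in> smooth_fun GM \<Longrightarrow> Ad G GM g v h = v (\<lambda>x. h (g \<cdot> (x \<cdot> iv g)))"
  and left_apply: "h \<in> smooth_fun GM \<Longrightarrow> left_inv_field G GM v g h = v (\<lambda>x. h (g \<cdot> x))"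
  and right_apply: "h \<in> smooth_fun GM \<Longrightarrow> right_inv_field G GM v g h = v (\<lambda>x. h (x \<cdot> g))"
  by (simp_all add: MC_L_def MC_R_def Ad_def left_inv_field_def right_inv_field_def dmap_apply)

lemma MC_L_tangent: "v \<in> tangent GM g \<Longrightarrow> MC_L G GM g v \<in> alg"
  using dmap_tangent[OF gm gm, of "\<lambda>x. iv g \<cdot> x" v g] by (simp add: MC_L_def smooth_g)

lemma MC_R_tangent: "v \<in> tangent GM g \<Longrightarrow> MC_R G GM g v \<in> alg"
  using dmap_tangent[OF gm gm, of "\<lambda>x. x \<cdot> iv g" v g] by (simp add: MC_R_def smooth_g)

lemma Ad_tangent: "v \<in> alg \<Longrightarrow> Ad G GM g v \<in> alg"
  using dmap_tangent[OF gm gm, of "\<lambda>x. g \<cdot> x \<cdot> iv g" v unit] by (simp add: Ad_def smooth_g)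

lemma left_tangent: "v \<in> alg \<Longrightarrow> left_inv_field G GM v g \<in> tangent GM g"
  using dmap_tangent[OF gm gm, of "\<lambda>x. g \<cdot> x" v unit] by (simp add: left_inv_field_def smooth_g)

lemma right_tangent: "v \<in> alg \<Longrightarrow> right_inv_field G GM v g \<in> tangent GM g"
  using dmap_tangent[OF gm gm, of "\<lambda>x. x \<cdot> g" v unit] by (simp add: right_inv_field_def smooth_g)

lemma dmap_dmap: "smooth_map GM GM k \<Longrightarrow> dmap GM k (dmap GM f v) = dmap GM (\<lambda>x. k (f x)) v"
  by (rule dmap_compose[OF gm gm])

lemma Ad_Ad: "Ad G GM a (Ad G GM b v) = Ad G GM (a \<cdot> b) v"
  by (simp add: Ad_def dmap_dmap smooth_g)

lemma Ad_one: "v \<in> alg \<Longrightarrow> Ad G GM unit v = v"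
  by (simp add: Ad_def dmap_id)

lemma Ad_inv: "v \<in> alg \<Longrightarrow> Ad G GM (iv a) (Ad G GM a v) = v" "v \<in> alg \<Longrightarrow> Ad G GM a (Ad G GM (iv a) v) = v"
  by (simp_all add: Ad_Ad Ad_one)

lemma Ad_lincomb: "Ad G GM g (lincomb a u b v) = lincomb a (Ad G GM g u) b (Ad G GM g v)"
  by (simp add: Ad_def dmap_lincomb)

lemma MC_R_eq_Ad: "MC_R G GM g v = Ad G GM g (MC_L G GM g v)"
  and MC_L_eq_Ad: "MC_L G GM g v = Ad G GM (iv g) (MC_R G GM g v)"
  by (simp_all add: MC_R_def MC_L_def Ad_def dmap_dmap smooth_g)

lemma MC_left_right:
  assumes "v \<in> alg"
  shows "MC_L G GM g (left_inv_field G GM v g) = v" "MC_R G GM g (right_inv_field G GM v g) = v"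
    "MC_R G GM g (left_inv_field G GM v g) = Ad G GM g v"
    "MC_L G GM g (right_inv_field G GM v g) = Ad G GM (iv g) v"
  by (simp_all add: MC_R_def MC_L_def Ad_def left_inv_field_def right_inv_field_def dmap_dmap smooth_g dmap_id[OF assms])

lemma MC_L_tdiff: "MC_L G GM g (tdiff u v) = tdiff (MC_L G GM g u) (MC_L G GM g v)"
  and MC_R_tdiff: "MC_R G GM g (tdiff u v) = tdiff (MC_R G GM g u) (MC_R G GM g v)"
  by (simp_all add: MC_L_def MC_R_def dmap_tdiff)

lemma mult_param:
  assumes h: "h \<in> smooth_fun GM" and v: "v \<in> alg"
  shows "(\<lambda>x. v (\<lambda>y. h (x \<cdot> y))) \<in> smooth_fun GM" and "(\<lambda>x. v (\<lambda>y. h (y \<cdot> x))) \<in> smooth_fun GM"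
proof -
  have "(\<lambda>z. h (fst z \<cdot> snd z)) \<in> smooth_fun (prod_mfd GM GM)" "(\<lambda>z. h (snd z \<cdot> fst z)) \<in> smooth_fun (prod_mfd GM GM)"
    by (intro smooth_fun_map[OF h] smooth_g)+
  then show "(\<lambda>x. v (\<lambda>y. h (x \<cdot> y))) \<in> smooth_fun GM" "(\<lambda>x. v (\<lambda>y. h (y \<cdot> x))) \<in> smooth_fun GM"
    using tangent_param_curried[where F = "\<lambda>x y. h (x \<cdot> y)", OF gm gm _ v]
      tangent_param_curried[where F = "\<lambda>x y. h (y \<cdot> x)", OF gm gm _ v] by blast+
qed

lemma left_vf: "v \<in> alg \<Longrightarrow> left_inv_field G GM v \<in> vector_fields GM"
  unfolding vector_fields_def by (simp add: left_tangent left_apply mult_param(1))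

lemma br_apply:
  assumes "h \<in> smooth_fun GM" "u \<in> alg" "v \<in> alg"
  shows "br u v h = u (\<lambda>x. v (\<lambda>y. h (x \<cdot> y))) - v (\<lambda>x. u (\<lambda>y. h (x \<cdot> y)))"
  using assms by (simp add: lie_br_def vf_bracket_def left_apply mult_param(1))

lemma br_tangent: "u \<in> alg \<Longrightarrow> v \<in> alg \<Longrightarrow> br u v \<in> alg"
  unfolding lie_br_def by (intro vf_bracket_tangent gm left_vf)

lemma br_lincomb_left:
  assumes "u \<in> alg" "v \<in> alg" "w \<in> alg"
  shows "br (lincomb a u b v) w = lincomb a (br u w) b (br v w)"
proof (rule tangent_eqI[where p = unit and q = unit])
  fix h assume h: "h \<in> smooth_fun GM"
  show "br (lincomb a u b v) w h = lincomb a (br u w) b (br v w) h"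
    using tangent_lin[OF assms(3) mult_param(1)[OF h assms(1)] mult_param(1)[OF h assms(2)]]
    by (simp add: br_apply[OF h] assms tangent_lincomb) (simp add: lincomb_def br_apply[OF h] assms algebra_simps)
qed (intro br_tangent tangent_lincomb assms)+

lemma br_anti:
  assumes "u \<in> alg" "v \<in> alg"
  shows "br v u = tscale (-1) (br u v)"
  by (rule tangent_eqI[OF br_tangent tangent_tscale[OF br_tangent]])
     (use assms in \<open>simp_all add: br_apply tscale_def\<close>)

lemma Ad_br:
  assumes u: "u \<in> alg" and v: "v \<in> alg"
  shows "Ad G GM g (br u v) = br (Ad G GM g u) (Ad G GM g v)"
proof (rule tangent_eqI[where p = unit and q = unit])
  fix h assume h: "h \<in> smooth_fun GM"
  have 1: "(\<lambda>x. h (g \<cdot> (x \<cdot> iv g))) \<in> smooth_fun GM" by (intro smooth_fun_map[OF h] smooth_g)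
  have 2: "(\<lambda>x. h (k \<cdot> x)) \<in> smooth_fun GM" for k by (intro smooth_fun_map[OF h] smooth_g)
  have key: "Ad G GM g u (\<lambda>x. Ad G GM g v (\<lambda>y. h (x \<cdot> y))) = u (\<lambda>x. v (\<lambda>y. h (g \<cdot> (x \<cdot> y \<cdot> iv g))))"
    if "u \<in> alg" "v \<in> alg" for u v
  proof -
    have "Ad G GM g u (\<lambda>x. Ad G GM g v (\<lambda>y. h (x \<cdot> y))) = u (\<lambda>x. Ad G GM g v (\<lambda>y. h (g \<cdot> (x \<cdot> iv g) \<cdot> y)))"
      by (rule Ad_apply[OF mult_param(1)[OF h Ad_tangent[OF that(2)]]])
    also have "\<dots> = u (\<lambda>x. v (\<lambda>y. h (g \<cdot> (x \<cdot> iv g) \<cdot> (g \<cdot> (y \<cdot> iv g)))))"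
      by (simp only: Ad_apply[OF 2])
    finally show ?thesis by simp
  qed
  show "Ad G GM g (br u v) h = br (Ad G GM g u) (Ad G GM g v) h"
    using u v by (simp add: Ad_apply[OF h] br_apply[OF 1] br_apply[OF h] Ad_tangent key)
qed (intro Ad_tangent br_tangent u v)+

text \<open>The diagonal rule applied to the constant function
  \<open>k (x \<cdot> iv x)\<close>.\<close>

lemma inv_deriv:
  assumes "v \<in> alg" "k \<in> smooth_fun GM"
  shows "v (\<lambda>x. k (iv x)) = - v k"
proof -
  have "(\<lambda>z. k (fst z \<cdot> iv (snd z))) \<in> smooth_fun (prod_mfd GM GM)"
    by (intro smooth_fun_map[OF assms(2)] smooth_g)
  from tangent_diagonal_curried[where F = "\<lambda>x y. k (x \<cdot> iv y)", OF gm this assms(1)]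
  show ?thesis using tangent_const[OF gm assms(1)] by simp
qed

text \<open>The point \<open>x\<close> occurs twice in the conjugation. Differentiating the left
  occurrence gives one half of the bracket; the inverse on the right contributes a sign by
  \<open>inv_deriv\<close>, and exchanging the derivations turns that term into the other
  half.\<close>

lemma Ad_deriv:
  assumes t: "t \<in> alg" and v: "v \<in> alg" and h: "h \<in> smooth_fun GM"
  shows "t (\<lambda>x. Ad G GM x v h) = br t v h" and "(\<lambda>x. Ad G GM x v h) \<in> smooth_fun GM"
proof -
  have F3: "(\<lambda>z. h (fst (fst z) \<cdot> (snd z \<cdot> iv (snd (fst z))))) \<in> smooth_fun (prod_mfd (prod_mfd GM GM) GM)"
    by (intro smooth_fun_map[OF h] smooth_mult smooth_inv smooth_fun_pair_compose smooth_manifold_prod gm smooth_g)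
  from tangent_param_curried[where F = "\<lambda>z y. h (fst z \<cdot> (y \<cdot> iv (snd z)))", OF gm gg F3 v]
  have F2: "(\<lambda>z. v (\<lambda>y. h (fst z \<cdot> (y \<cdot> iv (snd z))))) \<in> smooth_fun (prod_mfd GM GM)" .
  have dg: "smooth_map GM (prod_mfd GM GM) (\<lambda>x. (x, x))" by (intro smooth_map_Pair smooth_g)
  from smooth_fun_compose[OF gm gg dg F2]
  show "(\<lambda>x. Ad G GM x v h) \<in> smooth_fun GM" by (simp add: Ad_apply[OF h])
  have "t (\<lambda>x. Ad G GM x v h) = t (\<lambda>x. v (\<lambda>y. h (x \<cdot> y))) + t (\<lambda>x. v (\<lambda>y. h (y \<cdot> iv x)))"
    using tangent_diagonal_curried[where F = "\<lambda>x x'. v (\<lambda>y. h (x \<cdot> (y \<cdot> iv x')))", OF gm F2 t]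
    by (simp add: Ad_apply[OF h])
  also have "t (\<lambda>x. v (\<lambda>y. h (y \<cdot> iv x))) = - t (\<lambda>x. v (\<lambda>y. h (y \<cdot> x)))"
    by (rule inv_deriv[OF t mult_param(2)[OF h v]])
  also have "t (\<lambda>x. v (\<lambda>y. h (y \<cdot> x))) = v (\<lambda>y. t (\<lambda>x. h (y \<cdot> x)))"
    by (rule tangent_commute_curried[where F = "\<lambda>x y. h (y \<cdot> x)", OF gm gm _ v t]) (intro smooth_fun_map[OF h] smooth_g)
  finally show "t (\<lambda>x. Ad G GM x v h) = br t v h" by (simp add: br_apply[OF h t v])
qed

text \<open>Tested on \<open>h\<close>, a pulled-back Maurer--Cartan form is a derivative in
  \<open>y\<close> of a real function of two points, the base point \<open>m\<close> being held
  fixed. The structure equations are derived from this form.\<close>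

lemma pull_MC_apply:
  assumes "h \<in> smooth_fun GM"
  shows "MC_L G GM (f m) (dmap GM f v) h = v (\<lambda>y. h (iv (f m) \<cdot> f y))"
    and "MC_R G GM (f m) (dmap GM f v) h = v (\<lambda>y. h (f y \<cdot> iv (f m)))"
  using assms by (simp_all add: MC_L_apply MC_R_apply dmap_apply smooth_fun_map[OF assms] smooth_g)

lemma pull_MC_smooth:
  fixes M :: "('m::{t2_space,second_countable_topology}, 'd::euclidean_space) mfd"
  assumes M: "smooth_manifold M" and f: "smooth_map M GM f" and h: "h \<in> smooth_fun GM"
  shows "(\<lambda>z. h (iv (f (fst z)) \<cdot> f (snd z))) \<in> smooth_fun (prod_mfd M M)"
    and "(\<lambda>z. h (f (snd z) \<cdot> iv (f (fst z)))) \<in> smooth_fun (prod_mfd M M)"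
  by (intro smooth_fun_map[OF h] smooth_mult smooth_inv smooth_fun_pair_compose smooth_manifold_prod M f gm)+

lemma pull_MC_vf_smooth:
  fixes M :: "('m::{t2_space,second_countable_topology}, 'd::euclidean_space) mfd"
  assumes M: "smooth_manifold M" and f: "smooth_map M GM f" and X: "X \<in> vector_fields M" and h: "h \<in> smooth_fun GM"
  shows "(\<lambda>m. MC_L G GM (f m) (dmap GM f (X m)) h) \<in> smooth_fun M"
    and "(\<lambda>m. MC_R G GM (f m) (dmap GM f (X m)) h) \<in> smooth_fun M"
  using smooth_fun_vf_diagonal[where F = "\<lambda>n y. h (iv (f n) \<cdot> f y)", OF M pull_MC_smooth(1)[OF M f h] X]
    smooth_fun_vf_diagonal[where F = "\<lambda>n y. h (f y \<cdot> iv (f n))", OF M pull_MC_smooth(2)[OF M f h] X]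
  by (simp_all add: pull_MC_apply[OF h])

lemma pull_MC_tangent:
  assumes M: "smooth_manifold M" and f: "smooth_map M GM f" and v: "v \<in> tangent M m"
  shows "MC_L G GM (f m) (dmap GM f v) \<in> alg" "MC_R G GM (f m) (dmap GM f v) \<in> alg"
  by (intro MC_L_tangent MC_R_tangent dmap_tangent[OF M gm f v])+

text \<open>
  In the two Maurer--Cartan equations below, \<open>vf_diagonal\<close> splits the derivative of \<open>\<theta>(Y)\<close> along \<open>X\<close>: moving the
  argument of \<open>Y\<close> gives the bracket of vector fields, moving the base point gives the Lie bracket.
\<close>

lemma MC_L_equation:
  fixes M :: "('m::{t2_space,second_countable_topology}, 'd::euclidean_space) mfd"
  assumes M: "smooth_manifold M" and f: "smooth_map M GM f" and X: "X \<in> vector_fields M" and Y: "Y \<in> vector_fields M"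
    and h: "h \<in> smooth_fun GM"
  defines "\<alpha> \<equiv> \<lambda>m v. MC_L G GM (f m) (dmap GM f v)"
  shows "X m (\<lambda>n. \<alpha> n (Y n) h) - Y m (\<lambda>n. \<alpha> n (X n) h) = \<alpha> m (vf_bracket X Y m) h - br (\<alpha> m (X m)) (\<alpha> m (Y m)) h"
proof -
  let ?F = "\<lambda>n y. h (iv (f n) \<cdot> f y)"
  have F: "(\<lambda>z. ?F (fst z) (snd z)) \<in> smooth_fun (prod_mfd M M)" by (rule pull_MC_smooth(1)[OF M f h])
  have \<alpha>: "\<alpha> m v h = v (\<lambda>y. ?F m y)" for m v by (simp add: \<alpha>_def pull_MC_apply[OF h])
  have T: "\<alpha> m (Z m) \<in> alg" if "Z \<in> vector_fields M" for Z
    unfolding \<alpha>_def by (rule pull_MC_tangent(1)[OF M f vector_fieldsD(1)[OF that]])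
  \<comment> \<open>Both points are referred to \<open>f m\<close>:
    \<open>iv (f n) \<cdot> f y\<close> is the inverse of \<open>iv (f m) \<cdot> f n\<close> times
    \<open>iv (f m) \<cdot> f y\<close>. Thus \<open>n\<close> enters through an inverse, which
    costs a sign by \<open>inv_deriv\<close>.\<close>
  have key: "X m (\<lambda>n. Y m (\<lambda>y. ?F n y)) = - \<alpha> m (X m) (\<lambda>x. \<alpha> m (Y m) (\<lambda>y. h (x \<cdot> y)))"
    if X: "X \<in> vector_fields M" and Y: "Y \<in> vector_fields M" for X Y
  proof -
    note t = T[OF X] T[OF Y]
    let ?k = "\<lambda>x. \<alpha> m (Y m) (\<lambda>y. h (x \<cdot> y))"
    have k: "?k \<in> smooth_fun GM" by (rule mult_param(1)[OF h t(2)])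
    have k': "(\<lambda>x. ?k (iv x)) \<in> smooth_fun GM" by (intro smooth_fun_map[OF k] smooth_g)
    have hx: "(\<lambda>y. h (x \<cdot> y)) \<in> smooth_fun GM" for x by (intro smooth_fun_map[OF h] smooth_g)
    have "- \<alpha> m (X m) ?k = \<alpha> m (X m) (\<lambda>x. ?k (iv x))" using inv_deriv[OF t(1) k] by simp
    also have "\<dots> = X m (\<lambda>n. ?k (iv (iv (f m) \<cdot> f n)))"
      using pull_MC_apply(1)[OF k'] unfolding \<alpha>_def .
    also have "\<dots> = X m (\<lambda>n. Y m (\<lambda>y. h (iv (iv (f m) \<cdot> f n) \<cdot> (iv (f m) \<cdot> f y))))"
      unfolding \<alpha>_def by (simp only: pull_MC_apply(1)[OF hx])
    also have "\<dots> = X m (\<lambda>n. Y m (\<lambda>y. ?F n y))" by simp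
    finally show ?thesis by simp
  qed
  note t = T[OF X] T[OF Y]
  show ?thesis
    using vf_diagonal[where F = ?F, OF M F Y vector_fieldsD(1)[OF X], of m] vf_diagonal[where F = ?F, OF M F X vector_fieldsD(1)[OF Y], of m]
      key[OF X Y] key[OF Y X] br_apply[OF h t]
    by (simp add: \<alpha>) (simp add: vf_bracket_def)
qed

lemma MC_R_equation:
  fixes M :: "('m::{t2_space,second_countable_topology}, 'd::euclidean_space) mfd"
  assumes M: "smooth_manifold M" and f: "smooth_map M GM f" and X: "X \<in> vector_fields M" and Y: "Y \<in> vector_fields M"
    and h: "h \<in> smooth_fun GM"
  defines "\<beta> \<equiv> \<lambda>m v. MC_R G GM (f m) (dmap GM f v)"
  shows "X m (\<lambda>n. \<beta> n (Y n) h) - Y m (\<lambda>n. \<beta> n (X n) h) = \<beta> m (vf_bracket X Y m) h + br (\<beta> m (X m)) (\<beta> m (Y m)) h"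
proof -
  let ?F = "\<lambda>n y. h (f y \<cdot> iv (f n))"
  have F: "(\<lambda>z. ?F (fst z) (snd z)) \<in> smooth_fun (prod_mfd M M)" by (rule pull_MC_smooth(2)[OF M f h])
  have \<beta>: "\<beta> m v h = v (\<lambda>y. ?F m y)" for m v by (simp add: \<beta>_def pull_MC_apply[OF h])
  have T: "\<beta> m (Z m) \<in> alg" if "Z \<in> vector_fields M" for Z
    unfolding \<beta>_def by (rule pull_MC_tangent(2)[OF M f vector_fieldsD(1)[OF that]])
  have key: "X m (\<lambda>n. Y m (\<lambda>y. ?F n y)) = - \<beta> m (Y m) (\<lambda>x. \<beta> m (X m) (\<lambda>y. h (x \<cdot> y)))"
    if X: "X \<in> vector_fields M" and Y: "Y \<in> vector_fields M" for X Y
  proof -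
    note t = T[OF X] T[OF Y]
    let ?k = "\<lambda>x. \<beta> m (Y m) (\<lambda>y. h (y \<cdot> x))"
    have k: "?k \<in> smooth_fun GM" by (rule mult_param(2)[OF h t(2)])
    have k': "(\<lambda>x. ?k (iv x)) \<in> smooth_fun GM" by (intro smooth_fun_map[OF k] smooth_g)
    have hx: "(\<lambda>y. h (y \<cdot> x)) \<in> smooth_fun GM" for x by (intro smooth_fun_map[OF h] smooth_g)
    \<comment> \<open>Now the factor depending on \<open>n\<close> stands on the right. Exchanging
      the two derivations restores the order of the product and swaps the roles of \<open>X\<close>
      and \<open>Y\<close>, which is why the bracket term has the opposite sign.\<close>
    have "\<beta> m (X m) ?k = \<beta> m (Y m) (\<lambda>x. \<beta> m (X m) (\<lambda>y. h (x \<cdot> y)))"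
      by (rule tangent_commute_curried[where F = "\<lambda>x y. h (y \<cdot> x)", OF gm gm _ t(2,1)]) (intro smooth_fun_map[OF h] smooth_g)
    then have "- \<beta> m (Y m) (\<lambda>x. \<beta> m (X m) (\<lambda>y. h (x \<cdot> y))) = \<beta> m (X m) (\<lambda>x. ?k (iv x))"
      using inv_deriv[OF t(1) k] by simp
    also have "\<dots> = X m (\<lambda>n. ?k (iv (f n \<cdot> iv (f m))))"
      using pull_MC_apply(2)[OF k'] unfolding \<beta>_def .
    also have "\<dots> = X m (\<lambda>n. Y m (\<lambda>y. h (f y \<cdot> iv (f m) \<cdot> iv (f n \<cdot> iv (f m)))))"
      unfolding \<beta>_def by (simp only: pull_MC_apply(2)[OF hx])
    also have "\<dots> = X m (\<lambda>n. Y m (\<lambda>y. ?F n y))" by simp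
    finally show ?thesis by simp
  qed
  note t = T[OF X] T[OF Y]
  show ?thesis
    using vf_diagonal[where F = ?F, OF M F Y vector_fieldsD(1)[OF X], of m] vf_diagonal[where F = ?F, OF M F X vector_fieldsD(1)[OF Y], of m]
      key[OF X Y] key[OF Y X] br_apply[OF h t]
    by (simp add: \<beta>) (simp add: vf_bracket_def)
qed

end

text \<open>The bracket at the unit involves only the functions \<open>h (x \<cdot> y)\<close>,
  which a homomorphism carries over. It is applied to the two projections and to the
  diagonal.\<close>

lemma dmap_hom_br:
  assumes "lie_grp G GM" "lie_grp H HM" and k: "smooth_map GM HM k"
    and hom: "\<And>x y. k (x \<otimes>\<^bsub>G\<^esub> y) = k x \<otimes>\<^bsub>H\<^esub> k y"
    and u: "u \<in> tangent GM \<one>\<^bsub>G\<^esub>" and v: "v \<in> tangent GM \<one>\<^bsub>G\<^esub>"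
  shows "dmap HM k (lie_br G GM u v) = lie_br H HM (dmap HM k u) (dmap HM k v)"
proof -
  interpret G: lie_grp G GM by fact
  interpret H: lie_grp H HM by fact
  have k1: "k \<one>\<^bsub>G\<^esub> = \<one>\<^bsub>H\<^esub>"
    using hom[of "\<one>\<^bsub>G\<^esub>" "\<one>\<^bsub>G\<^esub>"] H.g_simps(6)[of "k \<one>\<^bsub>G\<^esub>" "k \<one>\<^bsub>G\<^esub>"] by simp
  have T: "dmap HM k w \<in> tangent HM \<one>\<^bsub>H\<^esub>" if "w \<in> tangent GM \<one>\<^bsub>G\<^esub>" for w
    using dmap_tangent[OF G.gm H.gm k that] k1 by simp
  have key: "dmap HM k u (\<lambda>x. dmap HM k v (\<lambda>y. h (x \<otimes>\<^bsub>H\<^esub> y))) = u (\<lambda>x. v (\<lambda>y. h (k (x \<otimes>\<^bsub>G\<^esub> y))))"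
    if "h \<in> smooth_fun HM" "u \<in> tangent GM \<one>\<^bsub>G\<^esub>" "v \<in> tangent GM \<one>\<^bsub>G\<^esub>" for h u v
  proof -
    have "(\<lambda>y. h (x \<otimes>\<^bsub>H\<^esub> y)) \<in> smooth_fun HM" for x by (intro H.smooth_fun_map[OF that(1)] H.smooth_g)
    then show ?thesis using H.mult_param(1)[OF that(1) T[OF that(3)]] by (simp add: dmap_apply hom)
  qed
  show ?thesis
  proof (rule tangent_eqI[OF T[OF G.br_tangent[OF u v]] H.br_tangent[OF T[OF u] T[OF v]]])
    fix h assume h: "h \<in> smooth_fun HM"
    have hk: "(\<lambda>x. h (k x)) \<in> smooth_fun GM" by (rule smooth_fun_compose[OF G.gm H.gm k h])
    show "dmap HM k (lie_br G GM u v) h = lie_br H HM (dmap HM k u) (dmap HM k v) h"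
      using h u v by (simp add: dmap_apply G.br_apply[OF hk] H.br_apply T key)
  qed
qed

locale lie_grp_form = lie_grp G GM
  for G :: "'g::{t2_space,second_countable_topology} monoid" and GM :: "('g, 'e::euclidean_space) mfd" +
  fixes B :: "'g tvec \<Rightarrow> 'g tvec \<Rightarrow> real"
  assumes form: "inv_inner_product G GM B"
begin

lemma B_lincomb:
  assumes "u \<in> alg" "v \<in> alg" "w \<in> alg"
  shows "B (lincomb a u b v) w = a * B u w + b * B v w" "B w (lincomb a u b v) = a * B w u + b * B w v"
  using form assms by (auto simp: inv_inner_product_def bilinear_on_tangent_def)

lemma B_tscale:
  assumes "u \<in> alg" "w \<in> alg"
  shows "B (tscale a u) w = a * B u w" "B w (tscale a u) = a * B w u"
  using B_lincomb[OF assms(1,1,2), of a 0] by (simp_all add: tscale_lincomb)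

lemma B_tdiff:
  assumes "u \<in> alg" "v \<in> alg" "w \<in> alg"
  shows "B (tdiff u v) w = B u w - B v w" "B w (tdiff u v) = B w u - B w v"
  using B_lincomb[OF assms, of 1 "-1"] by (simp_all add: tdiff_lincomb)

lemma B_sym: "u \<in> alg \<Longrightarrow> v \<in> alg \<Longrightarrow> B u v = B v u"
  using form by (auto simp: inv_inner_product_def lie_alg_def)

lemma B_nondeg: "u \<in> alg \<Longrightarrow> (\<And>v. v \<in> alg \<Longrightarrow> B v u = 0) \<Longrightarrow> u = (\<lambda>f. 0)"
  using form B_sym by (simp add: inv_inner_product_def lie_alg_def)

lemma B_Ad: "u \<in> alg \<Longrightarrow> v \<in> alg \<Longrightarrow> B (Ad G GM g u) (Ad G GM g v) = B u v"
  using form by (auto simp: inv_inner_product_def lie_alg_def)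

lemma B_Ad_left: "u \<in> alg \<Longrightarrow> v \<in> alg \<Longrightarrow> B (Ad G GM g u) v = B u (Ad G GM (iv g) v)"
  using B_Ad[of u "Ad G GM (iv g) v" g] by (simp add: Ad_tangent Ad_inv)

text \<open>Turns \<open>B\<close> into a finite sum of products of the real numbers
  \<open>u (x b)\<close>, so that smoothness and the Leibniz rule for \<open>B\<close> of two
  varying Lie algebra elements reduce to those for real functions.\<close>

lemma B_expand:
  obtains I :: "'e set" and x :: "'e \<Rightarrow> 'g \<Rightarrow> real" and e :: "'e \<Rightarrow> 'g tvec"
    where "finite I" "\<forall>b\<in>I. x b \<in> smooth_fun GM"
      "\<forall>u\<in>alg. \<forall>w\<in>alg. B u w = (\<Sum>b\<in>I. \<Sum>c\<in>I. u (x b) * w (x c) * B (e b) (e c))"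
proof (rule tangent_basis[OF gm, of unit])
  fix I :: "'e set" and x :: "'e \<Rightarrow> 'g \<Rightarrow> real" and e :: "'e \<Rightarrow> 'g tvec"
  assume I: "finite I" and x: "\<And>b. b \<in> I \<Longrightarrow> x b \<in> smooth_fun GM" and e: "\<And>b. b \<in> I \<Longrightarrow> e b \<in> alg"
    and ex: "\<And>v. v \<in> alg \<Longrightarrow> v = (\<lambda>f. \<Sum>b\<in>I. v (x b) * e b f)"
  have 1: "B u w = (\<Sum>b\<in>I. u (x b) * B (e b) w)" if u: "u \<in> alg" and w: "w \<in> alg" for u w
  proof -
    have "B (\<lambda>f. \<Sum>b\<in>I. u (x b) * e b f) w = (\<Sum>b\<in>I. u (x b) * B (e b) w)"
      by (rule conjunct2[OF linear_on_tangent_sum[where L = "\<lambda>u. B u w" and e = e and c = "\<lambda>b. u (x b)"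
              and p = unit and M = GM, OF _ I e]]) (simp_all add: B_lincomb w)
    then show ?thesis using ex[OF u] by simp
  qed
  have 2: "B u w = (\<Sum>c\<in>I. w (x c) * B u (e c))" if "u \<in> alg" "w \<in> alg" for u w
  proof -
    have "B u w = B w u" by (rule B_sym[OF that])
    also have "\<dots> = (\<Sum>b\<in>I. w (x b) * B (e b) u)" by (rule 1[OF that(2,1)])
    also have "\<dots> = (\<Sum>c\<in>I. w (x c) * B u (e c))"
      using that(1) e by (auto intro!: sum.cong simp: B_sym)
    finally show ?thesis .
  qed
  have "B u w = (\<Sum>b\<in>I. \<Sum>c\<in>I. u (x b) * w (x c) * B (e b) (e c))" if u: "u \<in> alg" and w: "w \<in> alg" for u w
  proof -
    have "B u w = (\<Sum>b\<in>I. u (x b) * B (e b) w)" by (rule 1[OF that])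
    also have "\<dots> = (\<Sum>b\<in>I. \<Sum>c\<in>I. u (x b) * w (x c) * B (e b) (e c))"
      using 2[OF e w] by (auto intro!: sum.cong simp: sum_distrib_left mult.assoc)
    finally show ?thesis .
  qed
  then show thesis using I x by (intro that[of I x e]) auto
qed

lemma B_smooth:
  assumes M: "smooth_manifold M" and alg: "\<And>m. a m \<in> alg" "\<And>m. c m \<in> alg"
    and sm: "\<And>h. h \<in> smooth_fun GM \<Longrightarrow> (\<lambda>m. a m h) \<in> smooth_fun M" "\<And>h. h \<in> smooth_fun GM \<Longrightarrow> (\<lambda>m. c m h) \<in> smooth_fun M"
  shows "(\<lambda>m. B (a m) (c m)) \<in> smooth_fun M"
proof -
  obtain I :: "'e set" and x :: "'e \<Rightarrow> 'g \<Rightarrow> real" and e :: "'e \<Rightarrow> 'g tvec"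
    where I: "finite I" and x: "\<forall>b\<in>I. x b \<in> smooth_fun GM"
      and ex: "\<forall>u\<in>alg. \<forall>w\<in>alg. B u w = (\<Sum>b\<in>I. \<Sum>c\<in>I. u (x b) * w (x c) * B (e b) (e c))"
    by (rule B_expand)
  have "(\<lambda>m. \<Sum>b\<in>I. \<Sum>c'\<in>I. a m (x b) * c m (x c') * B (e b) (e c')) \<in> smooth_fun M"
    using x by (intro smooth_fun_sum smooth_fun_mult smooth_fun_const sm M) auto
  then show ?thesis using ex alg by simp
qed

text \<open>The value on functions that are not smooth is set to zero, as for tangent vectors.\<close>

definition vder :: "'m tvec \<Rightarrow> ('m \<Rightarrow> 'g tvec) \<Rightarrow> 'g tvec" where
  "vder v a = (\<lambda>h. if h \<in> smooth_fun GM then v (\<lambda>m. a m h) else 0)"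

text \<open>All values of \<open>a\<close> are derivations at one and the same point, the unit; the
  coefficients \<open>f unit\<close> and \<open>g unit\<close> of the Leibniz rule are therefore
  constants for \<open>v\<close>.\<close>

lemma vder_tangent:
  assumes v: "v \<in> tangent M m" and alg: "\<And>m. a m \<in> alg"
    and sm: "\<And>h. h \<in> smooth_fun GM \<Longrightarrow> (\<lambda>m. a m h) \<in> smooth_fun M"
  shows "vder v a \<in> alg"
proof (rule tangentI)
  fix f g p q assume f: "f \<in> smooth_fun GM" and g: "g \<in> smooth_fun GM"
  show "vder v a (\<lambda>x. p * f x + q * g x) = p * vder v a f + q * vder v a g"
    using f g tangent_lin[OF v sm[OF f] sm[OF g]]
    by (simp add: vder_def smooth_fun_add smooth_fun_mult smooth_fun_const gm tangent_lin[OF alg])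
  show "vder v a (\<lambda>x. f x * g x) = f unit * vder v a g + g unit * vder v a f"
    using f g tangent_lin[OF v sm[OF g] sm[OF f], of "f unit" "g unit"]
    by (simp add: vder_def smooth_fun_mult gm tangent_mult[OF alg])
qed (simp add: vder_def)

lemma B_Leibniz:
  assumes M: "smooth_manifold M" and v: "v \<in> tangent M m" and alg: "\<And>m. a m \<in> alg" "\<And>m. c m \<in> alg"
    and sm: "\<And>h. h \<in> smooth_fun GM \<Longrightarrow> (\<lambda>m. a m h) \<in> smooth_fun M" "\<And>h. h \<in> smooth_fun GM \<Longrightarrow> (\<lambda>m. c m h) \<in> smooth_fun M"
  shows "v (\<lambda>n. B (a n) (c n)) = B (vder v a) (c m) + B (a m) (vder v c)"
proof -
  obtain I :: "'e set" and x :: "'e \<Rightarrow> 'g \<Rightarrow> real" and e :: "'e \<Rightarrow> 'g tvec"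
    where I: "finite I" and x: "\<forall>b\<in>I. x b \<in> smooth_fun GM"
      and ex: "\<forall>u\<in>alg. \<forall>w\<in>alg. B u w = (\<Sum>b\<in>I. \<Sum>c\<in>I. u (x b) * w (x c) * B (e b) (e c))"
    by (rule B_expand)
  note va = vder_tangent[OF v alg(1) sm(1)] and vc = vder_tangent[OF v alg(2) sm(2)]
  have s: "(\<lambda>n. a n (x b) * c n (x d)) \<in> smooth_fun M" if "b \<in> I" "d \<in> I" for b d
    using x that by (intro smooth_fun_mult sm M) auto
  have s': "(\<lambda>n. B (e b) (e d) * (a n (x b) * c n (x d))) \<in> smooth_fun M" if "b \<in> I" "d \<in> I" for b d
    by (intro smooth_fun_mult[OF M smooth_fun_const[OF M]] s that)
  have "v (\<lambda>n. B (a n) (c n)) = v (\<lambda>n. \<Sum>b\<in>I. \<Sum>d\<in>I. B (e b) (e d) * (a n (x b) * c n (x d)))"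
    using ex alg by (simp add: mult.commute mult.left_commute)
  also have "\<dots> = (\<Sum>b\<in>I. v (\<lambda>n. \<Sum>d\<in>I. B (e b) (e d) * (a n (x b) * c n (x d))))"
    by (intro tangent_sum[OF M v] smooth_fun_sum M s')
  also have "\<dots> = (\<Sum>b\<in>I. \<Sum>d\<in>I. v (\<lambda>n. B (e b) (e d) * (a n (x b) * c n (x d))))"
    by (intro sum.cong refl tangent_sum[OF M v] s')
  also have "\<dots> = (\<Sum>b\<in>I. \<Sum>d\<in>I. vder v a (x b) * c m (x d) * B (e b) (e d) + a m (x b) * vder v c (x d) * B (e b) (e d))"
  proof (intro sum.cong refl)
    fix b d assume bd: "b \<in> I" "d \<in> I"
    have "v (\<lambda>n. B (e b) (e d) * (a n (x b) * c n (x d))) = B (e b) (e d) * v (\<lambda>n. a n (x b) * c n (x d))"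
      by (rule tangent_cmult[OF v s[OF bd]])
    also have "v (\<lambda>n. a n (x b) * c n (x d)) = a m (x b) * v (\<lambda>n. c n (x d)) + c m (x d) * v (\<lambda>n. a n (x b))"
      using x bd by (intro tangent_mult[OF v] sm) auto
    finally show "v (\<lambda>n. B (e b) (e d) * (a n (x b) * c n (x d))) =
        vder v a (x b) * c m (x d) * B (e b) (e d) + a m (x b) * vder v c (x d) * B (e b) (e d)"
      using x bd by (simp add: vder_def algebra_simps)
  qed
  also have "\<dots> = B (vder v a) (c m) + B (a m) (vder v c)"
    using ex alg va vc by (simp add: sum.distrib)
  finally show ?thesis .
qed

text \<open>The infinitesimal form of invariance: \<open>B (Ad G GM x u) (Ad G GM x w)\<close> is
  constant in \<open>x\<close>, and its derivative along \<open>t\<close> at the unit is computed by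
  \<open>B_Leibniz\<close> and \<open>Ad_deriv\<close>.\<close>

lemma B_br:
  assumes "t \<in> alg" "u \<in> alg" "w \<in> alg"
  shows "B (br u t) w = B u (br t w)"
proof -
  have v: "vder t (\<lambda>x. Ad G GM x u) = br t u" if "u \<in> alg" for u
    using that assms(1) Ad_deriv(1)[OF assms(1)]
    by (intro tangent_eqI[OF vder_tangent[OF assms(1)] br_tangent]) (simp_all add: Ad_tangent Ad_deriv(2)[OF assms(1)] vder_def)
  have "t (\<lambda>x. B (Ad G GM x u) (Ad G GM x w)) = B (br t u) w + B u (br t w)"
    using B_Leibniz[OF gm assms(1), of "\<lambda>x. Ad G GM x u" "\<lambda>x. Ad G GM x w"] assms
    by (simp add: Ad_tangent Ad_deriv(2)[OF assms(1)] v Ad_one)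
  moreover have "t (\<lambda>x. B (Ad G GM x u) (Ad G GM x w)) = 0"
    using tangent_const[OF gm assms(1)] by (simp add: B_Ad assms)
  moreover have "br t u = tscale (-1) (br u t)" by (rule br_anti[OF assms(2,1)])
  ultimately show ?thesis using B_tscale(1)[OF br_tangent[OF assms(2,1)] assms(3), of "-1"] by simp
qed

text \<open>\<open>MC_LL\<close> is twice the bracket, and the three cyclic terms agree by
  invariance of \<open>B\<close>; hence the factor 2 times 3 over 12.\<close>

lemma eta_eq:
  assumes "u \<in> tangent GM g" "v \<in> tangent GM g" "w \<in> tangent GM g"
  shows "eta G GM B g u v w = 1/2 * B (MC_L G GM g u) (br (MC_L G GM g v) (MC_L G GM g w))"
proof -
  note t = MC_L_tangent[OF assms(1)] MC_L_tangent[OF assms(2)] MC_L_tangent[OF assms(3)]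
  have LL: "B x (tdiff (br y z) (br z y)) = 2 * B x (br y z)" if "x \<in> alg" "y \<in> alg" "z \<in> alg" for x y z
    using that br_anti[OF that(2,3)] by (simp add: B_tdiff B_tscale br_tangent tangent_tscale)
  have cyc: "B y (br z x) = B x (br y z)" if "x \<in> alg" "y \<in> alg" "z \<in> alg" for x y z
    using B_br[OF that(3,2,1)] B_sym[OF that(1) br_tangent[OF that(2,3)]] by simp
  show ?thesis
    unfolding eta_def MC_LL_def
    using t cyc[OF t] cyc[OF t(2,3,1)] by (simp add: LL)
qed

end

lemma lie_group_DirProd:
  assumes "lie_group G GM" "lie_group H HM"
  shows "lie_group (G \<times>\<times> H) (prod_mfd GM HM)"
proof -
  interpret G: lie_grp G GM by standard fact
  interpret H: lie_grp H HM by standard fact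
  note P = smooth_manifold_prod[OF G.gm H.gm] and PP = smooth_manifold_prod[OF smooth_manifold_prod[OF G.gm H.gm] smooth_manifold_prod[OF G.gm H.gm]]
  note fst1 = smooth_map_fst(1)[OF G.gm H.gm] and snd1 = smooth_map_fst(2)[OF G.gm H.gm]
  have grp: "group (G \<times>\<times> H)" by (intro DirProd_group G.grp H.grp)
  have car: "carrier (G \<times>\<times> H) = UNIV" using G.grp H.grp by (simp add: DirProd_def)
  have "(\<lambda>(a, b). a \<otimes>\<^bsub>G \<times>\<times> H\<^esub> b) = (\<lambda>z. (fst (fst z) \<otimes>\<^bsub>G\<^esub> fst (snd z), snd (fst z) \<otimes>\<^bsub>H\<^esub> snd (snd z)))"
    by (auto simp: fun_eq_iff)
  moreover have "smooth_map (prod_mfd (prod_mfd GM HM) (prod_mfd GM HM)) (prod_mfd GM HM)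
     (\<lambda>z. (fst (fst z) \<otimes>\<^bsub>G\<^esub> fst (snd z), snd (fst z) \<otimes>\<^bsub>H\<^esub> snd (snd z)))"
    by (intro smooth_map_Pair PP G.gm H.gm G.smooth_mult H.smooth_mult
        smooth_fun_pair_compose[OF P P G.gm fst1] smooth_fun_pair_compose[OF P P H.gm snd1])
  moreover have "(\<lambda>a. inv\<^bsub>G \<times>\<times> H\<^esub> a) = (\<lambda>z. (inv\<^bsub>G\<^esub> (fst z), inv\<^bsub>H\<^esub> (snd z)))"
    using inv_DirProd[OF G.grp(1) H.grp(1)] G.grp(2) H.grp(2) by (auto simp: fun_eq_iff)
  moreover have "smooth_map (prod_mfd GM HM) (prod_mfd GM HM) (\<lambda>z. (inv\<^bsub>G\<^esub> (fst z), inv\<^bsub>H\<^esub> (snd z)))"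
    using fst1 snd1 by (intro smooth_map_Pair P G.gm H.gm G.smooth_inv H.smooth_inv)
  ultimately show ?thesis using grp car P by (simp add: lie_group_def)
qed

lemma smooth_map_euclid_linear:
  assumes "bounded_linear L"
  shows "smooth_map euclid euclid L"
  unfolding smooth_map_def euclid_def
  using assms linear_continuous_on smooth_on_bounded_linear[OF assms] by (auto simp: o_def inv_id[unfolded id_def] id_def)

section \<open>Fusion of Lie algebra actions\<close>

locale fusion = lie_grp_form G GM B
  for G :: "'g::{t2_space,second_countable_topology} monoid" and GM :: "('g, 'e::euclidean_space) mfd"
    and B :: "'g tvec \<Rightarrow> 'g tvec \<Rightarrow> real" +
  fixes M :: "('m::{t2_space,second_countable_topology}, 'd::euclidean_space) mfd"
    and A :: "('g \<times> 'g) tvec \<Rightarrow> 'm \<Rightarrow> 'm tvec" and \<omega> :: "'m form2" and \<Phi> :: "'m \<Rightarrow> 'g \<times> 'g"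
  assumes q: "qham_lie_alg (G \<times>\<times> G) (prod_mfd GM GM) (sum_form GM B) M A \<omega> \<Phi>"
begin

sublocale GG: lie_grp "G \<times>\<times> G" "prod_mfd GM GM"
  by standard (rule lie_group_DirProd[OF lie lie])

abbreviation "PP \<equiv> prod_mfd GM GM"
abbreviation "d1 \<equiv> dmap GM fst"
abbreviation "d2 \<equiv> dmap GM snd"

definition "f1 = (\<lambda>m. fst (\<Phi> m))"
definition "f2 = (\<lambda>m. snd (\<Phi> m))"
definition "\<alpha> m v = MC_L G GM (f1 m) (dmap GM f1 v)"
definition "\<beta> m v = MC_R G GM (f2 m) (dmap GM f2 v)"

lemma M: "smooth_manifold M" and A: "lie_alg_action (G \<times>\<times> G) PP M A" and two: "two_form M \<omega>"
  and \<Phi>: "smooth_map M PP \<Phi>"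
  using q by (auto simp: qham_lie_alg_def)

lemma f12: "smooth_map M GM f1" "smooth_map M GM f2"
  unfolding f1_def f2_def
  using smooth_map_compose[OF M gg gm \<Phi> smooth_map_fst(1)[OF gm gm]] smooth_map_compose[OF M gg gm \<Phi> smooth_map_fst(2)[OF gm gm]]
  by simp_all

lemma d12_dmap: "d1 (dmap PP \<Phi> v) = dmap GM f1 v" "d2 (dmap PP \<Phi> v) = dmap GM f2 v"
  unfolding f1_def f2_def
  by (simp_all add: dmap_compose[OF gg gm smooth_map_fst(1)[OF gm gm]] dmap_compose[OF gg gm smooth_map_fst(2)[OF gm gm]])

text \<open>All these maps are differentials of translations or conjugations, and the projections
  are group homomorphisms intertwining them.\<close>

lemma d12_nat:
  "d1 (MC_L (G \<times>\<times> G) PP g u) = MC_L G GM (fst g) (d1 u)" "d2 (MC_L (G \<times>\<times> G) PP g u) = MC_L G GM (snd g) (d2 u)"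
  "d1 (MC_R (G \<times>\<times> G) PP g u) = MC_R G GM (fst g) (d1 u)" "d2 (MC_R (G \<times>\<times> G) PP g u) = MC_R G GM (snd g) (d2 u)"
  "d1 (Ad (G \<times>\<times> G) PP g u) = Ad G GM (fst g) (d1 u)" "d2 (Ad (G \<times>\<times> G) PP g u) = Ad G GM (snd g) (d2 u)"
  "d1 (left_inv_field (G \<times>\<times> G) PP u g) = left_inv_field G GM (d1 u) (fst g)"
  "d2 (left_inv_field (G \<times>\<times> G) PP u g) = left_inv_field G GM (d2 u) (snd g)"
  "d1 (right_inv_field (G \<times>\<times> G) PP u g) = right_inv_field G GM (d1 u) (fst g)"
  "d2 (right_inv_field (G \<times>\<times> G) PP u g) = right_inv_field G GM (d2 u) (snd g)"
proof -
  note c1 = dmap_compose[OF gg gm smooth_map_fst(1)[OF gm gm]] and c2 = dmap_compose[OF gg gm smooth_map_fst(2)[OF gm gm]]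
  have m: "fst (x \<otimes>\<^bsub>G \<times>\<times> G\<^esub> y) = fst x \<cdot> fst y" "snd (x \<otimes>\<^bsub>G \<times>\<times> G\<^esub> y) = snd x \<cdot> snd y" for x y
    by (cases x; cases y; simp)+
  have i: "fst (inv\<^bsub>G \<times>\<times> G\<^esub> g) = iv (fst g)" "snd (inv\<^bsub>G \<times>\<times> G\<^esub> g) = iv (snd g)"
    using inv_DirProd[OF grp(1) grp(1), of "fst g" "snd g"] grp(2) by simp_all
  note defs = MC_L_def MC_R_def Ad_def left_inv_field_def right_inv_field_def
  show "d1 (MC_L (G \<times>\<times> G) PP g u) = MC_L G GM (fst g) (d1 u)" "d2 (MC_L (G \<times>\<times> G) PP g u) = MC_L G GM (snd g) (d2 u)"
    "d1 (MC_R (G \<times>\<times> G) PP g u) = MC_R G GM (fst g) (d1 u)" "d2 (MC_R (G \<times>\<times> G) PP g u) = MC_R G GM (snd g) (d2 u)"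
    "d1 (Ad (G \<times>\<times> G) PP g u) = Ad G GM (fst g) (d1 u)" "d2 (Ad (G \<times>\<times> G) PP g u) = Ad G GM (snd g) (d2 u)"
    "d1 (left_inv_field (G \<times>\<times> G) PP u g) = left_inv_field G GM (d1 u) (fst g)"
    "d2 (left_inv_field (G \<times>\<times> G) PP u g) = left_inv_field G GM (d2 u) (snd g)"
    "d1 (right_inv_field (G \<times>\<times> G) PP u g) = right_inv_field G GM (d1 u) (fst g)"
    "d2 (right_inv_field (G \<times>\<times> G) PP u g) = right_inv_field G GM (d2 u) (snd g)"
    unfolding defs c1 c2 by (simp_all add: m i dmap_dmap smooth_g del: GG.g_simps)
qed

lemma d12_tangent:
  assumes "u \<in> tangent PP g"
  shows "d1 u \<in> tangent GM (fst g)" "d2 u \<in> tangent GM (snd g)"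
  using dmap_tangent[OF gg gm smooth_map_fst(1)[OF gm gm] assms] dmap_tangent[OF gg gm smooth_map_fst(2)[OF gm gm] assms]
  by auto

lemma d12_alg: "u \<in> GG.alg \<Longrightarrow> d1 u \<in> alg" "u \<in> GG.alg \<Longrightarrow> d2 u \<in> alg"
  using d12_tangent[of u "(unit, unit)"] by auto

lemma d12_br:
  assumes "u \<in> GG.alg" "v \<in> GG.alg"
  shows "d1 (GG.br u v) = br (d1 u) (d1 v)" "d2 (GG.br u v) = br (d2 u) (d2 v)"
proof -
  have L: "lie_grp (G \<times>\<times> G) PP" "lie_grp G GM" by unfold_locales
  show "d1 (GG.br u v) = br (d1 u) (d1 v)"
    by (rule dmap_hom_br[OF L smooth_map_fst(1)[OF gm gm] _ assms]) auto
  show "d2 (GG.br u v) = br (d2 u) (d2 v)"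
    by (rule dmap_hom_br[OF L smooth_map_fst(2)[OF gm gm] _ assms]) auto
qed

lemma diag_smooth: "smooth_map GM PP (\<lambda>g. (g, g))"
  by (intro smooth_map_Pair smooth_g)

lemma diag_alg: "x \<in> alg \<Longrightarrow> diag_alg GM x \<in> GG.alg"
  using dmap_tangent[OF gm gg diag_smooth, of x unit] by (simp add: diag_alg_def)

lemma diag_br: "x \<in> alg \<Longrightarrow> y \<in> alg \<Longrightarrow> diag_alg GM (br x y) = GG.br (diag_alg GM x) (diag_alg GM y)"
  unfolding diag_alg_def
  by (rule dmap_hom_br) (auto intro: diag_smooth lie_grp_axioms GG.lie_grp_axioms)

lemma d12_diag: "x \<in> alg \<Longrightarrow> d1 (diag_alg GM x) = x" "x \<in> alg \<Longrightarrow> d2 (diag_alg GM x) = x"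
  by (simp_all add: diag_alg_def dmap_compose[OF gg gm smooth_map_fst(1)[OF gm gm]]
      dmap_compose[OF gg gm smooth_map_fst(2)[OF gm gm]] dmap_id)

lemma d12_eq_0:
  assumes u: "u \<in> GG.alg" and 0: "d1 u = (\<lambda>f. 0)" "d2 u = (\<lambda>f. 0)"
  shows "u = (\<lambda>f. 0)"
proof (rule tangent_eqI[OF u tangent_zero])
  fix h assume h: "h \<in> smooth_fun PP"
  have "u \<in> tangent PP (unit, unit)" using u by simp
  from tangent_prod_decomp[OF gm gm this h] show "u h = 0" using 0 by simp
qed

text \<open>The first summand of the Lie algebra of the product group. In the kernel argument it
  isolates \<alpha>, which the diagonal cannot do.\<close>

definition "inl x = dmap PP (\<lambda>g. (g, unit)) x"

lemma inl:
  assumes "x \<in> alg"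
  shows "inl x \<in> GG.alg" "d1 (inl x) = x" "d2 (inl x) = (\<lambda>f. 0)"
proof -
  have s: "smooth_map GM PP (\<lambda>g. (g, unit))" by (intro smooth_map_Pair smooth_g)
  show "inl x \<in> GG.alg" using dmap_tangent[OF gm gg s assms] by (simp add: inl_def)
  show "d1 (inl x) = x"
    by (simp add: inl_def dmap_compose[OF gg gm smooth_map_fst(1)[OF gm gm]] dmap_id[OF assms])
  show "d2 (inl x) = (\<lambda>f. 0)"
  proof
    fix h
    have "dmap GM (\<lambda>x. unit) x h = 0"
      using tangent_const[OF gm assms] by (cases "h \<in> smooth_fun GM") (simp_all add: dmap_apply, simp add: dmap_def)
    then show "d2 (inl x) h = 0" by (simp add: inl_def dmap_compose[OF gg gm smooth_map_fst(2)[OF gm gm]])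
  qed
qed

lemma \<alpha>\<beta>_alg: "v \<in> tangent M m \<Longrightarrow> \<alpha> m v \<in> alg" "v \<in> tangent M m \<Longrightarrow> \<beta> m v \<in> alg"
  by (simp_all add: \<alpha>_def \<beta>_def pull_MC_tangent(1)[OF M f12(1)] pull_MC_tangent(2)[OF M f12(2)])

lemma \<alpha>\<beta>_lincomb: "\<alpha> m (lincomb a u b v) = lincomb a (\<alpha> m u) b (\<alpha> m v)"
  "\<beta> m (lincomb a u b v) = lincomb a (\<beta> m u) b (\<beta> m v)"
  by (simp_all add: \<alpha>_def \<beta>_def MC_L_def MC_R_def dmap_lincomb)

lemma \<alpha>\<beta>_smooth:
  assumes "X \<in> vector_fields M" "h \<in> smooth_fun GM"
  shows "(\<lambda>m. \<alpha> m (X m) h) \<in> smooth_fun M" "(\<lambda>m. \<beta> m (X m) h) \<in> smooth_fun M"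
  unfolding \<alpha>_def \<beta>_def
  using pull_MC_vf_smooth(1)[OF M f12(1) assms] pull_MC_vf_smooth(2)[OF M f12(2) assms] by auto

lemma A_vf: "u \<in> GG.alg \<Longrightarrow> A u \<in> vector_fields M"
  and A_lin: "u \<in> GG.alg \<Longrightarrow> v \<in> GG.alg \<Longrightarrow> A (lincomb a u b v) m = lincomb a (A u m) b (A v m)"
  and A_br: "u \<in> GG.alg \<Longrightarrow> v \<in> GG.alg \<Longrightarrow> A (GG.br u v) = vf_bracket (A u) (A v)"
  using A by (auto simp: lie_alg_action_def lie_alg_def)

lemma A_tangent: "u \<in> GG.alg \<Longrightarrow> A u m \<in> tangent M m"
  using vector_fieldsD(1)[OF A_vf] .

lemma equivariant:
  assumes "u \<in> GG.alg"
  shows "dmap GM f1 (A u m) = tdiff (left_inv_field G GM (d1 u) (f1 m)) (right_inv_field G GM (d1 u) (f1 m))"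
    and "dmap GM f2 (A u m) = tdiff (left_inv_field G GM (d2 u) (f2 m)) (right_inv_field G GM (d2 u) (f2 m))"
proof -
  have "dmap PP \<Phi> (A u m) = tdiff (left_inv_field (G \<times>\<times> G) PP u (\<Phi> m)) (right_inv_field (G \<times>\<times> G) PP u (\<Phi> m))"
    using q assms by (simp add: qham_lie_alg_def lie_alg_def)
  then have "d1 (dmap PP \<Phi> (A u m)) = d1 (tdiff (left_inv_field (G \<times>\<times> G) PP u (\<Phi> m)) (right_inv_field (G \<times>\<times> G) PP u (\<Phi> m)))"
    "d2 (dmap PP \<Phi> (A u m)) = d2 (tdiff (left_inv_field (G \<times>\<times> G) PP u (\<Phi> m)) (right_inv_field (G \<times>\<times> G) PP u (\<Phi> m)))"
    by simp_all
  then show "dmap GM f1 (A u m) = tdiff (left_inv_field G GM (d1 u) (f1 m)) (right_inv_field G GM (d1 u) (f1 m))"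
    "dmap GM f2 (A u m) = tdiff (left_inv_field G GM (d2 u) (f2 m)) (right_inv_field G GM (d2 u) (f2 m))"
    unfolding d12_dmap dmap_tdiff d12_nat by (simp_all add: f1_def f2_def)
qed

lemma \<alpha>\<beta>_A:
  assumes "u \<in> GG.alg"
  shows "\<alpha> m (A u m) = tdiff (d1 u) (Ad G GM (iv (f1 m)) (d1 u))"
    and "\<beta> m (A u m) = tdiff (Ad G GM (f2 m) (d2 u)) (d2 u)"
  by (simp_all add: \<alpha>_def \<beta>_def equivariant[OF assms] MC_L_tdiff MC_R_tdiff
      MC_left_right d12_alg[OF assms])

text \<open>The hypothesis on \<omega> rewritten with \<alpha> and \<beta> alone: the right form on
  the first factor is \<open>Ad\<close> at \<open>f1 m\<close> of \<alpha>, the left form on the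
  second is \<open>Ad\<close> at the inverse of \<open>f2 m\<close> of \<beta>.\<close>

lemma moment:
  assumes u: "u \<in> GG.alg" and v: "v \<in> tangent M m"
  shows "\<omega> m (A u m) v = 1/2 * (B (d1 u) (\<alpha> m v) + B (d1 u) (Ad G GM (f1 m) (\<alpha> m v)) +
     B (d2 u) (Ad G GM (iv (f2 m)) (\<beta> m v)) + B (d2 u) (\<beta> m v))"
proof -
  have "\<omega> m (A u m) v = sum_form GM B u (lincomb (1/2) (MC_L (G \<times>\<times> G) PP (\<Phi> m) (dmap PP \<Phi> v))
      (1/2) (MC_R (G \<times>\<times> G) PP (\<Phi> m) (dmap PP \<Phi> v)))"
    using q u v by (simp add: qham_lie_alg_def lie_alg_def)
  also have "\<dots> = B (d1 u) (lincomb (1/2) (\<alpha> m v) (1/2) (Ad G GM (f1 m) (\<alpha> m v))) +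
      B (d2 u) (lincomb (1/2) (Ad G GM (iv (f2 m)) (\<beta> m v)) (1/2) (\<beta> m v))"
    unfolding sum_form_def dmap_lincomb d12_nat d12_dmap \<alpha>_def \<beta>_def
    by (simp add: f1_def[symmetric] f2_def[symmetric] MC_R_eq_Ad[of "f1 m"] MC_L_eq_Ad[of "f2 m"]
        fun_cong[OF f1_def[symmetric]] fun_cong[OF f2_def[symmetric]])
  finally show ?thesis
    using u v by (simp add: B_lincomb d12_alg \<alpha>\<beta>_alg Ad_tangent)
qed

section \<open>The fused two-form\<close>

abbreviation "\<omega>' \<equiv> omega_fus G GM B \<omega> \<Phi>"

lemma \<omega>'_eq: "\<omega>' m u v = \<omega> m u v - 1/2 * (B (\<alpha> m u) (\<beta> m v) - B (\<alpha> m v) (\<beta> m u))"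
  unfolding omega_fus_def pull2_def varsigma_def \<alpha>_def \<beta>_def case_prod_beta d12_dmap
  by (simp add: f1_def f2_def)

lemma \<omega>_anti:
  assumes "u \<in> tangent M m" "v \<in> tangent M m"
  shows "\<omega> m u v = - \<omega> m v u"
proof -
  have lin: "bilinear_on_tangent M m (\<omega> m)" and z: "\<And>v. v \<in> tangent M m \<Longrightarrow> \<omega> m v v = 0"
    using two by (auto simp: two_form_def)
  have "\<omega> m (lincomb 1 u 1 v) (lincomb 1 u 1 v) = 0" by (intro z tangent_lincomb assms)
  then show ?thesis
    using lin assms z[OF assms(1)] z[OF assms(2)] tangent_lincomb[OF assms, of 1 1] by (simp add: bilinear_on_tangent_def)
qed

lemma \<omega>_lin:
  assumes "u \<in> tangent M m" "v \<in> tangent M m" "w \<in> tangent M m"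
  shows "\<omega> m (lincomb a u b v) w = a * \<omega> m u w + b * \<omega> m v w" "\<omega> m w (lincomb a u b v) = a * \<omega> m w u + b * \<omega> m w v"
  using two assms by (auto simp: two_form_def bilinear_on_tangent_def)

lemma \<omega>'_lin:
  assumes "u \<in> tangent M m" "v \<in> tangent M m" "w \<in> tangent M m"
  shows "\<omega>' m (lincomb a u b v) w = a * \<omega>' m u w + b * \<omega>' m v w" "\<omega>' m w (lincomb a u b v) = a * \<omega>' m w u + b * \<omega>' m w v"
  using assms by (simp_all add: \<omega>'_eq \<omega>_lin \<alpha>\<beta>_lincomb B_lincomb \<alpha>\<beta>_alg algebra_simps)

lemma \<omega>'_anti:
  assumes "u \<in> tangent M m" "v \<in> tangent M m"
  shows "\<omega>' m u v = - \<omega>' m v u"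
  using \<omega>_anti[OF assms] by (simp add: \<omega>'_eq field_simps)

lemma B\<alpha>\<beta>_smooth:
  assumes "X \<in> vector_fields M" "Y \<in> vector_fields M"
  shows "(\<lambda>m. B (\<alpha> m (X m)) (\<beta> m (Y m))) \<in> smooth_fun M"
  by (intro B_smooth M \<alpha>\<beta>_alg \<alpha>\<beta>_smooth vector_fieldsD(1)[OF assms(1)] vector_fieldsD(1)[OF assms(2)] assms)

lemma two_form_fus: "two_form M \<omega>'"
  unfolding two_form_def bilinear_on_tangent_def
proof (intro conjI allI ballI)
  fix p v assume "v \<in> tangent M p"
  then show "\<omega>' p v v = 0" using two by (simp add: \<omega>'_eq two_form_def)
next
  fix X Y assume X: "X \<in> vector_fields M" and Y: "Y \<in> vector_fields M"
  have "(\<lambda>p. \<omega> p (X p) (Y p)) \<in> smooth_fun M" using two X Y by (simp add: two_form_def)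
  then show "(\<lambda>p. \<omega>' p (X p) (Y p)) \<in> smooth_fun M"
    unfolding \<omega>'_eq
    by (intro smooth_fun_diff smooth_fun_mult smooth_fun_const B\<alpha>\<beta>_smooth M X Y)
qed (simp_all add: \<omega>'_lin)

section \<open>The fused moment map and the diagonal action\<close>

abbreviation "\<Phi>' \<equiv> Phi_fus G \<Phi>"

lemma \<Phi>'_eq: "\<Phi>' = (\<lambda>m. f1 m \<cdot> f2 m)"
  by (simp add: Phi_fus_def f1_def f2_def fun_eq_iff case_prod_beta)

lemma \<Phi>'_smooth: "smooth_map M GM \<Phi>'"
  unfolding \<Phi>'_eq by (intro smooth_mult M f12)

lemma fus_diagonal:
  assumes v: "v \<in> tangent M m" and h: "h \<in> smooth_fun GM"
  shows "v (\<lambda>y. h (f1 y \<cdot> f2 y)) = v (\<lambda>y. h (f1 y \<cdot> f2 m)) + v (\<lambda>y. h (f1 m \<cdot> f2 y))"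
proof -
  have "(\<lambda>z. h (f1 (fst z) \<cdot> f2 (snd z))) \<in> smooth_fun (prod_mfd M M)"
    by (intro smooth_fun_map[OF h] smooth_mult smooth_manifold_prod M smooth_fun_pair_compose gm f12)
  from tangent_diagonal_curried[where F = "\<lambda>x y. h (f1 x \<cdot> f2 y)", OF M this v] show ?thesis .
qed

text \<open>For a product ab of group-valued functions, (ab)^-1 d(ab) is the conjugate by b^-1 of
  a^-1 da + (db) b^-1.\<close>

lemma MC_L_fus:
  assumes v: "v \<in> tangent M m"
  shows "MC_L G GM (\<Phi>' m) (dmap GM \<Phi>' v) = Ad G GM (iv (f2 m)) (lincomb 1 (\<alpha> m v) 1 (\<beta> m v))"
proof (rule tangent_eqI)
  show "MC_L G GM (\<Phi>' m) (dmap GM \<Phi>' v) \<in> alg" by (rule pull_MC_tangent[OF M \<Phi>'_smooth v])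
  show "Ad G GM (iv (f2 m)) (lincomb 1 (\<alpha> m v) 1 (\<beta> m v)) \<in> alg"
    by (intro Ad_tangent tangent_lincomb \<alpha>\<beta>_alg v)
  fix h assume h: "h \<in> smooth_fun GM"
  have 1: "(\<lambda>x. h (k \<cdot> x)) \<in> smooth_fun GM" for k by (intro smooth_fun_map[OF h] smooth_g)
  have 2: "(\<lambda>x. h (iv (f2 m) \<cdot> (x \<cdot> iv (iv (f2 m))))) \<in> smooth_fun GM" by (intro smooth_fun_map[OF h] smooth_g)
  have "MC_L G GM (\<Phi>' m) (dmap GM \<Phi>' v) h = v (\<lambda>y. h (iv (\<Phi>' m) \<cdot> \<Phi>' y))"
    by (rule pull_MC_apply[OF h])
  also have "\<dots> = v (\<lambda>y. h (iv (\<Phi>' m) \<cdot> (f1 y \<cdot> f2 m))) + v (\<lambda>y. h (iv (\<Phi>' m) \<cdot> (f1 m \<cdot> f2 y)))"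
    using fus_diagonal[OF v 1[of "iv (\<Phi>' m)"]] by (simp add: \<Phi>'_eq)
  also have "\<dots> = \<alpha> m v (\<lambda>x. h (iv (f2 m) \<cdot> (x \<cdot> iv (iv (f2 m))))) + \<beta> m v (\<lambda>x. h (iv (f2 m) \<cdot> (x \<cdot> iv (iv (f2 m)))))"
    unfolding \<alpha>_def \<beta>_def pull_MC_apply[OF 2] by (simp add: \<Phi>'_eq)
  also have "\<dots> = Ad G GM (iv (f2 m)) (lincomb 1 (\<alpha> m v) 1 (\<beta> m v)) h"
    unfolding Ad_apply[OF h] by (simp add: lincomb_def)
  finally show "MC_L G GM (\<Phi>' m) (dmap GM \<Phi>' v) h = Ad G GM (iv (f2 m)) (lincomb 1 (\<alpha> m v) 1 (\<beta> m v)) h" .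
qed

lemma MC_R_fus:
  assumes v: "v \<in> tangent M m"
  shows "MC_R G GM (\<Phi>' m) (dmap GM \<Phi>' v) = Ad G GM (f1 m) (lincomb 1 (\<alpha> m v) 1 (\<beta> m v))"
  unfolding MC_R_eq_Ad MC_L_fus[OF v] by (simp add: Ad_Ad \<Phi>'_eq)

text \<open>With a = \<open>f1 m\<close> and b = \<open>f2 m\<close>, the contribution of
  \<open>varsigma\<close> cancels the unconjugated terms B(x, \<alpha>) and B(x, \<beta>) of
  \<open>moment\<close>. It adds half of B(x, Ad a \<beta>) and of B(x, Ad b^-1 \<alpha>), which
  complete both conjugated terms to the sum of \<alpha> and \<beta>.\<close>

lemma moment_fus:
  assumes x: "x \<in> alg" and v: "v \<in> tangent M m"
  shows "\<omega>' m (A (diag_alg GM x) m) v =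
    B x (lincomb (1/2) (MC_L G GM (\<Phi>' m) (dmap GM \<Phi>' v)) (1/2) (MC_R G GM (\<Phi>' m) (dmap GM \<Phi>' v)))"
proof -
  note t = \<alpha>\<beta>_alg[OF v] and d = diag_alg[OF x]
  have 1: "B (Ad G GM (iv (f1 m)) x) (\<beta> m v) = B x (Ad G GM (f1 m) (\<beta> m v))"
    using x t by (simp add: B_Ad_left)
  have "B (\<alpha> m v) (Ad G GM (f2 m) x) = B (Ad G GM (f2 m) x) (\<alpha> m v)"
    using x t by (intro B_sym Ad_tangent)
  also have "\<dots> = B x (Ad G GM (iv (f2 m)) (\<alpha> m v))" using x t by (simp add: B_Ad_left)
  finally have 2: "B (\<alpha> m v) (Ad G GM (f2 m) x) = B x (Ad G GM (iv (f2 m)) (\<alpha> m v))" .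
  show ?thesis
    unfolding MC_L_fus[OF v] MC_R_fus[OF v] \<omega>'_eq moment[OF d v] \<alpha>\<beta>_A[OF d] d12_diag[OF x]
    using x t 1 2 B_sym[OF t(1) x]
    by (simp add: B_lincomb B_tdiff Ad_tangent tangent_lincomb Ad_lincomb algebra_simps)
qed

text \<open>By the product rule, the right-invariant term of the second factor cancels the
  left-invariant term of the first: both insert \<open>x\<close> between \<open>f1 m\<close> and
  \<open>f2 m\<close>, with opposite signs.\<close>

lemma equivariant_fus:
  assumes x: "x \<in> alg"
  shows "dmap GM \<Phi>' (A (diag_alg GM x) m) = tdiff (left_inv_field G GM x (\<Phi>' m)) (right_inv_field G GM x (\<Phi>' m))"
proof (rule tangent_eqI)
  note d = diag_alg[OF x]
  note At = A_tangent[OF d, of m]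
  show "dmap GM \<Phi>' (A (diag_alg GM x) m) \<in> tangent GM (\<Phi>' m)" by (rule dmap_tangent[OF M gm \<Phi>'_smooth At])
  show "tdiff (left_inv_field G GM x (\<Phi>' m)) (right_inv_field G GM x (\<Phi>' m)) \<in> tangent GM (\<Phi>' m)"
    by (intro tangent_tdiff left_tangent right_tangent x)
  fix h assume h: "h \<in> smooth_fun GM"
  have 1: "(\<lambda>x. h (x \<cdot> f2 m)) \<in> smooth_fun GM" "(\<lambda>x. h (f1 m \<cdot> x)) \<in> smooth_fun GM"
    by (intro smooth_fun_map[OF h] smooth_g)+
  have "dmap GM \<Phi>' (A (diag_alg GM x) m) h = A (diag_alg GM x) m (\<lambda>y. h (f1 y \<cdot> f2 m)) + A (diag_alg GM x) m (\<lambda>y. h (f1 m \<cdot> f2 y))"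
    using fus_diagonal[OF At h] by (simp add: dmap_apply[OF h]) (simp add: \<Phi>'_eq)
  also have "A (diag_alg GM x) m (\<lambda>y. h (f1 y \<cdot> f2 m)) = dmap GM f1 (A (diag_alg GM x) m) (\<lambda>y. h (y \<cdot> f2 m))"
    by (simp add: dmap_apply[OF 1(1)])
  also have "A (diag_alg GM x) m (\<lambda>y. h (f1 m \<cdot> f2 y)) = dmap GM f2 (A (diag_alg GM x) m) (\<lambda>y. h (f1 m \<cdot> y))"
    by (simp add: dmap_apply[OF 1(2)])
  also have "dmap GM f1 (A (diag_alg GM x) m) (\<lambda>y. h (y \<cdot> f2 m)) + dmap GM f2 (A (diag_alg GM x) m) (\<lambda>y. h (f1 m \<cdot> y)) =
      tdiff (left_inv_field G GM x (\<Phi>' m)) (right_inv_field G GM x (\<Phi>' m)) h"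
    unfolding equivariant[OF d] d12_diag[OF x] tdiff_def left_apply[OF 1(1)] left_apply[OF 1(2)]
      right_apply[OF 1(1)] right_apply[OF 1(2)] left_apply[OF h] right_apply[OF h]
    by (simp add: \<Phi>'_eq)
  finally show "dmap GM \<Phi>' (A (diag_alg GM x) m) h = tdiff (left_inv_field G GM x (\<Phi>' m)) (right_inv_field G GM x (\<Phi>' m)) h" .
qed

lemma lie_alg_action_fus: "lie_alg_action G GM M (\<lambda>x. A (diag_alg GM x))"
  unfolding lie_alg_action_def lie_alg_def
proof (intro conjI ballI allI impI)
  fix L :: "'e \<Rightarrow> 'g tvec" and f
  assume L: "(\<forall>x. L x \<in> alg) \<and> (\<forall>x y a b. L (a *\<^sub>R x + b *\<^sub>R y) = lincomb a (L x) b (L y))" and f: "f \<in> smooth_fun M"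
  \<comment> \<open>Smoothness of the given action is tested on linear maps from the model type of
    the product group. The map \<open>L\<close> is extended by ignoring the second coordinate, and
    the result is pulled back along the inclusion of the first.\<close>
  define L' where "L' z = diag_alg GM (L (fst z))" for z :: "'e \<times> 'e"
  have "\<forall>z. L' z \<in> GG.alg" unfolding L'_def using L diag_alg by blast
  moreover have "\<forall>x y a b. L' (a *\<^sub>R x + b *\<^sub>R y) = lincomb a (L' x) b (L' y)"
    using L by (simp add: L'_def diag_alg_def dmap_lincomb)
  ultimately have 1: "(\<lambda>(z, m). A (L' z) m f) \<in> smooth_fun (prod_mfd (euclid :: ('e \<times> 'e, 'e \<times> 'e) mfd) M)"
    using A f unfolding lie_alg_action_def lie_alg_def by blast
  have 2: "smooth_map (prod_mfd (euclid :: ('e, 'e) mfd) M) (prod_mfd (euclid :: ('e \<times> 'e, 'e \<times> 'e) mfd) M)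
      (\<lambda>z. ((fst z, 0), snd z))"
    by (intro smooth_map_Pair smooth_manifold_prod smooth_manifold_euclid M smooth_map_fst[OF smooth_manifold_euclid M]
        smooth_fun_pair_compose(1)[where f = "\<lambda>x. (x, 0)"] smooth_map_euclid_linear
        bounded_linear_Pair bounded_linear_ident bounded_linear_zero)
  show "(\<lambda>(x, m). A (diag_alg GM (L x)) m f) \<in> smooth_fun (prod_mfd (euclid :: ('e, 'e) mfd) M)"
    using smooth_fun_compose[OF smooth_manifold_prod[OF smooth_manifold_euclid M] smooth_manifold_prod[OF smooth_manifold_euclid M] 2 1]
    by (simp add: L'_def case_prod_beta')
next
  fix x y a b m assume "x \<in> alg" "y \<in> alg"
  then show "A (diag_alg GM (lincomb a x b y)) m = lincomb a (A (diag_alg GM x) m) b (A (diag_alg GM y) m)"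
    using A_lin[OF diag_alg diag_alg] by (simp add: diag_alg_def dmap_lincomb)
qed (simp_all add: A_vf[OF diag_alg] diag_br A_br[OF diag_alg diag_alg])

section \<open>The exterior derivative of the fused form\<close>

lemma eta_GG:
  assumes "u \<in> tangent PP g" "v \<in> tangent PP g" "w \<in> tangent PP g"
  shows "eta (G \<times>\<times> G) PP (sum_form GM B) g u v w =
    eta G GM B (fst g) (d1 u) (d1 v) (d1 w) + eta G GM B (snd g) (d2 u) (d2 v) (d2 w)"
  unfolding eta_def sum_form_def MC_LL_def dmap_tdiff
  by (simp only: d12_br[OF GG.MC_L_tangent GG.MC_L_tangent] assms d12_nat) (simp add: field_simps)

lemma br_lincomb_right:
  assumes "u \<in> alg" "v \<in> alg" "w \<in> alg"
  shows "br w (lincomb a u b v) = lincomb a (br w u) b (br w v)"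
  unfolding br_anti[OF tangent_lincomb[OF assms(1,2)] assms(3)] br_lincomb_left[OF assms]
    br_anti[OF assms(1,3)] br_anti[OF assms(2,3)]
  by (simp add: lincomb_def tscale_def fun_eq_iff algebra_simps)

lemma d_eq_fus: "d_eq M \<omega>' (pull3 GM \<Phi>' (eta G GM B))"
  unfolding d_eq_def
proof (intro ballI allI)
  fix X Y Z p
  assume X: "X \<in> vector_fields M" and Y: "Y \<in> vector_fields M" and Z: "Z \<in> vector_fields M"
  note T = vector_fieldsD(1)[OF X, of p] vector_fieldsD(1)[OF Y, of p] vector_fieldsD(1)[OF Z, of p]
  \<comment> \<open>The derivative along \<open>W\<close> at \<open>p\<close> of the function
    \<alpha> evaluated on \<open>V\<close>; \<open>b\<close> is the same for \<beta>.\<close>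
  define a where "a V W = vder (W p) (\<lambda>q. \<alpha> q (V q))" for V W :: "'m \<Rightarrow> 'm tvec"
  define b where "b V W = vder (W p) (\<lambda>q. \<beta> q (V q))" for V W :: "'m \<Rightarrow> 'm tvec"
  have ab: "a V W \<in> alg" "b V W \<in> alg" if "V \<in> vector_fields M" "W \<in> vector_fields M" for V W
    unfolding a_def b_def
    using vder_tangent[OF vector_fieldsD(1)[OF that(2)] \<alpha>\<beta>_alg(1)[OF vector_fieldsD(1)[OF that(1)]] \<alpha>\<beta>_smooth(1)[OF that(1)]]
      vder_tangent[OF vector_fieldsD(1)[OF that(2)] \<alpha>\<beta>_alg(2)[OF vector_fieldsD(1)[OF that(1)]] \<alpha>\<beta>_smooth(2)[OF that(1)]]
    by simp_all
  have der: "W p (\<lambda>q. \<omega>' q (V q) (U q)) = W p (\<lambda>q. \<omega> q (V q) (U q)) -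
      1/2 * (B (a V W) (\<beta> p (U p)) + B (\<alpha> p (V p)) (b U W) - (B (a U W) (\<beta> p (V p)) + B (\<alpha> p (U p)) (b V W)))"
    if V: "V \<in> vector_fields M" and U: "U \<in> vector_fields M" and W: "W \<in> vector_fields M" for U V W
  proof -
    note w = vector_fieldsD(1)[OF W, of p]
    have L: "W p (\<lambda>q. B (\<alpha> q (V q)) (\<beta> q (U q))) = B (a V W) (\<beta> p (U p)) + B (\<alpha> p (V p)) (b U W)"
      if V: "V \<in> vector_fields M" and U: "U \<in> vector_fields M" for U V
      unfolding a_def b_def
      by (rule B_Leibniz[OF M w]) (intro \<alpha>\<beta>_alg \<alpha>\<beta>_smooth V U vector_fieldsD(1)[OF U] vector_fieldsD(1)[OF V]; assumption)+
    have s: "(\<lambda>q. \<omega> q (V q) (U q)) \<in> smooth_fun M" using two V U by (simp add: two_form_def)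
    note s1 = B\<alpha>\<beta>_smooth[OF V U] and s2 = B\<alpha>\<beta>_smooth[OF U V]
    have "W p (\<lambda>q. \<omega>' q (V q) (U q)) = W p (\<lambda>q. \<omega> q (V q) (U q)) -
        W p (\<lambda>q. 1/2 * (B (\<alpha> q (V q)) (\<beta> q (U q)) - B (\<alpha> q (U q)) (\<beta> q (V q))))"
      unfolding \<omega>'_eq
      by (rule tangent_diff[OF w s]) (intro smooth_fun_mult smooth_fun_const smooth_fun_diff s1 s2 M)
    also have "W p (\<lambda>q. 1/2 * (B (\<alpha> q (V q)) (\<beta> q (U q)) - B (\<alpha> q (U q)) (\<beta> q (V q)))) =
        1/2 * W p (\<lambda>q. B (\<alpha> q (V q)) (\<beta> q (U q)) - B (\<alpha> q (U q)) (\<beta> q (V q)))"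
      by (rule tangent_cmult[OF w]) (intro smooth_fun_diff s1 s2 M)
    also have "W p (\<lambda>q. B (\<alpha> q (V q)) (\<beta> q (U q)) - B (\<alpha> q (U q)) (\<beta> q (V q))) =
        W p (\<lambda>q. B (\<alpha> q (V q)) (\<beta> q (U q))) - W p (\<lambda>q. B (\<alpha> q (U q)) (\<beta> q (V q)))"
      by (rule tangent_diff[OF w s1 s2])
    finally show ?thesis unfolding L[OF V U] L[OF U V] .
  qed
  have mc: "B (a W V) w - B (a V W) w = B (\<alpha> p (vf_bracket V W p)) w - B (br (\<alpha> p (V p)) (\<alpha> p (W p))) w"
    "B w (b W V) - B w (b V W) = B w (\<beta> p (vf_bracket V W p)) + B w (br (\<beta> p (V p)) (\<beta> p (W p)))"
    if V: "V \<in> vector_fields M" and W: "W \<in> vector_fields M" and w: "w \<in> alg" for V W w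
  proof -
    note t = \<alpha>\<beta>_alg[OF vf_bracket_tangent[OF M V W], of p] \<alpha>\<beta>_alg[OF vector_fieldsD(1)[OF V], of p]
      \<alpha>\<beta>_alg[OF vector_fieldsD(1)[OF W], of p] ab[OF V W] ab[OF W V]
    have "tdiff (a W V) (a V W) = tdiff (\<alpha> p (vf_bracket V W p)) (br (\<alpha> p (V p)) (\<alpha> p (W p)))"
    proof (rule tangent_eqI[where p = unit and q = unit])
      fix h assume h: "h \<in> smooth_fun GM"
      show "tdiff (a W V) (a V W) h = tdiff (\<alpha> p (vf_bracket V W p)) (br (\<alpha> p (V p)) (\<alpha> p (W p))) h"
        using MC_L_equation[OF M f12(1) V W h, of p] h by (simp add: tdiff_def a_def vder_def \<alpha>_def)
    qed (intro tangent_tdiff br_tangent t)+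
    then have "B (tdiff (a W V) (a V W)) w = B (tdiff (\<alpha> p (vf_bracket V W p)) (br (\<alpha> p (V p)) (\<alpha> p (W p)))) w"
      by simp
    then show "B (a W V) w - B (a V W) w = B (\<alpha> p (vf_bracket V W p)) w - B (br (\<alpha> p (V p)) (\<alpha> p (W p))) w"
      using t w by (simp add: B_tdiff br_tangent)
    have "tdiff (b W V) (b V W) = lincomb 1 (\<beta> p (vf_bracket V W p)) 1 (br (\<beta> p (V p)) (\<beta> p (W p)))"
    proof (rule tangent_eqI[where p = unit and q = unit])
      fix h assume h: "h \<in> smooth_fun GM"
      show "tdiff (b W V) (b V W) h = lincomb 1 (\<beta> p (vf_bracket V W p)) 1 (br (\<beta> p (V p)) (\<beta> p (W p))) h"
        using MC_R_equation[OF M f12(2) V W h, of p] h by (simp add: tdiff_def lincomb_def b_def vder_def \<beta>_def)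
    qed (intro tangent_tdiff tangent_lincomb br_tangent t)+
    then have "B w (tdiff (b W V) (b V W)) = B w (lincomb 1 (\<beta> p (vf_bracket V W p)) 1 (br (\<beta> p (V p)) (\<beta> p (W p))))"
      by simp
    then show "B w (b W V) - B w (b V W) = B w (\<beta> p (vf_bracket V W p)) + B w (br (\<beta> p (V p)) (\<beta> p (W p)))"
      using t w by (simp add: B_tdiff B_lincomb br_tangent)
  qed
  define x1 x2 x3 where "x1 = \<alpha> p (X p)" and "x2 = \<alpha> p (Y p)" and "x3 = \<alpha> p (Z p)"
  define y1 y2 y3 where "y1 = \<beta> p (X p)" and "y2 = \<beta> p (Y p)" and "y3 = \<beta> p (Z p)"
  note xy_def = x1_def x2_def x3_def y1_def y2_def y3_def
  have x: "x1 \<in> alg" "x2 \<in> alg" "x3 \<in> alg" and y: "y1 \<in> alg" "y2 \<in> alg" "y3 \<in> alg"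
    unfolding xy_def by (intro \<alpha>\<beta>_alg T)+
  have d\<omega>: "ext_d2 \<omega> X Y Z p = 1/2 * B x1 (br x2 x3) + 1/2 * B y1 (br y2 y3)"
  proof -
    have "ext_d2 \<omega> X Y Z p = pull3 PP \<Phi> (eta (G \<times>\<times> G) PP (sum_form GM B)) p (X p) (Y p) (Z p)"
      using q X Y Z by (simp add: qham_lie_alg_def d_eq_def)
    also have "\<dots> = eta G GM B (f1 p) (dmap GM f1 (X p)) (dmap GM f1 (Y p)) (dmap GM f1 (Z p)) +
        eta G GM B (f2 p) (dmap GM f2 (X p)) (dmap GM f2 (Y p)) (dmap GM f2 (Z p))"
      unfolding pull3_def
      by (subst eta_GG) (simp_all add: dmap_tangent[OF M gg \<Phi>] T d12_dmap, simp add: f1_def f2_def)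
    also have "eta G GM B (f1 p) (dmap GM f1 (X p)) (dmap GM f1 (Y p)) (dmap GM f1 (Z p)) = 1/2 * B x1 (br x2 x3)"
      by (subst eta_eq) (simp_all add: dmap_tangent[OF M gm f12(1)] T xy_def \<alpha>_def)
    also have "eta G GM B (f2 p) (dmap GM f2 (X p)) (dmap GM f2 (Y p)) (dmap GM f2 (Z p)) =
        1/2 * B (Ad G GM (iv (f2 p)) y1) (br (Ad G GM (iv (f2 p)) y2) (Ad G GM (iv (f2 p)) y3))"
      by (subst eta_eq) (simp_all add: dmap_tangent[OF M gm f12(2)] T xy_def \<beta>_def MC_L_eq_Ad)
    \<comment> \<open>The form \<open>eta\<close> is bi-invariant: the conjugation relating the left
      and right Maurer--Cartan forms drops out.\<close>
    also have "\<dots> = 1/2 * B y1 (br y2 y3)"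
      using y by (simp add: Ad_br[symmetric] B_Ad br_tangent)
    finally show ?thesis .
  qed
  have rhs: "pull3 GM \<Phi>' (eta G GM B) p (X p) (Y p) (Z p) = 1/2 * (B x1 (br x2 x3) + B x1 (br x2 y3) + B x1 (br y2 x3) + B x1 (br y2 y3) +
      B y1 (br x2 x3) + B y1 (br x2 y3) + B y1 (br y2 x3) + B y1 (br y2 y3))"
  proof -
    have "pull3 GM \<Phi>' (eta G GM B) p (X p) (Y p) (Z p) =
      1/2 * B (Ad G GM (iv (f2 p)) (lincomb 1 x1 1 y1)) (br (Ad G GM (iv (f2 p)) (lincomb 1 x2 1 y2)) (Ad G GM (iv (f2 p)) (lincomb 1 x3 1 y3)))"
      unfolding pull3_def
      by (subst eta_eq) (simp_all add: dmap_tangent[OF M gm \<Phi>'_smooth] T MC_L_fus xy_def)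
    also have "\<dots> = 1/2 * B (lincomb 1 x1 1 y1) (br (lincomb 1 x2 1 y2) (lincomb 1 x3 1 y3))"
      using x y by (simp add: Ad_br[symmetric] B_Ad br_tangent tangent_lincomb)
    also have "\<dots> = 1/2 * (B x1 (br x2 x3) + B x1 (br x2 y3) + B x1 (br y2 x3) + B x1 (br y2 y3) +
      B y1 (br x2 x3) + B y1 (br x2 y3) + B y1 (br y2 x3) + B y1 (br y2 y3))"
      using x y by (simp add: br_lincomb_left br_lincomb_right B_lincomb br_tangent tangent_lincomb)
    finally show ?thesis .
  qed
  have anti: "B u (br v w) = - B u (br w v)" "B (br v w) u = - B (br w v) u" if "u \<in> alg" "v \<in> alg" "w \<in> alg" for u v w
    using B_tscale[OF br_tangent[OF that(3,2)] that(1), of "-1"] br_anti[OF that(3,2)] by simp_all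
  \<comment> \<open>Invariance of \<open>B\<close> and antisymmetry of the bracket bring five mixed
    terms into the shape that the structure equations produce; the sixth,
    \<open>B x1 (br y2 y3)\<close>, already has it.\<close>
  have c: "B x1 (br x2 y3) = B (br x1 x2) y3" "B x1 (br y2 x3) = - B (br x1 x3) y2" "B y1 (br x2 x3) = B (br x2 x3) y1"
    "B y1 (br x2 y3) = - B x2 (br y1 y3)" "B y1 (br y2 x3) = B x3 (br y1 y2)"
    using B_br[OF x(2,1) y(3)] B_br[OF x(3,1) y(2)] anti(1)[OF x(1) y(2) x(3)] B_sym[OF y(1) br_tangent[OF x(2,3)]]
      B_br[OF x(2) y(1,3)] anti(2)[OF y(3,1) x(2)] B_br[OF y(1) x(2) y(3)]
      B_br[OF y(2,1) x(3)] B_sym[OF x(3) br_tangent[OF y(1,2)]] by simp_all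
  \<comment> \<open>The derivatives \<open>a V W\<close> and \<open>b V W\<close> enter only through
    the antisymmetric combinations treated in \<open>mc\<close>. The brackets of vector fields
    arising there cancel those in \<open>ext_d2\<close>, so that only Lie brackets remain.\<close>
  have "ext_d2 \<omega>' X Y Z p = ext_d2 \<omega> X Y Z p + 1/2 * (B (br x1 x2) y3 - B (br x1 x3) y2 + B (br x2 x3) y1) +
      1/2 * (B x1 (br y2 y3) - B x2 (br y1 y3) + B x3 (br y1 y2))"
    unfolding ext_d2_def der[OF Y Z X] der[OF X Z Y] der[OF X Y Z] \<omega>'_eq[of p]
    using mc(1)[OF X Y y(3)] mc(1)[OF X Z y(2)] mc(1)[OF Y Z y(1)]
      mc(2)[OF X Y x(3)] mc(2)[OF X Z x(2)] mc(2)[OF Y Z x(1)]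
    unfolding xy_def[symmetric] by argo
  then show "ext_d2 \<omega>' X Y Z p = pull3 GM \<Phi>' (eta G GM B) p (X p) (Y p) (Z p)"
    unfolding d\<omega> rhs c by argo
qed

section \<open>The kernel of the fused form\<close>

lemma B_zero: "w \<in> alg \<Longrightarrow> B (\<lambda>f. 0) w = 0" "w \<in> alg \<Longrightarrow> B w (\<lambda>f. 0) = 0"
  using B_lincomb[OF tangent_zero tangent_zero, of w 0 0] by (simp_all add: lincomb_def)

lemma Ad_tscale: "Ad G GM g (tscale a u) = tscale a (Ad G GM g u)"
  by (simp add: tscale_lincomb Ad_lincomb)

lemma Ad_zero: "Ad G GM g (\<lambda>f. 0) = (\<lambda>f. 0)"
  by (rule ext) (simp add: Ad_def dmap_def)

text \<open>The condition says that \<open>Ad\<close> at \<open>f2 m\<close> and \<open>Ad\<close>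
  at the inverse of \<open>f1 m\<close> have opposite values on \<open>x\<close>. Moved across
  \<open>B\<close>, this makes the left and right halves of the moment map condition cancel.\<close>

lemma fixed_kernel:
  assumes x: "x \<in> alg" and fx: "Ad G GM (\<Phi>' m) x = tscale (-1) x" and w: "w \<in> tangent M m"
  shows "\<omega>' m (A (diag_alg GM x) m) w = 0"
proof -
  let ?s = "lincomb 1 (\<alpha> m w) 1 (\<beta> m w)"
  have s: "?s \<in> alg" by (intro tangent_lincomb \<alpha>\<beta>_alg w)
  have "Ad G GM (f2 m) x = Ad G GM (iv (f1 m)) (Ad G GM (\<Phi>' m) x)" by (simp add: Ad_Ad \<Phi>'_eq)
  then have e: "Ad G GM (f2 m) x = tscale (-1) (Ad G GM (iv (f1 m)) x)" by (simp add: fx Ad_tscale)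
  have "B x (Ad G GM (iv (f2 m)) ?s) = B (Ad G GM (f2 m) x) ?s" using x s by (simp add: B_Ad_left)
  also have "\<dots> = - B x (Ad G GM (f1 m) ?s)" unfolding e using x s by (simp add: B_tscale Ad_tangent B_Ad_left)
  finally show ?thesis
    unfolding moment_fus[OF x w] MC_L_fus[OF w] MC_R_fus[OF w]
    using x s by (simp add: B_lincomb Ad_tangent)
qed

text \<open>
  If \<open>v\<close> is in the kernel of \<open>\<omega>'\<close> and \<open>s = \<alpha> v + \<beta> v\<close>, the moment map condition shows that
  \<open>z = 1/2 Ad\<^sub>b\<^sup>-\<^sup>1 s\<close> satisfies \<open>Ad\<^sub>a\<^sub>b z = - z\<close>. Subtracting the generating vector of \<open>z\<close> from \<open>v\<close>
  reduces to \<open>s = 0\<close>; then pairing with the action of the first factor gives \<open>\<alpha> v = 0\<close>, so \<open>v\<close> is in the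
  kernel of \<open>\<omega>\<close>, where the condition \<open>\<alpha> v = \<beta> v = 0\<close> forces \<open>v = 0\<close>.
\<close>

lemma kernel_fus:
  assumes v: "v \<in> tangent M m" and ker: "\<And>w. w \<in> tangent M m \<Longrightarrow> \<omega>' m v w = 0"
  obtains z where "z \<in> alg" "Ad G GM (\<Phi>' m) z = tscale (-1) z" "v = A (diag_alg GM z) m"
proof -
  define a b where "a = f1 m" and "b = f2 m"
  define s where "s = lincomb 1 (\<alpha> m v) 1 (\<beta> m v)"
  define z where "z = tscale (1/2) (Ad G GM (iv b) s)"
  have s: "s \<in> alg" unfolding s_def by (intro tangent_lincomb \<alpha>\<beta>_alg v)
  have z: "z \<in> alg" unfolding z_def by (intro tangent_tscale Ad_tangent s)
  \<comment> \<open>Evaluating the kernel condition on the generating vectors of the diagonal action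
    turns the moment map condition into orthogonality to the whole Lie algebra.\<close>
  have "lincomb (1/2) (Ad G GM (iv b) s) (1/2) (Ad G GM a s) = (\<lambda>f. 0)"
  proof (rule B_nondeg)
    show "lincomb (1/2) (Ad G GM (iv b) s) (1/2) (Ad G GM a s) \<in> alg" by (intro tangent_lincomb Ad_tangent s)
    fix x assume x: "x \<in> alg"
    note At = A_tangent[OF diag_alg[OF x], of m]
    show "B x (lincomb (1/2) (Ad G GM (iv b) s) (1/2) (Ad G GM a s)) = 0"
      using moment_fus[OF x v] \<omega>'_anti[OF At v] ker[OF At]
      unfolding MC_L_fus[OF v] MC_R_fus[OF v] a_def b_def s_def by simp
  qed
  then have "lincomb (1/2) (Ad G GM (iv b) s) (1/2) (Ad G GM a s) h = 0" for h by simp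
  then have "Ad G GM (iv b) s h = - Ad G GM a s h" for h by (simp add: lincomb_def field_simps eq_neg_iff_add_eq_0)
  then have as: "Ad G GM a s = tscale (-1) (Ad G GM (iv b) s)" "Ad G GM (iv b) s = tscale (-1) (Ad G GM a s)"
    by (auto simp: tscale_def fun_eq_iff)
  have Phi: "\<Phi>' m = a \<cdot> b" by (simp add: \<Phi>'_eq a_def b_def)
  have "Ad G GM (\<Phi>' m) z = tscale (1/2) (Ad G GM a s)"
    unfolding Phi z_def Ad_tscale Ad_Ad by simp
  then have fz: "Ad G GM (\<Phi>' m) z = tscale (-1) z"
    unfolding as(1) z_def by (simp add: tscale_def)
  have bz: "Ad G GM b z = tscale (1/2) s" unfolding z_def Ad_tscale Ad_inv(2)[OF s] ..
  have az: "Ad G GM (iv a) z = tscale (-1/2) s"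
    unfolding z_def as(2) Ad_tscale Ad_inv(1)[OF s] by (simp add: tscale_def)
  define v' where "v' = lincomb 1 v (-1) (A (diag_alg GM z) m)"
  note dz = diag_alg[OF z]
  have v': "v' \<in> tangent M m" unfolding v'_def by (intro tangent_lincomb v A_tangent dz)
  have ker': "\<omega>' m v' w = 0" if "w \<in> tangent M m" for w
    unfolding v'_def \<omega>'_lin(1)[OF v A_tangent[OF dz] that] by (simp add: ker that fixed_kernel[OF z fz])
  define x' where "x' = \<alpha> m v'"
  have x': "x' \<in> alg" unfolding x'_def by (intro \<alpha>\<beta>_alg v')
  \<comment> \<open>On the generating vector of \<open>z\<close>, the sum of \<alpha> and \<beta> is
    Ad b z - Ad a^-1 z, the bare \<open>z\<close> cancelling. The two terms are s/2 and -s/2, so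
    this is exactly \<open>s\<close>, and the sum vanishes on \<open>v'\<close>.\<close>
  have y': "\<beta> m v' = tscale (-1) x'"
    unfolding x'_def v'_def \<alpha>\<beta>_lincomb \<alpha>\<beta>_A[OF dz] d12_diag[OF z] a_def[symmetric] b_def[symmetric] az bz
    by (simp add: s_def lincomb_def tscale_def tdiff_def fun_eq_iff field_simps)
  \<comment> \<open>For \<open>inl x\<close>, \<omega> contributes half of B(x, x') + B(x, Ad a x')
    and \<open>varsigma\<close> half of B(x, x') - B(x, Ad a x'); only B(x, x') is left.\<close>
  have x'0: "x' = (\<lambda>f. 0)"
  proof (rule B_nondeg[OF x'])
    fix x assume x: "x \<in> alg"
    note i = inl[OF x]
    note At = A_tangent[OF i(1), of m]
    have "\<omega>' m (A (inl x) m) v' = 0" using \<omega>'_anti[OF At v'] ker'[OF At] by simp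
    moreover have "tdiff (\<lambda>f. 0) (\<lambda>f. 0) = (\<lambda>f :: 'g \<Rightarrow> real. 0)" by (simp add: tdiff_def)
    ultimately show "B x x' = 0"
      unfolding \<omega>'_eq moment[OF i(1) v'] \<alpha>\<beta>_A[OF i(1)] y' i(2,3) x'_def[symmetric]
      using x x' by (simp add: B_zero Ad_zero Ad_tangent tangent_tscale B_tscale B_tdiff B_Ad_left Ad_tscale)
  qed
  have y'0: "\<beta> m v' = (\<lambda>f. 0)" unfolding y' x'0 by (simp add: tscale_def)
  have "\<omega> m v' w = 0" if "w \<in> tangent M m" for w
    using ker'[OF that] \<alpha>\<beta>_alg[OF that] unfolding \<omega>'_eq y'0 x'_def[symmetric] x'0 by (simp add: B_zero)
  then have "v' \<in> {v \<in> tangent M m. \<forall>w\<in>tangent M m. \<omega> m v w = 0}" using v' by simp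
  also have "\<dots> = {A u m | u. u \<in> lie_alg (G \<times>\<times> G) PP \<and> Ad (G \<times>\<times> G) PP (\<Phi> m) u = tscale (- 1) u}"
    using q unfolding qham_lie_alg_def by blast
  finally obtain u where u: "v' = A u m" "u \<in> GG.alg" "Ad (G \<times>\<times> G) PP (\<Phi> m) u = tscale (- 1) u"
    unfolding lie_alg_def by blast
  have "d1 (Ad (G \<times>\<times> G) PP (\<Phi> m) u) = d1 (tscale (- 1) u)" "d2 (Ad (G \<times>\<times> G) PP (\<Phi> m) u) = d2 (tscale (- 1) u)"
    unfolding u(3) by simp_all
  then have Adu: "Ad G GM a (d1 u) = tscale (-1) (d1 u)" "Ad G GM b (d2 u) = tscale (-1) (d2 u)"
    unfolding d12_nat dmap_tscale a_def b_def f1_def f2_def by simp_all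
  note du = d12_alg[OF u(2)]
  \<comment> \<open>The eigenvalue -1 of \<open>Ad\<close> also holds for its inverse, so the value
    of \<alpha> on the generating vector of \<open>u\<close> is twice \<open>d1 u\<close>; it is
    zero, hence so is \<open>d1 u\<close>. In the same way \<beta> gives -2 times
    \<open>d2 u\<close>.\<close>
  have "d1 u = tscale (-1) (Ad G GM (iv a) (d1 u))"
    using Ad_inv(1)[OF du(1), of a] unfolding Adu Ad_tscale by simp
  moreover have "tdiff (d1 u) (Ad G GM (iv a) (d1 u)) = (\<lambda>f. 0)"
    using x'0 unfolding x'_def u(1) \<alpha>\<beta>_A[OF u(2)] a_def by simp
  ultimately have 1: "d1 u = (\<lambda>f. 0)"
    by (simp add: tdiff_def tscale_def fun_eq_iff)
  have "tdiff (tscale (-1) (d2 u)) (d2 u) = (\<lambda>f. 0)"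
    using y'0 unfolding u(1) \<alpha>\<beta>_A[OF u(2)] b_def[symmetric] Adu(2) .
  then have 2: "d2 u = (\<lambda>f. 0)"
    by (simp add: tdiff_def tscale_def fun_eq_iff)
  have u0: "u = (\<lambda>f. 0)" by (rule d12_eq_0[OF u(2) 1 2])
  \<comment> \<open>The action is linear, so it sends the zero vector to zero; the zero vector is
    presented as a combination with zero coefficients in order to use \<open>A_lin\<close>.\<close>
  have "lincomb 0 u 0 u = u" unfolding u0 by (simp add: lincomb_def)
  then have "A u m = lincomb 0 (A u m) 0 (A u m)" using A_lin[OF u(2,2), of 0 0 m] by simp
  then have "v' = (\<lambda>f. 0)" unfolding u(1) by (simp add: lincomb_def)
  then have "v = A (diag_alg GM z) m" by (simp add: v'_def lincomb_def fun_eq_iff)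
  with z fz show thesis by (rule that)
qed

theorem qham_fus: "qham_lie_alg G GM B M (\<lambda>x. A (diag_alg GM x)) \<omega>' \<Phi>'"
  unfolding qham_lie_alg_def lie_alg_def
proof (intro conjI ballI allI)
  fix m
  show "{v \<in> tangent M m. \<forall>w\<in>tangent M m. \<omega>' m v w = 0} =
      {A (diag_alg GM x) m |x. x \<in> alg \<and> Ad G GM (\<Phi>' m) x = tscale (- 1) x}" (is "?K = ?F")
  proof
    show "?K \<subseteq> ?F"
    proof
      fix v assume "v \<in> ?K"
      then have v: "v \<in> tangent M m" "\<And>w. w \<in> tangent M m \<Longrightarrow> \<omega>' m v w = 0" by auto
      obtain z where "z \<in> alg" "Ad G GM (\<Phi>' m) z = tscale (-1) z" "v = A (diag_alg GM z) m"
        using kernel_fus[OF v] .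
      then show "v \<in> ?F" by blast
    qed
    show "?F \<subseteq> ?K" using A_tangent[OF diag_alg] fixed_kernel by blast
  qed
qed (use M lie_alg_action_fus two_form_fus \<Phi>'_smooth equivariant_fus d_eq_fus moment_fus in auto)

end

section \<open>One-parameter subgroups\<close>

lemma line_smooth_fun: "f \<in> smooth_fun line \<longleftrightarrow> smooth_on UNIV UNIV f"
proof -
  have "f \<in> smooth_fun line \<longleftrightarrow> continuous_on UNIV f \<and> smooth_on UNIV UNIV f"
    by (simp add: smooth_fun_def smooth_map_def euclid_def o_def inv_id[unfolded id_def] id_def)
  then show ?thesis using smooth_on_continuous by blast
qed

lemma line_deriv:
  assumes "f \<in> smooth_fun line"
  shows "(f has_real_derivative deriv f t) (at t)"
proof -
  have "Ck_on UNIV UNIV (Suc 0) f" using assms smooth_onD unfolding line_smooth_fun by blast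
  then obtain A where "(f has_derivative A) (at t)" by (rule Ck_on_SucE) auto
  then show ?thesis by (auto simp: DERIV_deriv_iff_real_differentiable differentiable_def)
qed

text \<open>The coordinate derivation d/dt at \<open>t\<close>, so that velocities of curves are
  push-forwards and obey the rules for \<open>dmap\<close>.\<close>

definition line_vec :: "real \<Rightarrow> real tvec" where
  "line_vec t = (\<lambda>f. if f \<in> smooth_fun line then deriv f t else 0)"

lemma line_vec_tangent: "line_vec t \<in> tangent line t"
proof (rule tangentI)
  fix f g :: "real \<Rightarrow> real" and a b assume f: "f \<in> smooth_fun line" and g: "g \<in> smooth_fun line"
  note s = smooth_fun_const[OF smooth_manifold_euclid] smooth_fun_mult[OF smooth_manifold_euclid]
    smooth_fun_add[OF smooth_manifold_euclid]
  note D = line_deriv[OF f, of t] line_deriv[OF g, of t]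
  have "((\<lambda>x. a * f x + b * g x) has_real_derivative a * deriv f t + b * deriv g t) (at t)"
    by (rule DERIV_add[OF DERIV_cmult[OF D(1)] DERIV_cmult[OF D(2)]])
  then show "line_vec t (\<lambda>x. a * f x + b * g x) = a * line_vec t f + b * line_vec t g"
    using f g by (simp add: line_vec_def s DERIV_imp_deriv)
  have "((\<lambda>x. f x * g x) has_real_derivative f t * deriv g t + g t * deriv f t) (at t)"
    using DERIV_mult'[OF D] by (simp add: mult.commute)
  then show "line_vec t (\<lambda>x. f x * g x) = f t * line_vec t g + g t * line_vec t f"
    using f g by (simp add: line_vec_def s DERIV_imp_deriv)
qed (simp add: line_vec_def)

text \<open>For maps given piecewise, each piece coinciding near a point with a globally defined
  smooth map.\<close>

lemma smooth_map_local_eq: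
  assumes M: "smooth_manifold M" and N: "smooth_manifold N"
    and loc: "\<And>p. \<exists>T g. open T \<and> p \<in> T \<and> smooth_map M N g \<and> (\<forall>x\<in>T. f x = g x)"
  shows "smooth_map M N f"
proof (rule smooth_mapI_local[OF M N])
  fix p
  obtain T g where T: "open T" "p \<in> T" and g: "smooth_map M N g" and eq: "\<And>x. x \<in> T \<Longrightarrow> f x = g x"
    using loc[of p] by blast
  obtain U \<phi> where U: "(U, \<phi>) \<in> atlas M" "p \<in> U" using chart_cover[OF M] .
  obtain W \<psi> where W: "(W, \<psi>) \<in> atlas N" "g p \<in> W" using chart_cover[OF N] .
  define S where "S = T \<inter> U \<inter> g -` W"
  have S: "open S" "p \<in> S" "S \<subseteq> U"
    using T U W chart(1)[OF M U(1)] smooth_map_vimage_open[OF g chart(1)[OF N W(1)]] by (auto simp: S_def)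
  have "smooth_on (model M) (\<phi> ` S) (\<psi> \<circ> g \<circ> inv_into U \<phi>)"
    by (rule smooth_mapD[OF g U(1) W(1)]) (auto simp: S_def)
  then have "smooth_on (model M) (\<phi> ` S) (\<psi> \<circ> f \<circ> inv_into U \<phi>)"
    by (rule smooth_on_cong[THEN iffD1, rotated])
       (use chart_inv[OF M U(1)] eq in \<open>auto simp: S_def\<close>)
  moreover have "f ` S \<subseteq> W" using eq by (auto simp: S_def)
  ultimately show "\<exists>U \<phi> W \<psi> T. (U, \<phi>) \<in> atlas M \<and> (W, \<psi>) \<in> atlas N \<and> open T \<and> p \<in> T \<and> T \<subseteq> U \<and> f ` T \<subseteq> W \<and>
      smooth_on (model M) (\<phi> ` T) (\<psi> \<circ> f \<circ> inv_into U \<phi>)"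
    using U(1) W(1) S by blast
qed

lemma smooth_map_affine: "smooth_map line line (\<lambda>t. s + a * t)"
proof -
  have "smooth_on UNIV UNIV (\<lambda>t::real. s + a * t)"
    by (rule smooth_on_add[OF smooth_on_const smooth_on_mult[OF smooth_on_const
          smooth_on_bounded_linear[OF bounded_linear_ident]]])
  then have "(\<lambda>t. s + a * t) \<in> smooth_fun line" by (simp add: line_smooth_fun)
  then show ?thesis by (simp add: smooth_fun_def)
qed

context lie_grp
begin

abbreviation velocity where "velocity c t \<equiv> dmap GM c (line_vec t)"

lemma curve_smooth_fun: "smooth_map line GM c \<Longrightarrow> h \<in> smooth_fun GM \<Longrightarrow> (\<lambda>t. h (c t)) \<in> smooth_fun line"
  using smooth_fun_map smooth_manifold_euclid by blast

lemma velocity_apply: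
  assumes "smooth_map line GM c" "h \<in> smooth_fun GM"
  shows "velocity c t h = deriv (\<lambda>t. h (c t)) t" "((\<lambda>t. h (c t)) has_real_derivative velocity c t h) (at t)"
proof -
  show "velocity c t h = deriv (\<lambda>t. h (c t)) t"
    using curve_smooth_fun[OF assms] by (simp add: dmap_apply[OF assms(2)] line_vec_def)
  then show "((\<lambda>t. h (c t)) has_real_derivative velocity c t h) (at t)"
    using line_deriv[OF curve_smooth_fun[OF assms]] by simp
qed

lemma velocity_tangent: "smooth_map line GM c \<Longrightarrow> velocity c t \<in> tangent GM (c t)"
  by (rule dmap_tangent[OF smooth_manifold_euclid gm _ line_vec_tangent])

lemma velocity0_eq: "smooth_map line GM c \<Longrightarrow> velocity0 GM c = velocity c 0"
  using velocity_apply(1) by (auto simp: velocity0_def dmap_def fun_eq_iff)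

lemma velocity_shift:
  assumes c: "smooth_map line GM c"
  shows "velocity (\<lambda>t. c (s + t)) t = velocity c (s + t)"
proof (rule tangent_eqI)
  have sh: "smooth_map line GM (\<lambda>t. c (s + t))"
    using smooth_map_compose[OF smooth_manifold_euclid smooth_manifold_euclid gm smooth_map_affine[of s 1] c] by simp
  show "velocity (\<lambda>t. c (s + t)) t \<in> tangent GM (c (s + t))" by (rule velocity_tangent[OF sh])
  show "velocity c (s + t) \<in> tangent GM (c (s + t))" by (rule velocity_tangent[OF c])
  fix h assume h: "h \<in> smooth_fun GM"
  have "((\<lambda>t. h (c (t + s))) has_real_derivative velocity c (t + s) h) (at t)"
    using velocity_apply(2)[OF c h, of "t + s"] by (simp add: DERIV_shift)
  then show "velocity (\<lambda>t. c (s + t)) t h = velocity c (s + t) h"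
    unfolding velocity_apply(1)[OF sh h] by (simp add: DERIV_imp_deriv add.commute)
qed

lemma velocity_translate:
  assumes c: "smooth_map line GM c" and v: "velocity c t = left_inv_field G GM v (c t)"
  shows "velocity (\<lambda>t. g \<cdot> c t) t = left_inv_field G GM v (g \<cdot> c t)"
proof -
  have "dmap GM (\<lambda>x. g \<cdot> x) (velocity c t) = velocity (\<lambda>t. g \<cdot> c t) t"
    by (rule dmap_compose[OF gm gm]) (intro smooth_g)
  moreover have "dmap GM (\<lambda>x. g \<cdot> x) (left_inv_field G GM v (c t)) = left_inv_field G GM v (g \<cdot> c t)"
    by (simp add: left_inv_field_def dmap_dmap smooth_g)
  ultimately show ?thesis by (simp add: v)
qed

text \<open>The two contributions to the derivative of \<open>a t \<cdot> iv (b t)\<close> cancel by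
  \<open>inv_deriv\<close>, because \<open>v\<close> is inserted between \<open>a t\<close> and the
  inverse of \<open>b t\<close> in both; smooth functions separate points. This serves as uniqueness
  theorem for the differential equation.\<close>

lemma integral_curves_unique:
  assumes v: "v \<in> alg" and a: "smooth_map line GM a" and b: "smooth_map line GM b"
    and I: "\<And>t. t \<in> {l<..<u} \<Longrightarrow> velocity a t = left_inv_field G GM v (a t)"
      "\<And>t. t \<in> {l<..<u} \<Longrightarrow> velocity b t = left_inv_field G GM v (b t)"
    and st: "s \<in> {l<..<u}" "t \<in> {l<..<u}"
  shows "a s \<cdot> iv (b s) = a t \<cdot> iv (b t)"
proof (rule smooth_fun_separate[OF gm])
  fix h assume h: "h \<in> smooth_fun GM"
  let ?g = "\<lambda>t. h (a t \<cdot> iv (b t))"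
  have "smooth_map line GM (\<lambda>t. a t \<cdot> iv (b t))"
    by (intro smooth_mult smooth_inv smooth_manifold_euclid a b)
  then have g: "?g \<in> smooth_fun line" using curve_smooth_fun h by blast
  have "(?g has_real_derivative 0) (at t)" if t: "t \<in> {l<..<u}" for t
  proof -
    have F: "(\<lambda>z. h (a (fst z) \<cdot> iv (b (snd z)))) \<in> smooth_fun (prod_mfd line line)"
      by (intro smooth_fun_map[OF h] smooth_mult smooth_inv smooth_manifold_prod smooth_manifold_euclid smooth_fun_pair_compose gm a b)
    have 1: "(\<lambda>x. h (x \<cdot> iv (b t))) \<in> smooth_fun GM" "(\<lambda>x. h (a t \<cdot> iv x)) \<in> smooth_fun GM"
      "(\<lambda>x. h (a t \<cdot> (x \<cdot> iv (b t)))) \<in> smooth_fun GM"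
      by (intro smooth_fun_map[OF h] smooth_g)+
    have "deriv ?g t = line_vec t ?g" using g by (simp add: line_vec_def)
    also have "\<dots> = line_vec t (\<lambda>s. h (a s \<cdot> iv (b t))) + line_vec t (\<lambda>s. h (a t \<cdot> iv (b s)))"
      using tangent_diagonal_curried[where F = "\<lambda>x y. h (a x \<cdot> iv (b y))", OF smooth_manifold_euclid F line_vec_tangent] .
    also have "line_vec t (\<lambda>s. h (a s \<cdot> iv (b t))) = velocity a t (\<lambda>x. h (x \<cdot> iv (b t)))"
      by (simp add: dmap_apply[OF 1(1)])
    also have "\<dots> = v (\<lambda>x. h (a t \<cdot> (x \<cdot> iv (b t))))"
      unfolding I(1)[OF t] left_apply[OF 1(1)] by simp
    also have "line_vec t (\<lambda>s. h (a t \<cdot> iv (b s))) = velocity b t (\<lambda>x. h (a t \<cdot> iv x))"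
      by (simp add: dmap_apply[OF 1(2)])
    also have "\<dots> = v (\<lambda>x. h (a t \<cdot> (iv x \<cdot> iv (b t))))"
      unfolding I(2)[OF t] left_apply[OF 1(2)] by simp
    also have "\<dots> = - v (\<lambda>x. h (a t \<cdot> (x \<cdot> iv (b t))))"
      by (rule inv_deriv[OF v 1(3)])
    finally have "deriv ?g t = 0" by simp
    then show ?thesis using line_deriv[OF g, of t] by simp
  qed
  then show "h (a s \<cdot> iv (b s)) = h (a t \<cdot> iv (b t))"
    using st by (intro DERIV_isconst3[of l u s t ?g]) auto
qed

lemma one_param_subgroup_unit:
  assumes "one_param_subgroup G GM \<gamma>"
  shows "\<gamma> 0 = unit"
proof -
  have "\<gamma> (0 + 0) = \<gamma> 0 \<cdot> \<gamma> 0" using assms unfolding one_param_subgroup_def by blast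
  then show ?thesis using g_simps(6)[of "\<gamma> 0" "\<gamma> 0"] by simp
qed

text \<open>Obtained by differentiating the product \<gamma> t \<cdot> \<gamma> s in
  \<open>s\<close> at 0.\<close>

lemma one_param_subgroup_velocity:
  assumes \<gamma>: "one_param_subgroup G GM \<gamma>"
  shows "velocity \<gamma> t = left_inv_field G GM (velocity0 GM \<gamma>) (\<gamma> t)"
proof -
  have sm: "smooth_map line GM \<gamma>" and hom: "\<And>s t. \<gamma> (s + t) = \<gamma> s \<cdot> \<gamma> t"
    using \<gamma> by (auto simp: one_param_subgroup_def)
  have "velocity \<gamma> t = velocity (\<lambda>s. \<gamma> (t + s)) 0" using velocity_shift[OF sm, of t 0] by simp
  also have "\<dots> = velocity (\<lambda>s. \<gamma> t \<cdot> \<gamma> s) 0" by (simp add: hom)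
  also have "\<dots> = dmap GM (\<lambda>x. \<gamma> t \<cdot> x) (velocity \<gamma> 0)"
    by (rule dmap_compose[OF gm gm, symmetric]) (intro smooth_g)
  finally show ?thesis by (simp add: velocity0_eq[OF sm] left_inv_field_def)
qed

lemma one_param_subgroup_unique:
  assumes \<gamma>: "one_param_subgroup G GM \<gamma>" and \<delta>: "one_param_subgroup G GM \<delta>"
    and eq: "velocity0 GM \<gamma> = velocity0 GM \<delta>"
  shows "\<gamma> = \<delta>"
proof
  fix t
  have sm: "smooth_map line GM \<gamma>" "smooth_map line GM \<delta>"
    using \<gamma> \<delta> by (auto simp: one_param_subgroup_def)
  have v: "velocity0 GM \<gamma> \<in> alg"
    using velocity_tangent[OF sm(1), of 0] velocity0_eq[OF sm(1)] one_param_subgroup_unit[OF \<gamma>] by simp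
  have "\<gamma> t \<cdot> iv (\<delta> t) = \<gamma> 0 \<cdot> iv (\<delta> 0)"
    by (rule integral_curves_unique[OF v sm, where l = "-\<bar>t\<bar> - 1" and u = "\<bar>t\<bar> + 1"])
       (auto simp: one_param_subgroup_velocity[OF \<gamma>] one_param_subgroup_velocity[OF \<delta>] eq)
  then have "\<gamma> t \<cdot> iv (\<delta> t) \<cdot> \<delta> t = \<delta> t" by (simp only: one_param_subgroup_unit[OF \<gamma>] one_param_subgroup_unit[OF \<delta>] g_simps)
  then show "\<gamma> t = \<delta> t" by simp
qed

text \<open>The differential equation is solved in a chart at the unit. A smooth map on the line has
  to be defined everywhere, so the solution is reparametrised to a total curve that is an integral
  curve only near 0.\<close>

lemma local_integral_curve:
  assumes v: "v \<in> alg"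
  obtains c r where "r > 0" "smooth_map line GM c" "c 0 = unit"
    "\<forall>t\<in>{-r<..<r}. velocity c t = left_inv_field G GM v (c t)"
proof -
  obtain U \<phi> where U: "(U, \<phi>) \<in> atlas GM" "unit \<in> U" using chart_cover[OF gm] .
  obtain T x where pT: "unit \<in> T" and co: "coords GM U \<phi> T x" using local_coordinates[OF gm U] .
  note T = coordsD(1)[OF co] pT coordsD(2)[OF co]
  let ?V = "model GM"
  have V: "subspace ?V" by (rule manifold_model[OF gm])
  have ro: "relopen ?V (\<phi> ` T)" by (rule chart_image_relopen[OF gm U(1) T(1,3)])
  \<comment> \<open>The left-invariant field in the chart; its components are its values on the
    coordinate functions.\<close>
  define F where "F y = (\<Sum>b\<in>onb ?V. ((\<lambda>g. left_inv_field G GM v g (x b)) \<circ> inv_into U \<phi>) y *\<^sub>R b)" for y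
  have F: "smooth_on ?V (\<phi> ` T) F"
    unfolding F_def
  proof (intro smooth_on_sum smooth_on_scaleR smooth_on_const)
    fix b assume "b \<in> onb ?V"
    then have "(\<lambda>g. left_inv_field G GM v g (x b)) \<in> smooth_fun GM"
      using vector_fieldsD(2)[OF left_vf[OF v]] coordsD(3)[OF co] by blast
    from smooth_funD[OF this U(1)]
    show "smooth_on ?V (\<phi> ` T) ((\<lambda>g. left_inv_field G GM v g (x b)) \<circ> inv_into U \<phi>)"
      by (rule smooth_on_subset) (use T(3) in auto)
  qed
  have FV: "F y \<in> ?V" for y
    unfolding F_def using onb(1)[OF V] by (intro subspace_sum[OF V] subspace_scale[OF V]) auto
  have Fb: "F y \<bullet> b = left_inv_field G GM v (inv_into U \<phi> y) (x b)" if "b \<in> onb ?V" for y b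
    using that onb(2)[OF V] onb_inner[OF V _ that]
    by (simp add: F_def inner_sum_left if_distrib[of "\<lambda>z. _ * z"] cong: if_cong)
  obtain \<tau> u where \<tau>: "\<tau> > 0" and u: "smooth_on UNIV {-\<tau><..<\<tau>} u" "u ` {-\<tau><..<\<tau>} \<subseteq> \<phi> ` T"
    and u': "\<And>t. t \<in> {-\<tau><..<\<tau>} \<Longrightarrow> (u has_vector_derivative F (u t)) (at t)"
  proof (rule integral_curve_exists[OF ro F _ imageI[OF T(2)]])
    show "F ` \<phi> ` T \<subseteq> ?V" using FV by auto
  qed (rule that)
  define r where "r = \<tau> / 3"
  \<comment> \<open>A smooth time change with values in the interval of existence that is the
    identity up to \<open>r\<close>. The cutoff vanishes beyond \<open>2 * r\<close>, which is less
    than \<tau> by the choice of \<open>r\<close>.\<close>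
  define \<theta> where "\<theta> t = t * bump 0 r t" for t :: real
  have r: "r > 0" using \<tau> by (simp add: r_def)
  have \<theta>I: "\<theta> t \<in> {-\<tau><..<\<tau>}" for t
  proof (cases "\<bar>t\<bar> < 2 * r")
    case True
    have "0 \<le> bump 0 r t" "bump 0 r t \<le> 1"
      using bump_denominator_pos[OF r, of "(norm (t - 0))\<^sup>2"] flat_nonneg[of 0]
      by (auto simp: bump_def divide_inverse[symmetric])
    then have "\<bar>\<theta> t\<bar> \<le> \<bar>t\<bar> * 1" unfolding \<theta>_def abs_mult by (intro mult_left_mono) auto
    then show ?thesis using True \<tau> by (auto simp: r_def)
  next
    case False
    then show ?thesis using bump_eq_0[OF r, of t 0] \<tau> by (simp add: \<theta>_def)
  qed
  have \<theta>1: "\<theta> t = t" if "\<bar>t\<bar> \<le> r" for t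
    using bump_eq_1[OF r, of t 0] that by (simp add: \<theta>_def)
  have \<theta>s: "smooth_on UNIV UNIV \<theta>"
    unfolding \<theta>_def by (intro smooth_on_mult smooth_on_bounded_linear bounded_linear_ident smooth_on_bump r relopen_UNIV open_UNIV)
  have us: "smooth_on UNIV UNIV (\<lambda>t. u (\<theta> t))"
    by (rule smooth_on_compose[OF relopen_UNIV[OF open_UNIV] subspace_UNIV subset_UNIV _ \<theta>s u(1)]) (use \<theta>I in auto)
  define c where "c t = inv_into U \<phi> (u (\<theta> t))" for t
  have uT: "u (\<theta> t) \<in> \<phi> ` T" for t using u(2) \<theta>I by blast
  have cT: "c t \<in> T" and \<phi>c: "\<phi> (c t) = u (\<theta> t)" for t
  proof -
    obtain q where q: "q \<in> T" "u (\<theta> t) = \<phi> q" using uT by blast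
    then have "c t = q" using chart_inv[OF gm U(1)] T(3) by (auto simp: c_def)
    then show "c t \<in> T" "\<phi> (c t) = u (\<theta> t)" using q by auto
  qed
  have c: "smooth_map line GM c"
  proof (rule smooth_mapI_local[OF smooth_manifold_euclid gm])
    fix p
    have "smooth_on (model line) (id ` UNIV) (\<phi> \<circ> c \<circ> inv_into UNIV id)"
      using us by (simp add: euclid_def o_def \<phi>c)
    moreover have "c ` UNIV \<subseteq> U" using cT T(3) by auto
    ultimately show "\<exists>U \<phi> W \<psi> T. (U, \<phi>) \<in> atlas line \<and> (W, \<psi>) \<in> atlas GM \<and> open T \<and> p \<in> T \<and> T \<subseteq> U \<and> c ` T \<subseteq> W \<and>
        smooth_on (model line) (\<phi> ` T) (\<psi> \<circ> c \<circ> inv_into U \<phi>)"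
      using U(1) by (intro exI[of _ UNIV] exI[of _ id] exI[of _ U] exI[of _ \<phi>]) (auto simp: euclid_def)
  qed
  have vel: "velocity c t = left_inv_field G GM v (c t)" if t: "t \<in> {-r<..<r}" for t
  proof (rule tangent_eqI[OF velocity_tangent[OF c] left_tangent[OF v]])
    fix h assume h: "h \<in> smooth_fun GM"
    let ?h = "h \<circ> inv_into U \<phi>"
    have t': "t \<in> {-\<tau><..<\<tau>}" "\<bar>t\<bar> \<le> r" using t r by (auto simp: r_def)
    have sh: "smooth_on ?V (\<phi> ` T) ?h"
      by (rule smooth_on_subset[OF smooth_funD[OF h U(1)]]) (use T(3) in auto)
    have ut: "u t = \<phi> (c t)" using \<phi>c[of t] \<theta>1[OF t'(2)] by simp
    have im: "u ` {-r<..<r} \<subseteq> \<phi> ` T"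
    proof -
      have "{-r<..<r} \<subseteq> {-\<tau><..<\<tau>}" using \<tau> by (auto simp: r_def)
      then show ?thesis using u(2) by blast
    qed
    have utT: "u t \<in> \<phi> ` T" using ut cT by auto
    have d1: "(u has_derivative (\<lambda>s. s *\<^sub>R F (u t))) (at t within {-r<..<r})"
      using u'[OF t'(1)] unfolding has_vector_derivative_def by (rule has_derivative_at_withinI)
    have d2: "(?h has_derivative (\<lambda>w. \<Sum>b\<in>onb ?V. (w \<bullet> b) *\<^sub>R dir_deriv ?h (u t) b)) (at (u t) within u ` {-r<..<r})"
      by (rule has_derivative_subset[OF dir_deriv_linear(1)[OF ro utT sh] im])
    have "((\<lambda>s. ?h (u s)) has_derivative (\<lambda>s. \<Sum>b\<in>onb ?V. ((s *\<^sub>R F (u t)) \<bullet> b) *\<^sub>R dir_deriv ?h (u t) b)) (at t within {-r<..<r})"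
      by (rule has_derivative_in_compose[OF d1 d2])
    moreover have "(\<lambda>s. \<Sum>b\<in>onb ?V. ((s *\<^sub>R F (u t)) \<bullet> b) *\<^sub>R dir_deriv ?h (u t) b) = (*) (\<Sum>b\<in>onb ?V. (F (u t) \<bullet> b) * dir_deriv ?h (u t) b)"
      by (simp add: fun_eq_iff sum_distrib_left sum_distrib_right mult.assoc mult.commute mult.left_commute)
    moreover have "at t within {-r<..<r} = at t" using t by (intro at_within_open) auto
    ultimately have "((\<lambda>s. ?h (u s)) has_real_derivative (\<Sum>b\<in>onb ?V. (F (u t) \<bullet> b) * dir_deriv ?h (u t) b)) (at t)"
      by (simp add: has_field_derivative_def)
    then have "((\<lambda>s. h (c s)) has_real_derivative (\<Sum>b\<in>onb ?V. (F (u t) \<bullet> b) * dir_deriv ?h (u t) b)) (at t)"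
      by (rule has_field_derivative_transform_within_open[where S = "{-r<..<r}"])
         (use t \<theta>1 in \<open>auto simp: c_def\<close>)
    then have "velocity c t h = (\<Sum>b\<in>onb ?V. (F (u t) \<bullet> b) * dir_deriv ?h (u t) b)"
      unfolding velocity_apply(1)[OF c h] by (rule DERIV_imp_deriv)
    also have "\<dots> = (\<Sum>b\<in>onb ?V. left_inv_field G GM v (c t) (x b) * dir_deriv ?h (\<phi> (c t)) b)"
    proof (rule sum.cong[OF refl])
      fix b assume b: "b \<in> onb ?V"
      have "inv_into U \<phi> (u t) = c t" using \<theta>1[OF t'(2)] by (simp add: c_def)
      then show "F (u t) \<bullet> b * dir_deriv ?h (u t) b = left_inv_field G GM v (c t) (x b) * dir_deriv ?h (\<phi> (c t)) b"
        by (simp add: Fb[OF b] ut)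
    qed
    also have "\<dots> = left_inv_field G GM v (c t) h"
      using coordsD(4)[OF co cT left_tangent[OF v] h] by simp
    finally show "velocity c t h = left_inv_field G GM v (c t) h" .
  qed
  show thesis
  \<comment> \<open>The solution of the differential equation has no prescribed value at time 0.
    Left translation preserves integral curves of a left-invariant field and moves that value to the
    unit.\<close>
  proof (rule that[of r "\<lambda>t. iv (c 0) \<cdot> c t"])
    show "smooth_map line GM (\<lambda>t. iv (c 0) \<cdot> c t)"
      by (intro smooth_mult smooth_map_const smooth_manifold_euclid gm c)
    show "\<forall>t\<in>{-r<..<r}. velocity (\<lambda>t. iv (c 0) \<cdot> c t) t = left_inv_field G GM v (iv (c 0) \<cdot> c t)"
      using velocity_translate[OF c vel] by blast
  qed (use r in auto)
qed

abbreviation pw :: "nat \<Rightarrow> 'g \<Rightarrow> 'g" where "pw n g \<equiv> g [^]\<^bsub>G\<^esub> n"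

lemma pw_mult: "pw n (pw m g) = pw (m * n) g"
  and pw_distrib: "x \<cdot> y = y \<cdot> x \<Longrightarrow> pw n (x \<cdot> y) = pw n x \<cdot> pw n y"
proof -
  interpret group G by (rule grp)
  show "pw n (pw m g) = pw (m * n) g" using nat_pow_pow grp(2) by simp
  show "x \<cdot> y = y \<cdot> x \<Longrightarrow> pw n (x \<cdot> y) = pw n x \<cdot> pw n y" using pow_mult_distrib grp(2) by simp
qed

lemma smooth_pw: "smooth_manifold M \<Longrightarrow> smooth_map M GM f \<Longrightarrow> smooth_map M GM (\<lambda>x. pw n (f x))"
  by (induction n) (simp_all add: smooth_map_const gm smooth_mult)

text \<open>An integral curve is a homomorphism near \<open>0\<close>; powers extend it to the whole line.\<close>

lemma one_param_subgroup_exists: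
  assumes v: "v \<in> alg"
  obtains \<gamma> where "one_param_subgroup G GM \<gamma>" "velocity0 GM \<gamma> = v"
proof -
  obtain c r where r: "r > 0" and c: "smooth_map line GM c" and c0: "c 0 = unit"
    and vel: "\<forall>t\<in>{-r<..<r}. velocity c t = left_inv_field G GM v (c t)"
    using local_integral_curve[OF v] .
  \<comment> \<open>With both parameters below \<open>e\<close>, their sum stays in the interval
    where \<open>c\<close> is an integral curve.\<close>
  define e where "e = r / 2"
  have e: "e > 0" using r by (simp add: e_def)
  have hom: "c (s + t) = c s \<cdot> c t" if st: "\<bar>s\<bar> < e" "\<bar>t\<bar> < e" for s t
  proof -
    have sh: "smooth_map line GM (\<lambda>t. c (s + t))"
      using smooth_map_compose[OF smooth_manifold_euclid smooth_manifold_euclid gm smooth_map_affine[of s 1] c] by simp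
    have tr: "smooth_map line GM (\<lambda>t. c s \<cdot> c t)"
      by (intro smooth_mult smooth_map_const smooth_manifold_euclid gm c)
    \<comment> \<open>As functions of \<open>t\<close>, both \<open>c (s + t)\<close> and
      \<open>c s \<cdot> c t\<close> are integral curves of the same field, and they agree at
      0.\<close>
    have "c (s + t) \<cdot> iv (c s \<cdot> c t) = c (s + 0) \<cdot> iv (c s \<cdot> c 0)"
    proof (rule integral_curves_unique[OF v sh tr, where l = "-e" and u = e])
      fix t assume t: "t \<in> {-e<..<e}"
      have "s + t \<in> {-r<..<r}" "t \<in> {-r<..<r}" using t st by (auto simp: e_def)
      then show "velocity (\<lambda>t. c (s + t)) t = left_inv_field G GM v (c (s + t))"
        "velocity (\<lambda>t. c s \<cdot> c t) t = left_inv_field G GM v (c s \<cdot> c t)"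
        using vel velocity_shift[OF c] velocity_translate[OF c] by auto
    qed (use st e in auto)
    then have "c (s + t) \<cdot> iv (c s \<cdot> c t) \<cdot> (c s \<cdot> c t) = c s \<cdot> c t" by (simp add: c0)
    then show ?thesis by simp
  qed
  have mul: "c (real n * s) = pw n (c s)" if "\<bar>real n * s\<bar> < e" for n s
    using that
  proof (induction n)
    case 0 then show ?case by (simp add: c0)
  next
    case (Suc n)
    have le: "real n * \<bar>s\<bar> \<le> real (Suc n) * \<bar>s\<bar>" "1 * \<bar>s\<bar> \<le> real (Suc n) * \<bar>s\<bar>" by (intro mult_right_mono; simp)+
    have small: "\<bar>real n * s\<bar> < e" "\<bar>s\<bar> < e" using le Suc.prems by (auto simp: abs_mult)
    have "c (real (Suc n) * s) = c (real n * s + s)" by (simp add: algebra_simps)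
    also have "\<dots> = c (real n * s) \<cdot> c s" by (rule hom[OF small])
    finally show ?case using Suc.IH[OF small(1)] by simp
  qed
  \<comment> \<open>Enough equal parts to bring \<open>t\<close> into the domain of the local
    homomorphism; the summand 1 makes the bound strict and \<open>N t\<close> positive.\<close>
  define N where "N t = nat \<lceil>\<bar>t\<bar> / e\<rceil> + 1" for t
  define \<gamma> where "\<gamma> t = pw (N t) (c (t / real (N t)))" for t
  have N: "N t \<ge> 1" "\<bar>t\<bar> / real (N t) < e" for t
  proof -
    have "\<bar>t\<bar> / e < real (N t)" unfolding N_def by linarith
    moreover have "0 < real (N t)" by (simp add: N_def)
    ultimately show "\<bar>t\<bar> / real (N t) < e" using e by (simp add: pos_divide_less_eq mult.commute)
  qed (simp add: N_def)
  have eq: "\<gamma> t = pw n (c (t / real n))" if n: "n \<ge> 1" "\<bar>t\<bar> / real n < e" for t n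
  proof -
    \<comment> \<open>Two subdivisions are compared through their common refinement into
      \<open>m * k\<close> parts, so that the power does not depend on the subdivision.\<close>
    have half: "pw k (c (t / real k)) = pw (m * k) (c (t / (real k * real m)))" if "k \<ge> 1" "m \<ge> 1" "\<bar>t\<bar> / real k < e" for k m
    proof -
      have "real m * (t / (real k * real m)) = t / real k" using that by (simp add: field_simps)
      then have "c (t / real k) = pw m (c (t / (real k * real m)))"
        using mul[of m "t / (real k * real m)"] that by (simp add: abs_divide)
      then show ?thesis by (simp add: pw_mult)
    qed
    show ?thesis
      unfolding \<gamma>_def using half[OF N(1) n(1) N(2)] half[OF n(1) N(1) n(2)] by (simp add: mult.commute)
  qed
  have small: "\<bar>s\<bar> / real n < e" if "\<bar>s\<bar> \<le> t" "n = N t" for s t n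
  proof -
    have "\<bar>s\<bar> / real n \<le> \<bar>t\<bar> / real n" using that by (intro divide_right_mono) auto
    then show ?thesis using N(2)[of t] that(2) by simp
  qed
  have \<gamma>hom: "\<gamma> (s + t) = \<gamma> s \<cdot> \<gamma> t" for s t
  proof -
    \<comment> \<open>One subdivision fine enough for \<open>s\<close>, \<open>t\<close> and their
      sum simultaneously.\<close>
    define n where "n = N (\<bar>s\<bar> + \<bar>t\<bar>)"
    have n: "n \<ge> 1" "\<bar>s\<bar> / real n < e" "\<bar>t\<bar> / real n < e" "\<bar>s + t\<bar> / real n < e"
      using small[OF _ n_def] N(1) by (auto simp: n_def)
    let ?x = "c (s / real n)" and ?y = "c (t / real n)"
    have sn: "\<bar>s / real n\<bar> < e" "\<bar>t / real n\<bar> < e" using n by (auto simp: abs_divide)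
    \<comment> \<open>Both products equal \<open>c\<close> at the same sum. Only because the factors
      commute does the power of the product split.\<close>
    have xy: "?x \<cdot> ?y = ?y \<cdot> ?x" using hom[OF sn] hom[OF sn(2,1)] by (simp add: add.commute)
    have "\<gamma> (s + t) = pw n (c (s / real n + t / real n))" using eq[OF n(1,4)] by (simp add: add_divide_distrib)
    also have "\<dots> = pw n (?x \<cdot> ?y)" by (simp add: hom[OF sn])
    also have "\<dots> = \<gamma> s \<cdot> \<gamma> t" by (simp add: pw_distrib[OF xy] eq[OF n(1,2)] eq[OF n(1,3)])
    finally show ?thesis .
  qed
  have \<gamma>s: "smooth_map line GM \<gamma>"
  proof (rule smooth_map_local_eq[OF smooth_manifold_euclid gm])
    fix p :: real
    \<comment> \<open>This number of parts serves the whole ball of radius 1 about \<open>p\<close>,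
      so near \<open>p\<close> the map is a fixed power of a rescaled \<open>c\<close>, hence
      smooth.\<close>
    define n where "n = N (\<bar>p\<bar> + 1)"
    have "smooth_map line GM (\<lambda>t. c (0 + (1 / real n) * t))"
      by (rule smooth_map_compose[OF smooth_manifold_euclid smooth_manifold_euclid gm smooth_map_affine c])
    then have "smooth_map line GM (\<lambda>t. pw n (c (t / real n)))"
      using smooth_pw[OF smooth_manifold_euclid] by fastforce
    moreover have "\<gamma> t = pw n (c (t / real n))" if "t \<in> ball p 1" for t
      using that N(1) small[OF _ n_def, of t] by (intro eq) (auto simp: n_def dist_real_def)
    ultimately show "\<exists>T g. open T \<and> p \<in> T \<and> smooth_map line GM g \<and> (\<forall>x\<in>T. \<gamma> x = g x)"
      by (intro exI[of _ "ball p 1"]) auto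
  qed
  have "velocity0 GM \<gamma> = v"
    unfolding velocity0_eq[OF \<gamma>s]
  proof (rule tangent_eqI[OF velocity_tangent[OF \<gamma>s] v])
    fix h assume h: "h \<in> smooth_fun GM"
    have "((\<lambda>t. h (\<gamma> t)) has_real_derivative velocity c 0 h) (at 0)"
    proof (rule has_field_derivative_transform_within_open[OF velocity_apply(2)[OF c h]])
      show "h (c t) = h (\<gamma> t)" if "t \<in> {-e<..<e}" for t using eq[of 1 t] that by auto
    qed (use e in auto)
    then have "velocity \<gamma> 0 h = velocity c 0 h"
      unfolding velocity_apply(1)[OF \<gamma>s h] by (rule DERIV_imp_deriv)
    also have "\<dots> = v h" using vel r h by (simp add: c0 left_apply)
    finally show "velocity \<gamma> 0 h = v h" .
  qed
  with \<gamma>s \<gamma>hom show thesis by (intro that[of \<gamma>]) (auto simp: one_param_subgroup_def)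
qed

lemma lie_exp_eq:
  assumes "one_param_subgroup G GM \<gamma>"
  shows "lie_exp G GM (velocity0 GM \<gamma>) = \<gamma> 1"
proof -
  have "(THE \<delta>. one_param_subgroup G GM \<delta> \<and> velocity0 GM \<delta> = velocity0 GM \<gamma>) = \<gamma>"
    using assms one_param_subgroup_unique by blast
  then show ?thesis by (simp add: lie_exp_def)
qed

text \<open>The diagonal of a one-parameter subgroup with velocity \<open>v\<close> is one with
  velocity \<open>diag_alg GM v\<close>; uniqueness in both groups then identifies the definite
  descriptions.\<close>

lemma lie_exp_diag:
  assumes v: "v \<in> alg"
  shows "lie_exp (G \<times>\<times> G) (prod_mfd GM GM) (diag_alg GM v) = (lie_exp G GM v, lie_exp G GM v)"
proof -
  interpret GG: lie_grp "G \<times>\<times> G" "prod_mfd GM GM"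
    by standard (rule lie_group_DirProd[OF lie lie])
  obtain \<gamma> where \<gamma>: "one_param_subgroup G GM \<gamma>" "velocity0 GM \<gamma> = v"
    using one_param_subgroup_exists[OF v] .
  have sm: "smooth_map line GM \<gamma>" using \<gamma> by (simp add: one_param_subgroup_def)
  have d: "smooth_map GM (prod_mfd GM GM) (\<lambda>g. (g, g))" by (intro smooth_map_Pair smooth_g)
  have "smooth_map line (prod_mfd GM GM) (\<lambda>t. (\<gamma> t, \<gamma> t))"
    by (intro smooth_map_Pair smooth_manifold_euclid gm sm)
  then have 1: "one_param_subgroup (G \<times>\<times> G) (prod_mfd GM GM) (\<lambda>t. (\<gamma> t, \<gamma> t))"
    using \<gamma>(1) by (auto simp: one_param_subgroup_def)
  have "velocity0 (prod_mfd GM GM) (\<lambda>t. (\<gamma> t, \<gamma> t)) h = diag_alg GM v h" for h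
    using smooth_fun_compose[OF gm gg d, of h] by (auto simp: velocity0_def diag_alg_def dmap_def o_def \<gamma>(2)[symmetric])
  then have "velocity0 (prod_mfd GM GM) (\<lambda>t. (\<gamma> t, \<gamma> t)) = diag_alg GM v" by (rule ext)
  then show ?thesis using GG.lie_exp_eq[OF 1] lie_exp_eq[OF \<gamma>(1)] \<gamma>(2) by simp
qed

end

section \<open>Fusion of group actions\<close>

text \<open>Two actions that agree on the Lie algebra may differ as total functions. The Lie algebra
  is closed under \<open>lincomb\<close> and the bracket, so every clause evaluates the action only
  where both agree.\<close>

lemma qham_lie_alg_cong:
  assumes L: "lie_group G GM" and q: "qham_lie_alg G GM B M A \<omega> \<Phi>" and eq: "\<And>x. x \<in> lie_alg G GM \<Longrightarrow> A' x = A x"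
  shows "qham_lie_alg G GM B M A' \<omega> \<Phi>"
proof -
  interpret lie_grp G GM by standard fact
  have eq': "A' x = A x" if "x \<in> alg" for x using eq that by (simp add: lie_alg_def)
  have "lie_alg_action G GM M A'"
    using q eq' tangent_lincomb[of _ GM unit] br_tangent
    unfolding qham_lie_alg_def lie_alg_action_def lie_alg_def by simp
  moreover have "{A' x m |x. x \<in> lie_alg G GM \<and> P x} = {A x m |x. x \<in> lie_alg G GM \<and> P x}" for m P
    using eq by (metis (no_types, lifting))
  ultimately show ?thesis using q eq unfolding qham_lie_alg_def by simp
qed

locale group_fusion = fusion G GM B M "induced (G \<times>\<times> G) (prod_mfd GM GM) M \<rho>" \<omega> \<Phi>
  for G :: "'g::{t2_space,second_countable_topology} monoid" and GM :: "('g, 'e::euclidean_space) mfd"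
    and B :: "'g tvec \<Rightarrow> 'g tvec \<Rightarrow> real"
    and M :: "('m::{t2_space,second_countable_topology}, 'd::euclidean_space) mfd"
    and \<rho> :: "'g \<times> 'g \<Rightarrow> 'm \<Rightarrow> 'm" and \<omega> :: "'m form2" and \<Phi> :: "'m \<Rightarrow> 'g \<times> 'g" +
  assumes qG: "qham_group (G \<times>\<times> G) (prod_mfd GM GM) (sum_form GM B) M \<rho> \<omega> \<Phi>"
begin

lemma \<rho>_smooth: "smooth_map (prod_mfd PP M) M (\<lambda>z. \<rho> (fst z) (snd z))"
  using qG by (simp add: qham_group_def lie_group_action_def case_prod_beta')

lemma action_fus: "lie_group_action G GM M (\<lambda>g. \<rho> (g, g))"
proof -
  have act: "\<rho> (unit, unit) m = m" "\<rho> (a \<cdot> b, a \<cdot> b) m = \<rho> (a, a) (\<rho> (b, b) m)" for a b m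
    using qG by (simp_all add: qham_group_def lie_group_action_def)
  have "smooth_map (prod_mfd GM M) (prod_mfd PP M) (\<lambda>z. ((fst z, fst z), snd z))"
    by (intro smooth_map_Pair smooth_manifold_prod gm M smooth_map_fst)
  from smooth_map_compose[OF smooth_manifold_prod[OF gm M] smooth_manifold_prod[OF gg M] M this \<rho>_smooth]
  show ?thesis
    using act by (simp add: lie_group_action_def case_prod_beta')
qed

lemma f12_\<rho>: "f1 (\<rho> (g, g) m) = g \<cdot> (f1 m \<cdot> iv g)" "f2 (\<rho> (g, g) m) = g \<cdot> (f2 m \<cdot> iv g)"
proof -
  have "\<Phi> (\<rho> (g, g) m) = (g, g) \<otimes>\<^bsub>G \<times>\<times> G\<^esub> \<Phi> m \<otimes>\<^bsub>G \<times>\<times> G\<^esub> inv\<^bsub>G \<times>\<times> G\<^esub> (g, g)"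
    using qG by (simp add: qham_group_def)
  moreover have "inv\<^bsub>G \<times>\<times> G\<^esub> (g, g) = (iv g, iv g)" using grp by (simp add: inv_DirProd)
  ultimately have "\<Phi> (\<rho> (g, g) m) = (g \<cdot> (f1 m \<cdot> iv g), g \<cdot> (f2 m \<cdot> iv g))"
    by (cases "\<Phi> m") (simp add: f1_def f2_def)
  then show "f1 (\<rho> (g, g) m) = g \<cdot> (f1 m \<cdot> iv g)" "f2 (\<rho> (g, g) m) = g \<cdot> (f2 m \<cdot> iv g)"
    by (simp_all add: f1_def f2_def)
qed

text \<open>Under conjugation of the group by \<open>g\<close> both Maurer--Cartan forms transform
  by \<open>Ad\<close> at \<open>g\<close>. By invariance of \<open>B\<close>, the term added to
  \<omega> is then invariant under the diagonal action.\<close>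

lemma MC_conj:
  assumes f: "smooth_map M GM f" and conj: "\<And>m. f (\<rho> k m) = g \<cdot> (f m \<cdot> iv g)"
  shows "MC_L G GM (f (\<rho> k m)) (dmap GM f (dmap M (\<rho> k) v)) = Ad G GM g (MC_L G GM (f m) (dmap GM f v))"
    and "MC_R G GM (f (\<rho> k m)) (dmap GM f (dmap M (\<rho> k) v)) = Ad G GM g (MC_R G GM (f m) (dmap GM f v))"
proof -
  have c: "smooth_map GM GM (\<lambda>x. g \<cdot> (x \<cdot> iv g))" by (intro smooth_g)
  have "dmap GM f (dmap M (\<rho> k) v) = dmap GM (\<lambda>m. g \<cdot> (f m \<cdot> iv g)) v"
    by (simp add: dmap_compose[OF M gm f] conj)
  also have "\<dots> = dmap GM (\<lambda>x. g \<cdot> (x \<cdot> iv g)) (dmap GM f v)" by (simp add: dmap_dmap[OF c])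
  finally have d: "dmap GM f (dmap M (\<rho> k) v) = dmap GM (\<lambda>x. g \<cdot> (x \<cdot> iv g)) (dmap GM f v)" .
  show "MC_L G GM (f (\<rho> k m)) (dmap GM f (dmap M (\<rho> k) v)) = Ad G GM g (MC_L G GM (f m) (dmap GM f v))"
    "MC_R G GM (f (\<rho> k m)) (dmap GM f (dmap M (\<rho> k) v)) = Ad G GM g (MC_R G GM (f m) (dmap GM f v))"
    unfolding d conj MC_L_def MC_R_def Ad_def by (simp_all add: dmap_dmap smooth_g)
qed

lemma \<omega>'_invariant:
  assumes "u \<in> tangent M m" "v \<in> tangent M m"
  shows "pull2 M (\<rho> (g, g)) \<omega>' m u v = \<omega>' m u v"
proof -
  have "pull2 M (\<rho> (g, g)) \<omega> m u v = \<omega> m u v" using qG assms by (simp add: qham_group_def)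
  moreover have "\<alpha> (\<rho> (g, g) m) (dmap M (\<rho> (g, g)) w) = Ad G GM g (\<alpha> m w)"
    "\<beta> (\<rho> (g, g) m) (dmap M (\<rho> (g, g)) w) = Ad G GM g (\<beta> m w)" for w
    unfolding \<alpha>_def \<beta>_def by (rule MC_conj[OF f12(1) f12_\<rho>(1)], rule MC_conj[OF f12(2) f12_\<rho>(2)])
  ultimately show ?thesis
    by (simp add: pull2_def \<omega>'_eq B_Ad \<alpha>\<beta>_alg[OF assms(1)] \<alpha>\<beta>_alg[OF assms(2)])
qed

text \<open>Scaling commutes with the diagonal, so \<open>lie_exp_diag\<close> applies at every time
  and the curves defining the two vector fields coincide.\<close>

lemma induced_fus:
  assumes "x \<in> lie_alg G GM"
  shows "induced G GM M (\<lambda>g. \<rho> (g, g)) x = induced (G \<times>\<times> G) PP M \<rho> (diag_alg GM x)"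
proof -
  have "lie_exp (G \<times>\<times> G) PP (tscale t (diag_alg GM x)) = (lie_exp G GM (tscale t x), lie_exp G GM (tscale t x))" for t
    using lie_exp_diag[OF tangent_tscale, of x t] assms by (simp add: diag_alg_def dmap_tscale lie_alg_def)
  then show ?thesis by (simp add: induced_def fun_eq_iff)
qed

theorem qham_group_fus: "qham_group G GM B M (\<lambda>g. \<rho> (g, g)) \<omega>' \<Phi>'"
  unfolding qham_group_def
proof (intro conjI allI ballI)
  show "lie_group_action G GM M (\<lambda>g. \<rho> (g, g))" by (rule action_fus)
  show "qham_lie_alg G GM B M (induced G GM M (\<lambda>g. \<rho> (g, g))) \<omega>' \<Phi>'"
    by (rule qham_lie_alg_cong[OF lie qham_fus induced_fus])
  show "\<Phi>' (\<rho> (g, g) m) = g \<cdot> \<Phi>' m \<cdot> iv g" for g m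
    by (simp add: \<Phi>'_eq f12_\<rho>)
qed (rule \<omega>'_invariant)

end

theorem theorem5p6:
  fixes G :: "'g::{t2_space,second_countable_topology} monoid"
    and GM :: "('g, 'e::euclidean_space) mfd"
    and B :: "'g tvec \<Rightarrow> 'g tvec \<Rightarrow> real"
    and M :: "('m::{t2_space,second_countable_topology}, 'd::euclidean_space) mfd"
    and \<omega> :: "'m form2"
    and \<Phi> :: "'m \<Rightarrow> 'g \<times> 'g"
  assumes "lie_group G GM"
    and "inv_inner_product G GM B"
  shows
    "(\<forall>\<rho> :: 'g \<times> 'g \<Rightarrow> 'm \<Rightarrow> 'm.
        qham_group (G \<times>\<times> G) (prod_mfd GM GM) (sum_form GM B) M \<rho> \<omega> \<Phi> \<longrightarrow>
        qham_group G GM B M (\<lambda>g. \<rho> (g, g)) (omega_fus G GM B \<omega> \<Phi>) (Phi_fus G \<Phi>)) \<and>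
     (\<forall>\<A> :: ('g \<times> 'g) tvec \<Rightarrow> 'm \<Rightarrow> 'm tvec.
        qham_lie_alg (G \<times>\<times> G) (prod_mfd GM GM) (sum_form GM B) M \<A> \<omega> \<Phi> \<longrightarrow>
        qham_lie_alg G GM B M (\<lambda>\<xi>. \<A> (diag_alg GM \<xi>)) (omega_fus G GM B \<omega> \<Phi>) (Phi_fus G \<Phi>))"
proof (intro conjI allI impI)
  interpret lie_grp_form G GM B using assms by unfold_locales
  fix \<A> :: "('g \<times> 'g) tvec \<Rightarrow> 'm \<Rightarrow> 'm tvec"
  assume "qham_lie_alg (G \<times>\<times> G) (prod_mfd GM GM) (sum_form GM B) M \<A> \<omega> \<Phi>"
  then interpret fusion G GM B M \<A> \<omega> \<Phi> by unfold_locales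
  show "qham_lie_alg G GM B M (\<lambda>\<xi>. \<A> (diag_alg GM \<xi>)) (omega_fus G GM B \<omega> \<Phi>) (Phi_fus G \<Phi>)"
    by (rule qham_fus)
next
  interpret lie_grp_form G GM B using assms by unfold_locales
  fix \<rho> :: "'g \<times> 'g \<Rightarrow> 'm \<Rightarrow> 'm"
  assume "qham_group (G \<times>\<times> G) (prod_mfd GM GM) (sum_form GM B) M \<rho> \<omega> \<Phi>"
  then interpret group_fusion G GM B M \<rho> \<omega> \<Phi> by unfold_locales (auto simp: qham_group_def)
  show "qham_group G GM B M (\<lambda>g. \<rho> (g, g)) (omega_fus G GM B \<omega> \<Phi>) (Phi_fus G \<Phi>)"
    by (rule qham_group_fus)
qed

end
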